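(* Let $\mathcal{M}$ be a graded manifold with underlying manifold $M$, $\ell\in\mathbb{Z}$, and $H\in\Omega^3_{\mathcal{M}}(M)$ a closed $3$-form of degree $-\ell$. Let $\mathcal{E}=T[\ell]\mathcal{M}\oplus T^*\mathcal{M}$ be the graded Courant algebroid of degree $\ell$ with $\rho(X,\xi)=X$, $\langle(X,\xi),(Y,\eta)\rangle_{\mathcal{E}}=\xi(Y)+(-1)^{|X||Y|}\eta(X)$ and $$[(X,\xi),(Y,\eta)]^H_D=\big([X,Y],(-1)^{|X|\ell}\mathcal{L}_X\eta-(-1)^{|Y|(|X|+\ell)}i_Y\mathrm{d}\xi+(-1)^\ell H(X,Y,\cdot)\big).$$ Let $\Delta:\Gamma_{\mathcal{E}}(M)\to\Gamma_{\mathcal{E}}(M)$ be an $\mathbb{R}$-linear map of degree $1$ and let $\underline{\Delta}$ be a vector field of degree $1$; put $Q:=(-1)^\ell\underline{\Delta}$. Then $\Delta$ is a differential on $\mathcal{E}$ with associated vector field $\underline{\Delta}$ if and only if there is a $2$-form $\theta\in\Omega^2_{\mathcal{M}}(M)$ of degree $|\theta|=1-\ell$ such that $$\Delta(X,\xi)=\big([Q,X],(-1)^\ell\{\mathcal{L}_Q\xi+\theta(X,\cdot)+H(Q,X,\cdot)\}\big)\quad\text{for all }(X,\xi)\in\Gamma_{\mathcal{E}}(M),$$ and $$\mathrm{d}\theta=0,\qquad[Q,Q]=0,\qquad\mathcal{L}_Q(\theta+i_QH)=0.$$ Moreover, if $\ell\neq1$, then for every such $\Delta$ one has $\theta=\mathrm{d}\vartheta$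 for some $\vartheta\in\Omega^1_{\mathcal{M}}(M)$ of degree $1-\ell$, and $\Delta(X,\xi)=[(Q,\vartheta),(X,\xi)]^H_D$ for all $(X,\xi)\in\Gamma_{\mathcal{E}}(M)$.
   Context: **Graded conventions.** Everything is $\mathbb{Z}$-graded; a graded object is a family of its homogeneous components, all elements are homogeneous, $|x|$ is the degree of $x$. A graded manifold $\mathcal{M}=(M,\mathcal{C}^\infty_{\mathcal{M}})$ is a second countable Hausdorff space $M$ with a sheaf of graded commutative associative unital $\mathbb{R}$-algebras ($fg=(-1)^{|f||g|}gf$) with local stalks, locally isomorphic to an open $\hat U\subseteq\mathbb{R}^{n_0}$ with the sheaf of formal power series, with coefficients smooth functions on open subsets of $\hat U$, in finitely many graded commuting variables of non-zero degrees. A graded vector bundle over $\mathcal{M}$ is given by a sheaf $\Gamma_{\mathcal{E}}$ of graded $\mathcal{C}^\infty_{\mathcal{M}}$-modules, locally free of finite graded rank. Sections of $T\mathcal{M}$ are graded derivations (vector fields) $X(fg)=X(f)g+(-1)^{|X||f|}fX(g)$, with $[X,Y]=XY-(-1)^{|X||Y|}YX$. Sections of $T^*\mathcal{M}$ are $1$-forms. The shift $\mathcal{E}[\ell]$ has $(\Gamma_{\mathcal{E}[\ell]})_j=(\Gamma_{\mathcal{E}})_{j+\ell}$ with action $f\triangleright\psi=(-1)^{|f|\ell}f\psi$. In $\mathcal{E}=T[\ell]\mathcal{M}\oplus T^*\mathcal{M}$ one has $|(X,\xi)|=|X|-\ell=|\xi|$, where $|X|,|\xi|$ are the original degrees, and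 functions act by $f(X,\xi)=((-1)^{|f|\ell}fX,f\xi)$. **Forms.** A $p$-form $\omega\in\Omega^p_{\mathcal{M}}(M)$ of degree $|\omega|$ is an $\mathbb{R}$-$p$-linear map on vector fields with values in functions, $|\omega(X_1,\dots,X_p)|=|\omega|+\sum|X_i|$, $\omega(fX_1,\dots)=(-1)^{|f||\omega|}f\omega(X_1,\dots)$, $\omega(\dots,X_i,X_{i+1},\dots)=-(-1)^{|X_i||X_{i+1}|}\omega(\dots,X_{i+1},X_i,\dots)$. $(i_X\omega)(X_1,\dots,X_{p-1})=(-1)^{|\omega|(|X|-1)}\omega(X,X_1,\dots,X_{p-1})$. The exterior product is the associative, degree-additive product with $\omega\wedge\tau=(-1)^{(p+|\omega|)(q+|\tau|)}\tau\wedge\omega$, $f\wedge\omega=f\omega$, $i_X(\omega\wedge\tau)=(i_X\omega)\wedge\tau+(-1)^{(|X|-1)(|\omega|+p)}\omega\wedge i_X\tau$. The exterior differential preserves $|\cdot|$ and is determined by $\mathrm{d}^2=0$, $i_X\mathrm{d}f=X(f)$ and $\mathrm{d}(\omega\wedge\tau)=\mathrm{d}\omega\wedge\tau+(-1)^{|\omega|+p}\omega\wedge\mathrm{d}\tau$. $\mathcal{L}_X=i_X\circ\mathrm{d}+(-1)^{|X|}\mathrm{d}\circ i_X$. **Differential.** For a graded Courant algebroid $(\mathcal{E},\rho,g_{\mathcal{E}},[\cdot,\cdot]_{\mathcal{E}})$ of degree $\ell$ (here the one in the claim), a differential on $\mathcal{E}$ is a degree $1$ $\mathbb{R}$-linear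 map $\Delta:\Gamma_{\mathcal{E}}(M)\to\Gamma_{\mathcal{E}}(M)$ such that (i) $\Delta^2=0$; (ii) there is a vector field $\underline{\Delta}$ with $\Delta(f\psi)=(-1)^{|f|}f\Delta(\psi)+\underline{\Delta}(f)\psi$; (iii) $\underline{\Delta}\langle\psi,\psi'\rangle_{\mathcal{E}}=\langle\Delta(\psi),\psi'\rangle_{\mathcal{E}}+(-1)^{|\psi|+\ell}\langle\psi,\Delta(\psi')\rangle_{\mathcal{E}}$; (iv) $\rho(\Delta(\psi))=(-1)^\ell[\underline{\Delta},\rho(\psi)]$; (v) $\Delta([\psi,\psi']_{\mathcal{E}})=[\Delta(\psi),\psi']_{\mathcal{E}}+(-1)^{|\psi|+\ell}[\psi,\Delta(\psi')]_{\mathcal{E}}$, for all sections $\psi,\psi'$ and functions $f$. *)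

theory Defs
  imports "HOL-Analysis.Analysis"
begin

text \<open>
  A \<open>\<int>\<close>-graded object is a family of homogeneous components, given here by a family of carriers
  \<open>A :: int \<Rightarrow> 'f set\<close> inside an ambient real algebra \<open>'f\<close>. Nothing is lost by using one ambient
  (non-unital) algebra for all section spaces of a sheaf: any family of graded algebras embeds into
  the direct sum of all its components. Only homogeneous elements are ever considered.
\<close>

definition sg :: "int \<Rightarrow> real"
  where "sg k = (if even k then 1 else -1)"

locale graded_comm_algebra =
  fixes A :: "int \<Rightarrow> 'f::real_algebra set" and e :: 'f
  assumes subspace_A: "subspace (A i)"
    and A_disjoint: "i \<noteq> j \<Longrightarrow> A i \<inter> A j = {0}"
    and mult_A: "f \<in> A i \<Longrightarrow> g \<in> A j \<Longrightarrow> f * g \<in> A (i + j)"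
    and unit_A: "e \<in> A 0"
    and unit_mult: "f \<in> A i \<Longrightarrow> e * f = f"
    and graded_comm: "f \<in> A i \<Longrightarrow> g \<in> A j \<Longrightarrow> f * g = sg (i * j) *\<^sub>R (g * f)"


section \<open>Graded manifolds\<close>

record ('p, 'f) graded_ringed_space =
  base :: "'p topology"
  sec :: "'p set \<Rightarrow> int \<Rightarrow> 'f set"
  unit :: "'p set \<Rightarrow> 'f"
  restr :: "'p set \<Rightarrow> 'p set \<Rightarrow> 'f \<Rightarrow> 'f"

locale graded_sheaf =
  fixes M :: "('p, 'f::real_algebra) graded_ringed_space"
  assumes algebra: "openin (base M) U \<Longrightarrow> graded_comm_algebra (sec M U) (unit M U)"
    and restr_sec: "openin (base M) U \<Longrightarrow> openin (base M) V \<Longrightarrow> V \<subseteq> U \<Longrightarrow>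
      f \<in> sec M U k \<Longrightarrow> restr M U V f \<in> sec M V k"
    and restr_add: "openin (base M) U \<Longrightarrow> openin (base M) V \<Longrightarrow> V \<subseteq> U \<Longrightarrow>
      f \<in> sec M U k \<Longrightarrow> g \<in> sec M U k \<Longrightarrow>
      restr M U V (f + g) = restr M U V f + restr M U V g"
    and restr_scale: "openin (base M) U \<Longrightarrow> openin (base M) V \<Longrightarrow> V \<subseteq> U \<Longrightarrow>
      f \<in> sec M U k \<Longrightarrow> restr M U V (c *\<^sub>R f) = c *\<^sub>R restr M U V f"
    and restr_mult: "openin (base M) U \<Longrightarrow> openin (base M) V \<Longrightarrow> V \<subseteq> U \<Longrightarrow>
      f \<in> sec M U i \<Longrightarrow> g \<in> sec M U j \<Longrightarrow>
      restr M U V (f * g) = restr M U V f * restr M U V g"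
    and restr_unit: "openin (base M) U \<Longrightarrow> openin (base M) V \<Longrightarrow> V \<subseteq> U \<Longrightarrow>
      restr M U V (unit M U) = unit M V"
    and restr_refl: "openin (base M) U \<Longrightarrow> f \<in> sec M U k \<Longrightarrow> restr M U U f = f"
    and restr_trans: "openin (base M) U \<Longrightarrow> openin (base M) V \<Longrightarrow> openin (base M) W \<Longrightarrow>
      W \<subseteq> V \<Longrightarrow> V \<subseteq> U \<Longrightarrow> f \<in> sec M U k \<Longrightarrow>
      restr M V W (restr M U V f) = restr M U W f"
    and locality: "(\<And>U. U \<in> \<U> \<Longrightarrow> openin (base M) U) \<Longrightarrow>
      f \<in> sec M (\<Union>\<U>) k \<Longrightarrow> g \<in> sec M (\<Union>\<U>) k \<Longrightarrow>
      (\<And>U. U \<in> \<U> \<Longrightarrow> restr M (\<Union>\<U>) U f = restr M (\<Union>\<U>) U g) \<Longrightarrow> f = g"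
    and gluing: "(\<And>U. U \<in> \<U> \<Longrightarrow> openin (base M) U) \<Longrightarrow>
      (\<And>U. U \<in> \<U> \<Longrightarrow> s U \<in> sec M U k) \<Longrightarrow>
      (\<And>U V. U \<in> \<U> \<Longrightarrow> V \<in> \<U> \<Longrightarrow> restr M U (U \<inter> V) (s U) = restr M V (U \<inter> V) (s V)) \<Longrightarrow>
      \<exists>f \<in> sec M (\<Union>\<U>) k. \<forall>U \<in> \<U>. restr M (\<Union>\<U>) U f = s U"

text \<open>
  Homogeneous ideals of the stalk at \<open>m\<close> are described by the representatives \<open>(U, f)\<close> of the germs
  they contain; such a family of sets of representatives has to be saturated under equality of germs.
\<close>

definition germ_reps :: "('p, 'f::real_algebra) graded_ringed_space \<Rightarrow> 'p \<Rightarrow> int \<Rightarrow> ('p set \<times> 'f) set"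
  where "germ_reps M m k = {(U, f). openin (base M) U \<and> m \<in> U \<and> f \<in> sec M U k}"

definition germ_eq ::
    "('p, 'f::real_algebra) graded_ringed_space \<Rightarrow> 'p \<Rightarrow> 'p set \<times> 'f \<Rightarrow> 'p set \<times> 'f \<Rightarrow> bool"
  where "germ_eq M m = (\<lambda>(U, f) (V, g).
    \<exists>W. openin (base M) W \<and> m \<in> W \<and> W \<subseteq> U \<inter> V \<and> restr M U W f = restr M V W g)"

definition stalk_ideal ::
    "('p, 'f::real_algebra) graded_ringed_space \<Rightarrow> 'p \<Rightarrow> (int \<Rightarrow> ('p set \<times> 'f) set) \<Rightarrow> bool"
  where "stalk_ideal M m I \<longleftrightarrow>
    (\<forall>k. I k \<subseteq> germ_reps M m k) \<and>
    (\<forall>k. \<forall>s \<in> I k. \<forall>t \<in> germ_reps M m k. germ_eq M m s t \<longrightarrow> t \<in> I k) \<and>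
    (\<forall>k U. openin (base M) U \<and> m \<in> U \<longrightarrow> (U, 0) \<in> I k) \<and>
    (\<forall>k U f g. (U, f) \<in> I k \<and> (U, g) \<in> I k \<longrightarrow> (U, f + g) \<in> I k) \<and>
    (\<forall>i k U f h. (U, f) \<in> I k \<and> h \<in> sec M U i \<longrightarrow> (U, h * f) \<in> I (i + k))"

definition maximal_stalk_ideal ::
    "('p, 'f::real_algebra) graded_ringed_space \<Rightarrow> 'p \<Rightarrow> (int \<Rightarrow> ('p set \<times> 'f) set) \<Rightarrow> bool"
  where "maximal_stalk_ideal M m I \<longleftrightarrow>
    stalk_ideal M m I \<and> I \<noteq> germ_reps M m \<and>
    (\<forall>J. stalk_ideal M m J \<and> (\<forall>k. I k \<subseteq> J k) \<longrightarrow> J = I \<or> J = germ_reps M m)"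

text \<open>
  Smooth functions on a subset \<open>U\<close>, open in \<^term>\<open>Euclidean_space n\<close>. Points of
  \<^term>\<open>Euclidean_space n\<close> are sequences vanishing from index \<open>n\<close> on, so that \<open>n = 0\<close> is included.
\<close>

definition partial :: "nat \<Rightarrow> ((nat \<Rightarrow> real) \<Rightarrow> real) \<Rightarrow> (nat \<Rightarrow> real) \<Rightarrow> real"
  where "partial i f x = deriv (\<lambda>t. f (x(i := t))) (x i)"

primrec Ck_on :: "nat \<Rightarrow> nat \<Rightarrow> (nat \<Rightarrow> real) set \<Rightarrow> ((nat \<Rightarrow> real) \<Rightarrow> real) \<Rightarrow> bool"
  where
    "Ck_on n 0 U f \<longleftrightarrow> continuous_map (subtopology (Euclidean_space n) U) euclideanreal f"
  | "Ck_on n (Suc k) U f \<longleftrightarrow>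
      continuous_map (subtopology (Euclidean_space n) U) euclideanreal f \<and>
      (\<forall>i<n. (\<forall>x\<in>U. (\<lambda>t. f (x(i := t))) differentiable at (x i)) \<and> Ck_on n k U (partial i f))"

definition Cinf_on :: "nat \<Rightarrow> (nat \<Rightarrow> real) set \<Rightarrow> ((nat \<Rightarrow> real) \<Rightarrow> real) \<Rightarrow> bool"
  where "Cinf_on n U f \<longleftrightarrow> (\<forall>k. Ck_on n k U f)"

text \<open>
  The model: formal power series \<open>\<Sum>\<^sub>p f\<^sub>p \<xi>\<^sup>p\<close> in graded commuting variables \<open>\<xi>\<^sub>0, \<xi>\<^sub>1, \<dots>\<close> whose degrees
  are listed in \<open>ds\<close>; here \<open>\<xi>\<^sup>p = \<xi>\<^sub>0\<^bsup>p 0\<^esup> \<xi>\<^sub>1\<^bsup>p 1\<^esup> \<dots>\<close>, with exponents at most \<open>1\<close> for variables of odd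
  degree. The function \<open>f p\<close> is the coefficient of \<open>\<xi>\<^sup>p\<close>, extended by zero outside the domain. The
  sign \<open>mono_sign ds q r\<close> is the one in \<open>\<xi>\<^sup>q \<xi>\<^sup>r = \<plusminus> \<xi>\<^bsup>q + r\<^esup>\<close>.
\<close>

type_synonym series = "(nat \<Rightarrow> nat) \<Rightarrow> (nat \<Rightarrow> real) \<Rightarrow> real"

definition exponents :: "int list \<Rightarrow> (nat \<Rightarrow> nat) set"
  where "exponents ds = {p. (\<forall>i\<ge>length ds. p i = 0) \<and> (\<forall>i<length ds. odd (ds ! i) \<longrightarrow> p i \<le> 1)}"

definition mono_deg :: "int list \<Rightarrow> (nat \<Rightarrow> nat) \<Rightarrow> int"
  where "mono_deg ds p = (\<Sum>i<length ds. int (p i) * ds ! i)"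

definition mono_sign :: "int list \<Rightarrow> (nat \<Rightarrow> nat) \<Rightarrow> (nat \<Rightarrow> nat) \<Rightarrow> real"
  where "mono_sign ds q r =
    sg (\<Sum>i<length ds. \<Sum>j<i. (int (q i) * ds ! i) * (int (r j) * ds ! j))"

definition series_sec :: "nat \<Rightarrow> int list \<Rightarrow> (nat \<Rightarrow> real) set \<Rightarrow> int \<Rightarrow> series set"
  where "series_sec n ds U k = {f.
    (\<forall>p. Cinf_on n U (f p)) \<and> (\<forall>p x. x \<notin> U \<longrightarrow> f p x = 0) \<and>
    (\<forall>p. p \<notin> exponents ds \<or> mono_deg ds p \<noteq> k \<longrightarrow> f p = (\<lambda>x. 0))}"

definition series_mult :: "int list \<Rightarrow> series \<Rightarrow> series \<Rightarrow> series"
  where "series_mult ds f g = (\<lambda>p x. if p \<in> exponents ds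
    then \<Sum>q | \<forall>i. q i \<le> p i.
      mono_sign ds q (\<lambda>i. p i - q i) * (f q x * g (\<lambda>i. p i - q i) x)
    else 0)"

definition series_unit :: "(nat \<Rightarrow> real) set \<Rightarrow> series"
  where "series_unit U = (\<lambda>p x. if p = (\<lambda>i. 0) \<and> x \<in> U then 1 else 0)"

definition series_restr :: "(nat \<Rightarrow> real) set \<Rightarrow> series \<Rightarrow> series"
  where "series_restr V f = (\<lambda>p x. if x \<in> V then f p x else 0)"

definition graded_chart ::
    "nat \<Rightarrow> int list \<Rightarrow> ('p, 'f::real_algebra) graded_ringed_space \<Rightarrow> 'p set \<Rightarrow> (nat \<Rightarrow> real) set \<Rightarrow>
     ('p \<Rightarrow> nat \<Rightarrow> real) \<Rightarrow> ('p set \<Rightarrow> 'f \<Rightarrow> series) \<Rightarrow> bool"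
  where "graded_chart n ds M U U' \<phi> \<Phi> \<longleftrightarrow>
    openin (base M) U \<and> openin (Euclidean_space n) U' \<and>
    homeomorphic_map (subtopology (base M) U) (subtopology (Euclidean_space n) U') \<phi> \<and>
    (\<forall>V. openin (base M) V \<and> V \<subseteq> U \<longrightarrow>
      (\<forall>k. bij_betw (\<Phi> V) (sec M V k) (series_sec n ds (\<phi> ` V) k)) \<and>
      (\<forall>k. \<forall>f \<in> sec M V k. \<forall>g \<in> sec M V k. \<Phi> V (f + g) = (\<lambda>p x. \<Phi> V f p x + \<Phi> V g p x)) \<and>
      (\<forall>k c. \<forall>f \<in> sec M V k. \<Phi> V (c *\<^sub>R f) = (\<lambda>p x. c * \<Phi> V f p x)) \<and>
      (\<forall>i j. \<forall>f \<in> sec M V i. \<forall>g \<in> sec M V j.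
        \<Phi> V (f * g) = series_mult ds (\<Phi> V f) (\<Phi> V g)) \<and>
      \<Phi> V (unit M V) = series_unit (\<phi> ` V) \<and>
      (\<forall>k W. \<forall>f \<in> sec M V k. openin (base M) W \<and> W \<subseteq> V \<longrightarrow>
        \<Phi> W (restr M V W f) = series_restr (\<phi> ` W) (\<Phi> V f)))"

locale graded_manifold = graded_sheaf M
  for M :: "('p, 'f::real_algebra) graded_ringed_space" and n :: nat and ds :: "int list" +
  assumes hausdorff: "Hausdorff_space (base M)"
    and second_countable_base: "second_countable (base M)"
    and local_stalks: "m \<in> topspace (base M) \<Longrightarrow> \<exists>!I. maximal_stalk_ideal M m I"
    and nonzero_degrees: "0 \<notin> set ds"
    and charts: "m \<in> topspace (base M) \<Longrightarrow> \<exists>U U' \<phi> \<Phi>. m \<in> U \<and> graded_chart n ds M U U' \<phi> \<Phi>"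

definition global_functions :: "('p, 'f::real_algebra) graded_ringed_space \<Rightarrow> int \<Rightarrow> 'f set"
  where "global_functions M = sec M (topspace (base M))"


section \<open>Vector fields\<close>

text \<open>
  A homogeneous vector field is a pair \<open>V = (|V|, X)\<close> of its degree and a graded derivation \<open>X\<close>, which
  is set to zero outside the homogeneous elements. Carrying the degree along keeps the zero vector
  fields of different degrees apart.
\<close>

type_synonym 'f hvf = "int \<times> ('f \<Rightarrow> 'f)"

definition vfields :: "(int \<Rightarrow> 'f::real_algebra set) \<Rightarrow> 'f hvf set"
  where "vfields A = {(k, X).
    (\<forall>i. \<forall>f \<in> A i. X f \<in> A (i + k)) \<and>
    (\<forall>i. \<forall>f \<in> A i. \<forall>g \<in> A i. X (f + g) = X f + X g) \<and>
    (\<forall>i c. \<forall>f \<in> A i. X (c *\<^sub>R f) = c *\<^sub>R X f) \<and>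
    (\<forall>i j. \<forall>f \<in> A i. \<forall>g \<in> A j. X (f * g) = X f * g + sg (k * i) *\<^sub>R (f * X g)) \<and>
    (\<forall>f. f \<notin> (\<Union>i. A i) \<longrightarrow> X f = 0)}"

definition vadd :: "'f::real_algebra hvf \<Rightarrow> 'f hvf \<Rightarrow> 'f hvf"
  where "vadd V W = (fst V, \<lambda>f. snd V f + snd W f)"

definition vscale :: "real \<Rightarrow> 'f::real_algebra hvf \<Rightarrow> 'f hvf"
  where "vscale c V = (fst V, \<lambda>f. c *\<^sub>R snd V f)"

text \<open>\<open>vmult i f V\<close> is the product \<open>fV\<close> with a function \<open>f\<close> of degree \<open>i\<close>.\<close>

definition vmult :: "int \<Rightarrow> 'f \<Rightarrow> 'f::real_algebra hvf \<Rightarrow> 'f hvf"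
  where "vmult i f V = (i + fst V, \<lambda>g. f * snd V g)"

definition vbracket :: "'f::real_algebra hvf \<Rightarrow> 'f hvf \<Rightarrow> 'f hvf"
  where "vbracket V W = (fst V + fst W,
    \<lambda>f. snd V (snd W f) - sg (fst V * fst W) *\<^sub>R snd W (snd V f))"


section \<open>Differential forms\<close>

type_synonym 'f form = "'f hvf list \<Rightarrow> 'f"

text \<open>
  \<open>forms A p j\<close> is the space of \<open>p\<close>-forms of degree \<open>j\<close>. A form is set to zero on lists
  that are not lists of \<open>p\<close> vector fields; so \<open>0\<close>-forms are the functions \<open>form0 f\<close>. Operations
  on forms whose signs involve degrees get these as additional arguments: in \<open>iprod j V \<omega>\<close>,
  \<open>ext_d A j \<omega>\<close> and \<open>lie A j V \<omega>\<close> the degree of \<open>\<omega>\<close> is \<open>j\<close>.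
\<close>

definition forms :: "(int \<Rightarrow> 'f::real_algebra set) \<Rightarrow> nat \<Rightarrow> int \<Rightarrow> 'f form set"
  where "forms A p j = {\<omega>.
    (\<forall>Vs. length Vs = p \<and> set Vs \<subseteq> vfields A \<longrightarrow> \<omega> Vs \<in> A (j + sum_list (map fst Vs))) \<and>
    (\<forall>Vs. \<not> (length Vs = p \<and> set Vs \<subseteq> vfields A) \<longrightarrow> \<omega> Vs = 0) \<and>
    (\<forall>Us Vs. \<forall>V \<in> vfields A. \<forall>W \<in> vfields A. fst V = fst W \<longrightarrow>
      \<omega> (Us @ vadd V W # Vs) = \<omega> (Us @ V # Vs) + \<omega> (Us @ W # Vs)) \<and>
    (\<forall>Us Vs c. \<forall>V \<in> vfields A. \<omega> (Us @ vscale c V # Vs) = c *\<^sub>R \<omega> (Us @ V # Vs)) \<and>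
    (\<forall>Vs i. \<forall>f \<in> A i. \<forall>V \<in> vfields A.
      \<omega> (vmult i f V # Vs) = sg (i * j) *\<^sub>R (f * \<omega> (V # Vs))) \<and>
    (\<forall>Us Vs. \<forall>V \<in> vfields A. \<forall>W \<in> vfields A.
      \<omega> (Us @ V # W # Vs) = - (sg (fst V * fst W) *\<^sub>R \<omega> (Us @ W # V # Vs)))}"

definition form0 :: "'f::real_algebra \<Rightarrow> 'f form"
  where "form0 f = (\<lambda>Vs. if Vs = [] then f else 0)"

definition iprod :: "int \<Rightarrow> 'f::real_algebra hvf \<Rightarrow> 'f form \<Rightarrow> 'f form"
  where "iprod j V \<omega> = (\<lambda>Vs. sg (j * (fst V - 1)) *\<^sub>R \<omega> (V # Vs))"

text \<open>
  Exterior product of a \<open>p\<close>-form of degree \<open>j\<close> and a form of degree \<open>k\<close>, by recursion along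
  \<open>i\<^sub>V (\<alpha> \<and> \<beta>) = i\<^sub>V \<alpha> \<and> \<beta> + (-1)\<^bsup>(|V| - 1)(j + p)\<^esup> \<alpha> \<and> i\<^sub>V \<beta>\<close>.
\<close>

primrec wedge_eval ::
    "'f hvf list \<Rightarrow> nat \<Rightarrow> int \<Rightarrow> 'f::real_algebra form \<Rightarrow> int \<Rightarrow> 'f form \<Rightarrow> 'f"
  where
    "wedge_eval [] p j \<alpha> k \<beta> = \<alpha> [] * \<beta> []"
  | "wedge_eval (V # Vs) p j \<alpha> k \<beta> = sg ((j + k) * (fst V - 1)) *\<^sub>R
      (wedge_eval Vs (p - 1) (j + fst V) (iprod j V \<alpha>) k \<beta> +
       sg ((fst V - 1) * (j + int p)) *\<^sub>R wedge_eval Vs p j \<alpha> (k + fst V) (iprod k V \<beta>))"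

definition wedge :: "nat \<Rightarrow> int \<Rightarrow> 'f::real_algebra form \<Rightarrow> int \<Rightarrow> 'f form \<Rightarrow> 'f form"
  where "wedge p j \<alpha> k \<beta> = (\<lambda>Vs. wedge_eval Vs p j \<alpha> k \<beta>)"

text \<open>
  The exterior differential is constructed from its Cartan recursion
  \<open>i\<^sub>V d\<omega> = D\<^sub>V \<omega> - (-1)\<^bsup>|V|\<^esup> d (i\<^sub>V \<omega>)\<close>, where \<open>D\<^sub>V\<close> is the natural action of \<open>V\<close> on
  multilinear maps. That it has the properties by which the exterior differential is characterised
  (\<open>exterior_differential\<close> below) is proved at the end of this theory; in particular \<open>D\<^sub>V\<close> agrees with
  the Lie derivative \<open>lie\<close>.
\<close>

definition nat_lie :: "(int \<Rightarrow> 'f::real_algebra set) \<Rightarrow> int \<Rightarrow> 'f hvf \<Rightarrow> 'f form \<Rightarrow> 'f form"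
  where "nat_lie A j V \<omega> = (\<lambda>Ws. if set (V # Ws) \<subseteq> vfields A
    then snd V (\<omega> Ws) - (\<Sum>i<length Ws. sg (fst V * (j + sum_list (map fst (take i Ws)))) *\<^sub>R
      \<omega> (Ws[i := vbracket V (Ws ! i)]))
    else 0)"

primrec ext_d_eval ::
    "(int \<Rightarrow> 'f set) \<Rightarrow> 'f::real_algebra hvf list \<Rightarrow> int \<Rightarrow> 'f form \<Rightarrow> 'f"
  where
    "ext_d_eval A [] j \<omega> = 0"
  | "ext_d_eval A (V # Vs) j \<omega> = sg (j * (fst V - 1)) *\<^sub>R
      (nat_lie A j V \<omega> Vs - sg (fst V) *\<^sub>R ext_d_eval A Vs (j + fst V) (iprod j V \<omega>))"

definition ext_d :: "(int \<Rightarrow> 'f::real_algebra set) \<Rightarrow> int \<Rightarrow> 'f form \<Rightarrow> 'f form"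
  where "ext_d A j \<omega> = (\<lambda>Vs. ext_d_eval A Vs j \<omega>)"

definition exterior_differential ::
    "(int \<Rightarrow> 'f::real_algebra set) \<Rightarrow> (int \<Rightarrow> 'f form \<Rightarrow> 'f form) \<Rightarrow> bool"
  where "exterior_differential A d \<longleftrightarrow>
    (\<forall>p j. \<forall>\<omega> \<in> forms A p j. d j \<omega> \<in> forms A (Suc p) j) \<and>
    (\<forall>p j. \<forall>\<omega> \<in> forms A p j. \<forall>\<tau> \<in> forms A p j.
      d j (\<lambda>Vs. \<omega> Vs + \<tau> Vs) = (\<lambda>Vs. d j \<omega> Vs + d j \<tau> Vs)) \<and>
    (\<forall>p j c. \<forall>\<omega> \<in> forms A p j. d j (\<lambda>Vs. c *\<^sub>R \<omega> Vs) = (\<lambda>Vs. c *\<^sub>R d j \<omega> Vs)) \<and>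
    (\<forall>p j. \<forall>\<omega> \<in> forms A p j. d j (d j \<omega>) = (\<lambda>Vs. 0)) \<and>
    (\<forall>i. \<forall>f \<in> A i. \<forall>V \<in> vfields A. iprod i V (d i (form0 f)) = form0 (snd V f)) \<and>
    (\<forall>p j q k. \<forall>\<omega> \<in> forms A p j. \<forall>\<tau> \<in> forms A q k.
      d (j + k) (wedge p j \<omega> k \<tau>) = (\<lambda>Vs. wedge (p + 1) j (d j \<omega>) k \<tau> Vs +
        sg (j + int p) *\<^sub>R wedge p j \<omega> k (d k \<tau>) Vs))"

definition lie :: "(int \<Rightarrow> 'f::real_algebra set) \<Rightarrow> int \<Rightarrow> 'f hvf \<Rightarrow> 'f form \<Rightarrow> 'f form"
  where "lie A j V \<omega> = (\<lambda>Ws. iprod j V (ext_d A j \<omega>) Ws +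
    sg (fst V) *\<^sub>R ext_d A (j + fst V) (iprod j V \<omega>) Ws)"


section \<open>The graded Courant algebroid \<open>T[l]M \<oplus> T\<^sup>*M\<close>\<close>

text \<open>
  \<open>sections A l j\<close> are the sections \<open>(X, \<xi>)\<close> of degree \<open>j\<close>, so \<open>|X| = j + l\<close> and \<open>|\<xi>| = j\<close>; the
  degrees in the formulas below are recovered from \<open>|\<xi>| = |X| - l\<close>.
\<close>

type_synonym 'f esection = "'f hvf \<times> 'f form"

definition sections :: "(int \<Rightarrow> 'f::real_algebra set) \<Rightarrow> int \<Rightarrow> int \<Rightarrow> 'f esection set"
  where "sections A l j = {(X, \<xi>). X \<in> vfields A \<and> fst X = j + l \<and> \<xi> \<in> forms A 1 j}"

definition sadd :: "'f::real_algebra esection \<Rightarrow> 'f esection \<Rightarrow> 'f esection"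
  where "sadd = (\<lambda>(X, \<xi>) (Y, \<eta>). (vadd X Y, \<lambda>Vs. \<xi> Vs + \<eta> Vs))"

definition sscale :: "real \<Rightarrow> 'f::real_algebra esection \<Rightarrow> 'f esection"
  where "sscale c = (\<lambda>(X, \<xi>). (vscale c X, \<lambda>Vs. c *\<^sub>R \<xi> Vs))"

text \<open>The action of a function \<open>f\<close> of degree \<open>i\<close>.\<close>

definition smult :: "int \<Rightarrow> int \<Rightarrow> 'f \<Rightarrow> 'f::real_algebra esection \<Rightarrow> 'f esection"
  where "smult l i f = (\<lambda>(X, \<xi>). (vscale (sg (i * l)) (vmult i f X), \<lambda>Vs. f * \<xi> Vs))"

definition anchor :: "'f::real_algebra esection \<Rightarrow> 'f hvf"
  where "anchor = (\<lambda>(X, \<xi>). X)"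

definition pairing :: "'f::real_algebra esection \<Rightarrow> 'f esection \<Rightarrow> 'f"
  where "pairing = (\<lambda>(X, \<xi>) (Y, \<eta>). \<xi> [Y] + sg (fst X * fst Y) *\<^sub>R \<eta> [X])"

definition dorfman ::
    "(int \<Rightarrow> 'f::real_algebra set) \<Rightarrow> int \<Rightarrow> 'f form \<Rightarrow> 'f esection \<Rightarrow> 'f esection \<Rightarrow> 'f esection"
  where "dorfman A l H = (\<lambda>(X, \<xi>) (Y, \<eta>). (vbracket X Y,
    \<lambda>Vs. sg (fst X * l) *\<^sub>R lie A (fst Y - l) X \<eta> Vs
      - sg (fst Y * (fst X + l)) *\<^sub>R iprod (fst X - l) Y (ext_d A (fst X - l) \<xi>) Vs
      + sg l *\<^sub>R H (X # Y # Vs)))"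

definition linear_degree_1 ::
    "(int \<Rightarrow> 'f::real_algebra set) \<Rightarrow> int \<Rightarrow> ('f esection \<Rightarrow> 'f esection) \<Rightarrow> bool"
  where "linear_degree_1 A l \<Delta> \<longleftrightarrow>
    (\<forall>j. \<forall>\<psi> \<in> sections A l j. \<Delta> \<psi> \<in> sections A l (j + 1)) \<and>
    (\<forall>j. \<forall>\<psi> \<in> sections A l j. \<forall>\<psi>' \<in> sections A l j. \<Delta> (sadd \<psi> \<psi>') = sadd (\<Delta> \<psi>) (\<Delta> \<psi>')) \<and>
    (\<forall>j c. \<forall>\<psi> \<in> sections A l j. \<Delta> (sscale c \<psi>) = sscale c (\<Delta> \<psi>))"

text \<open>\<open>courant_differential A l H \<Delta> D\<close>: the map \<open>\<Delta>\<close> is a differential with associated vector field \<open>D\<close>.\<close>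

definition courant_differential ::
    "(int \<Rightarrow> 'f::real_algebra set) \<Rightarrow> int \<Rightarrow> 'f form \<Rightarrow> ('f esection \<Rightarrow> 'f esection) \<Rightarrow> 'f hvf \<Rightarrow> bool"
  where "courant_differential A l H \<Delta> D \<longleftrightarrow>
    linear_degree_1 A l \<Delta> \<and> D \<in> vfields A \<and> fst D = 1 \<and>
    (\<forall>j. \<forall>\<psi> \<in> sections A l j. \<Delta> (\<Delta> \<psi>) = ((j + 2 + l, \<lambda>f. 0), \<lambda>Vs. 0)) \<and>
    (\<forall>i j. \<forall>f \<in> A i. \<forall>\<psi> \<in> sections A l j.
      \<Delta> (smult l i f \<psi>) =
        sadd (sscale (sg i) (smult l i f (\<Delta> \<psi>))) (smult l (i + 1) (snd D f) \<psi>)) \<and>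
    (\<forall>j k. \<forall>\<psi> \<in> sections A l j. \<forall>\<psi>' \<in> sections A l k.
      snd D (pairing \<psi> \<psi>') = pairing (\<Delta> \<psi>) \<psi>' + sg (j + l) *\<^sub>R pairing \<psi> (\<Delta> \<psi>')) \<and>
    (\<forall>j. \<forall>\<psi> \<in> sections A l j.
      anchor (\<Delta> \<psi>) = vscale (sg l) (vbracket D (anchor \<psi>))) \<and>
    (\<forall>j k. \<forall>\<psi> \<in> sections A l j. \<forall>\<psi>' \<in> sections A l k.
      \<Delta> (dorfman A l H \<psi> \<psi>') =
        sadd (dorfman A l H (\<Delta> \<psi>) \<psi>') (sscale (sg (j + l)) (dorfman A l H \<psi> (\<Delta> \<psi>'))))"


section \<open>Properties of the exterior calculus\<close>

lemma sg_sg [simp]: "sg k * sg k = 1" and sg_0 [simp]: "sg 0 = 1"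
  and sg_scale_sg [simp]: "sg k *\<^sub>R sg k *\<^sub>R (x :: 'a::real_vector) = x"
  by (auto simp: sg_def)

lemma sg_add: "sg (a + b) = sg a * sg b" and sg_diff: "sg (a - b) = sg a * sg b"
  by (auto simp: sg_def)

lemma sg_scale_cancel [simp]: "sg k *\<^sub>R x = sg k *\<^sub>R y \<longleftrightarrow> x = (y :: 'a::real_vector)"
  by (auto simp: sg_def)

lemma fst_vops [simp]:
  "fst (vadd V W) = fst V" "fst (vscale c V) = fst V" "fst (vmult i f V) = i + fst V"
  "fst (vbracket V W) = fst V + fst W"
  by (simp_all add: vadd_def vscale_def vmult_def vbracket_def)

lemma snd_vops:
  "snd (vadd V W) = (\<lambda>f. snd V f + snd W f)" "snd (vscale c V) = (\<lambda>f. c *\<^sub>R snd V f)"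
  "snd (vmult i f V) = (\<lambda>g. f * snd V g)"
  "snd (vbracket V W) = (\<lambda>f. snd V (snd W f) - sg (fst V * fst W) *\<^sub>R snd W (snd V f))"
  by (simp_all add: vadd_def vscale_def vmult_def vbracket_def)

lemma iprod_lin [simp]:
  "iprod j V (\<lambda>Vs. \<alpha> Vs + \<beta> Vs) = (\<lambda>Vs. iprod j V \<alpha> Vs + iprod j V \<beta> Vs)"
  "iprod j V (\<lambda>Vs. \<alpha> Vs - \<beta> Vs) = (\<lambda>Vs. iprod j V \<alpha> Vs - iprod j V \<beta> Vs)"
  "iprod j V (\<lambda>Vs. c *\<^sub>R \<alpha> Vs) = (\<lambda>Vs. c *\<^sub>R iprod j V \<alpha> Vs)"
  "iprod j V (\<lambda>Vs. 0) = (\<lambda>Vs. 0)"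
  by (simp_all add: iprod_def scaleR_right_distrib scaleR_right_diff_distrib mult.commute)

lemma iprod_fmult:
  "iprod (i + j) V (\<lambda>Vs. f * \<omega> Vs) = (\<lambda>Vs. sg (i * (fst V - 1)) *\<^sub>R (f * iprod j V \<omega> Vs))"
  by (simp add: iprod_def sg_def fun_eq_iff)

lemma iprod_form0 [simp]: "iprod j V (form0 f) = (\<lambda>Vs. 0)"
  by (simp add: iprod_def form0_def)

lemma eval_iprod: "\<omega> (V # Vs) = sg (j * (fst V - 1)) *\<^sub>R iprod j V \<omega> Vs"
  by (simp add: iprod_def)

context graded_comm_algebra
begin

lemma A_0 [simp]: "0 \<in> A i"
  and A_add: "f \<in> A i \<Longrightarrow> g \<in> A i \<Longrightarrow> f + g \<in> A i"
  and A_diff: "f \<in> A i \<Longrightarrow> g \<in> A i \<Longrightarrow> f - g \<in> A i"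
  and A_scale: "f \<in> A i \<Longrightarrow> c *\<^sub>R f \<in> A i"
  and A_neg: "f \<in> A i \<Longrightarrow> - f \<in> A i"
  using subspace_A[of i]
  by (auto simp: subspace_0 subspace_add subspace_diff subspace_mul subspace_neg)

lemma A_sum: "(\<And>x. x \<in> S \<Longrightarrow> f x \<in> A i) \<Longrightarrow> sum f S \<in> A i"
  using subspace_A by (rule subspace_sum)

lemma A_cong: "f \<in> A i \<Longrightarrow> i = j \<Longrightarrow> f \<in> A j"
  by simp

subsection \<open>Vector fields\<close>

lemma vfieldD:
  assumes "V \<in> vfields A"
  shows "f \<in> A i \<Longrightarrow> snd V f \<in> A (i + fst V)"
    and "f \<in> A i \<Longrightarrow> g \<in> A i \<Longrightarrow> snd V (f + g) = snd V f + snd V g"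
    and "f \<in> A i \<Longrightarrow> snd V (c *\<^sub>R f) = c *\<^sub>R snd V f"
    and "f \<in> A i \<Longrightarrow> g \<in> A j \<Longrightarrow> snd V (f * g) = snd V f * g + sg (fst V * i) *\<^sub>R (f * snd V g)"
    and "f \<notin> (\<Union>i. A i) \<Longrightarrow> snd V f = 0"
  using assms unfolding vfields_def by fastforce+

lemma vfield_0 [simp]: "V \<in> vfields A \<Longrightarrow> snd V 0 = 0"
  using vfieldD(3)[of V 0 0 0] by simp

lemma vfield_diff:
  assumes "V \<in> vfields A" "f \<in> A i" "g \<in> A i"
  shows "snd V (f - g) = snd V f - snd V g"
  using vfieldD(2)[OF assms(1) assms(2), of "- g"] vfieldD(3)[OF assms(1) assms(3), of "-1"]
    A_neg[OF assms(3)] by simp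

lemma vfield_sum:
  assumes "V \<in> vfields A" "finite S" "\<And>x. x \<in> S \<Longrightarrow> f x \<in> A i"
  shows "snd V (sum f S) = (\<Sum>x\<in>S. snd V (f x))"
  using assms(2,3)
proof (induction S rule: finite_induct)
  case (insert x S)
  then show ?case
    using vfieldD(2)[OF assms(1), of "f x" i "sum f S"] A_sum[of S f i] by simp
qed (simp add: assms)

lemma vfieldI:
  assumes "\<And>i f. f \<in> A i \<Longrightarrow> X f \<in> A (i + k)"
    and "\<And>i f g. f \<in> A i \<Longrightarrow> g \<in> A i \<Longrightarrow> X (f + g) = X f + X g"
    and "\<And>i f c. f \<in> A i \<Longrightarrow> X (c *\<^sub>R f) = c *\<^sub>R X f"
    and "\<And>i j f g. f \<in> A i \<Longrightarrow> g \<in> A j \<Longrightarrow> X (f * g) = X f * g + sg (k * i) *\<^sub>R (f * X g)"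
    and "\<And>f. f \<notin> (\<Union>i. A i) \<Longrightarrow> X f = 0"
  shows "(k, X) \<in> vfields A"
  using assms unfolding vfields_def by simp

lemma vadd_in:
  assumes V: "V \<in> vfields A" and W: "W \<in> vfields A" and eq: "fst V = fst W"
  shows "vadd V W \<in> vfields A"
  unfolding vadd_def
proof (rule vfieldI)
  fix i f assume f: "f \<in> A i"
  show "snd V f + snd W f \<in> A (i + fst V)"
    using vfieldD(1)[OF V f] vfieldD(1)[OF W f] eq by (simp add: A_add)
  show "snd V (c *\<^sub>R f) + snd W (c *\<^sub>R f) = c *\<^sub>R (snd V f + snd W f)" for c
    by (simp add: vfieldD(3)[OF V f] vfieldD(3)[OF W f] scaleR_right_distrib)
  show "snd V (f + g) + snd W (f + g) = snd V f + snd W f + (snd V g + snd W g)" if "g \<in> A i" for g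
    by (simp add: vfieldD(2)[OF V f that] vfieldD(2)[OF W f that])
  show "snd V (f * g) + snd W (f * g) =
      (snd V f + snd W f) * g + sg (fst V * i) *\<^sub>R (f * (snd V g + snd W g))" if "g \<in> A j" for g j
    by (simp add: vfieldD(4)[OF V f that] vfieldD(4)[OF W f that] eq algebra_simps)
qed (simp add: vfieldD(5)[OF V] vfieldD(5)[OF W])

lemma vscale_in:
  assumes V: "V \<in> vfields A"
  shows "vscale c V \<in> vfields A"
  unfolding vscale_def
proof (rule vfieldI)
  fix i f assume f: "f \<in> A i"
  show "c *\<^sub>R snd V f \<in> A (i + fst V)"
    using vfieldD(1)[OF V f] by (simp add: A_scale)
  show "c *\<^sub>R snd V (a *\<^sub>R f) = a *\<^sub>R c *\<^sub>R snd V f" for a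
    by (simp add: vfieldD(3)[OF V f] mult.commute)
  show "c *\<^sub>R snd V (f + g) = c *\<^sub>R snd V f + c *\<^sub>R snd V g" if "g \<in> A i" for g
    by (simp add: vfieldD(2)[OF V f that] scaleR_right_distrib)
  show "c *\<^sub>R snd V (f * g) = c *\<^sub>R snd V f * g + sg (fst V * i) *\<^sub>R (f * c *\<^sub>R snd V g)"
    if "g \<in> A j" for g j
    by (simp add: vfieldD(4)[OF V f that] scaleR_right_distrib mult.commute)
qed (simp add: vfieldD(5)[OF V])

lemma vmult_in:
  assumes V: "V \<in> vfields A" and f: "f \<in> A i"
  shows "vmult i f V \<in> vfields A"
  unfolding vmult_def
proof (rule vfieldI)
  fix k g assume g: "g \<in> A k"
  show "f * snd V g \<in> A (k + (i + fst V))"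
    by (rule A_cong[OF mult_A[OF f vfieldD(1)[OF V g]]]) simp
  fix h j assume h: "h \<in> A j"
  have "f * (g * snd V h) = sg (i * k) *\<^sub>R (g * (f * snd V h))"
    using graded_comm[OF f g] by (simp flip: mult.assoc)
  then show "f * snd V (g * h) = f * snd V g * h + sg ((i + fst V) * k) *\<^sub>R (g * (f * snd V h))"
    by (simp add: vfieldD(4)[OF V g h] distrib_left sg_add distrib_right mult.assoc)
  show "f * snd V (g + h) = f * snd V g + f * snd V h" if "h \<in> A k" for h
    by (simp add: vfieldD(2)[OF V g that] distrib_left)
  show "f * snd V (c *\<^sub>R g) = c *\<^sub>R (f * snd V g)" for c
    by (simp add: vfieldD(3)[OF V g])
qed (simp add: vfieldD(5)[OF V])

lemma vbracket_in:
  assumes V: "V \<in> vfields A" and W: "W \<in> vfields A"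
  shows "vbracket V W \<in> vfields A"
  unfolding vbracket_def
proof (rule vfieldI)
  fix k g assume g: "g \<in> A k"
  have in1: "snd V (snd W g) \<in> A (k + (fst V + fst W))"
    by (rule A_cong[OF vfieldD(1)[OF V vfieldD(1)[OF W g]]]) simp
  have in2: "snd W (snd V g) \<in> A (k + (fst V + fst W))"
    by (rule A_cong[OF vfieldD(1)[OF W vfieldD(1)[OF V g]]]) simp
  show "snd V (snd W g) - sg (fst V * fst W) *\<^sub>R snd W (snd V g) \<in> A (k + (fst V + fst W))"
    by (intro A_diff A_scale in1 in2)
  show "snd V (snd W (c *\<^sub>R g)) - sg (fst V * fst W) *\<^sub>R snd W (snd V (c *\<^sub>R g)) =
     c *\<^sub>R (snd V (snd W g) - sg (fst V * fst W) *\<^sub>R snd W (snd V g))" for c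
    by (simp add: vfieldD(3)[OF V g] vfieldD(3)[OF W g] vfieldD(3)[OF V vfieldD(1)[OF W g]]
        vfieldD(3)[OF W vfieldD(1)[OF V g]] scaleR_right_diff_distrib mult.commute)
  {
    fix h assume h: "h \<in> A k"
    show "snd V (snd W (g + h)) - sg (fst V * fst W) *\<^sub>R snd W (snd V (g + h)) =
       snd V (snd W g) - sg (fst V * fst W) *\<^sub>R snd W (snd V g) +
       (snd V (snd W h) - sg (fst V * fst W) *\<^sub>R snd W (snd V h))"
      by (simp add: vfieldD(2)[OF V g h] vfieldD(2)[OF W g h]
          vfieldD(2)[OF V vfieldD(1)[OF W g] vfieldD(1)[OF W h]]
          vfieldD(2)[OF W vfieldD(1)[OF V g] vfieldD(1)[OF V h]] scaleR_right_distrib)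
  }
  fix h j assume h: "h \<in> A j"
  have *: "snd V (snd W (g * h)) = snd V (snd W g) * h
      + sg (fst V * (k + fst W)) *\<^sub>R (snd W g * snd V h)
      + sg (fst W * k) *\<^sub>R (snd V g * snd W h) + (sg (fst W * k) * sg (fst V * k)) *\<^sub>R (g * snd V (snd W h))"
    if V: "V \<in> vfields A" and W: "W \<in> vfields A" for V W
  proof -
    have a: "snd W g * h \<in> A (k + fst W + j)" "g * snd W h \<in> A (k + fst W + j)"
      using mult_A[OF vfieldD(1)[OF W g] h] mult_A[OF g vfieldD(1)[OF W h]] by (simp_all add: ac_simps)
    show ?thesis
      by (simp add: vfieldD(4)[OF W g h] vfieldD(2)[OF V a(1) A_scale[OF a(2)]] vfieldD(3)[OF V a(2)]
          vfieldD(4)[OF V vfieldD(1)[OF W g] h] vfieldD(4)[OF V g vfieldD(1)[OF W h]]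
          scaleR_right_distrib mult.commute)
  qed
  show "snd V (snd W (g * h)) - sg (fst V * fst W) *\<^sub>R snd W (snd V (g * h)) =
       (snd V (snd W g) - sg (fst V * fst W) *\<^sub>R snd W (snd V g)) * h +
       sg ((fst V + fst W) * k) *\<^sub>R (g * (snd V (snd W h) - sg (fst V * fst W) *\<^sub>R snd W (snd V h)))"
    unfolding *[OF V W] *[OF W V]
    by (cases "even (fst V)"; cases "even (fst W)"; cases "even k";
        simp add: sg_def algebra_simps)
qed (use V W in \<open>simp add: vfieldD(5)\<close>)


subsection \<open>Forms\<close>

lemma formD:
  assumes "\<omega> \<in> forms A p j"
  shows "length Vs = p \<Longrightarrow> set Vs \<subseteq> vfields A \<Longrightarrow> \<omega> Vs \<in> A (j + sum_list (map fst Vs))"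
    and "\<not> (length Vs = p \<and> set Vs \<subseteq> vfields A) \<Longrightarrow> \<omega> Vs = 0"
    and "V \<in> vfields A \<Longrightarrow> W \<in> vfields A \<Longrightarrow> fst V = fst W \<Longrightarrow>
      \<omega> (Us @ vadd V W # Vs) = \<omega> (Us @ V # Vs) + \<omega> (Us @ W # Vs)"
    and "V \<in> vfields A \<Longrightarrow> \<omega> (Us @ vscale c V # Vs) = c *\<^sub>R \<omega> (Us @ V # Vs)"
    and "f \<in> A i \<Longrightarrow> V \<in> vfields A \<Longrightarrow>
      \<omega> (vmult i f V # Vs) = sg (i * j) *\<^sub>R (f * \<omega> (V # Vs))"
    and "V \<in> vfields A \<Longrightarrow> W \<in> vfields A \<Longrightarrow>
      \<omega> (Us @ V # W # Vs) = - (sg (fst V * fst W) *\<^sub>R \<omega> (Us @ W # V # Vs))"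
proof -
  note c = assms[unfolded forms_def mem_Collect_eq]
  show "length Vs = p \<Longrightarrow> set Vs \<subseteq> vfields A \<Longrightarrow> \<omega> Vs \<in> A (j + sum_list (map fst Vs))"
    using c[THEN conjunct1] by blast
  show "\<not> (length Vs = p \<and> set Vs \<subseteq> vfields A) \<Longrightarrow> \<omega> Vs = 0"
    using c[THEN conjunct2, THEN conjunct1] by blast
  show "V \<in> vfields A \<Longrightarrow> W \<in> vfields A \<Longrightarrow> fst V = fst W \<Longrightarrow>
      \<omega> (Us @ vadd V W # Vs) = \<omega> (Us @ V # Vs) + \<omega> (Us @ W # Vs)"
    using c[THEN conjunct2, THEN conjunct2, THEN conjunct1] by blast
  show "V \<in> vfields A \<Longrightarrow> \<omega> (Us @ vscale c V # Vs) = c *\<^sub>R \<omega> (Us @ V # Vs)"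
    using c[THEN conjunct2, THEN conjunct2, THEN conjunct2, THEN conjunct1] by blast
  show "f \<in> A i \<Longrightarrow> V \<in> vfields A \<Longrightarrow>
      \<omega> (vmult i f V # Vs) = sg (i * j) *\<^sub>R (f * \<omega> (V # Vs))"
    using c[THEN conjunct2, THEN conjunct2, THEN conjunct2, THEN conjunct2, THEN conjunct1] by blast
  show "V \<in> vfields A \<Longrightarrow> W \<in> vfields A \<Longrightarrow>
      \<omega> (Us @ V # W # Vs) = - (sg (fst V * fst W) *\<^sub>R \<omega> (Us @ W # V # Vs))"
    using c[THEN conjunct2, THEN conjunct2, THEN conjunct2, THEN conjunct2, THEN conjunct2] by blast
qed

lemma formI:
  assumes "\<And>Vs. length Vs = p \<Longrightarrow> set Vs \<subseteq> vfields A \<Longrightarrow> \<omega> Vs \<in> A (j + sum_list (map fst Vs))"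
    and "\<And>Vs. \<not> (length Vs = p \<and> set Vs \<subseteq> vfields A) \<Longrightarrow> \<omega> Vs = 0"
    and "\<And>Us V W Vs. V \<in> vfields A \<Longrightarrow> W \<in> vfields A \<Longrightarrow> fst V = fst W \<Longrightarrow>
      \<omega> (Us @ vadd V W # Vs) = \<omega> (Us @ V # Vs) + \<omega> (Us @ W # Vs)"
    and "\<And>Us V c Vs. V \<in> vfields A \<Longrightarrow> \<omega> (Us @ vscale c V # Vs) = c *\<^sub>R \<omega> (Us @ V # Vs)"
    and "\<And>V f i Vs. f \<in> A i \<Longrightarrow> V \<in> vfields A \<Longrightarrow>
      \<omega> (vmult i f V # Vs) = sg (i * j) *\<^sub>R (f * \<omega> (V # Vs))"
    and "\<And>Us V W Vs. V \<in> vfields A \<Longrightarrow> W \<in> vfields A \<Longrightarrow>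
      \<omega> (Us @ V # W # Vs) = - (sg (fst V * fst W) *\<^sub>R \<omega> (Us @ W # V # Vs))"
  shows "\<omega> \<in> forms A p j"
  unfolding forms_def mem_Collect_eq
  by (intro conjI allI ballI impI; (elim conjE)?; rule assms; assumption)

lemma form_zero_in [simp]: "(\<lambda>Vs. 0) \<in> forms A p j"
  by (rule formI) auto

lemma form_add_in:
  assumes w: "\<omega> \<in> forms A p j" and t: "\<tau> \<in> forms A p j"
  shows "(\<lambda>Vs. \<omega> Vs + \<tau> Vs) \<in> forms A p j"
proof (rule formI)
  show "\<omega> (Us @ V # W # Vs) + \<tau> (Us @ V # W # Vs) =
      - (sg (fst V * fst W) *\<^sub>R (\<omega> (Us @ W # V # Vs) + \<tau> (Us @ W # V # Vs)))"
    if "V \<in> vfields A" "W \<in> vfields A" for Us V W Vs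
    by (subst formD(6)[OF w that], subst formD(6)[OF t that]) (simp add: scaleR_right_distrib)
qed (simp_all add: formD(1-5)[OF w] formD(1-5)[OF t] A_add scaleR_right_distrib distrib_left)

lemma form_scale_in:
  assumes w: "\<omega> \<in> forms A p j"
  shows "(\<lambda>Vs. c *\<^sub>R \<omega> Vs) \<in> forms A p j"
proof (rule formI)
  show "c *\<^sub>R \<omega> (Us @ V # W # Vs) = - (sg (fst V * fst W) *\<^sub>R (c *\<^sub>R \<omega> (Us @ W # V # Vs)))"
    if "V \<in> vfields A" "W \<in> vfields A" for Us V W Vs
    by (subst formD(6)[OF w that]) (simp add: mult.commute)
qed (simp_all add: formD(1-5)[OF w] A_scale scaleR_right_distrib mult.commute)

lemma form_diff_in:
  assumes "\<omega> \<in> forms A p j" "\<tau> \<in> forms A p j"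
  shows "(\<lambda>Vs. \<omega> Vs - \<tau> Vs) \<in> forms A p j"
  using form_add_in[OF assms(1) form_scale_in[OF assms(2), of "-1"]] by simp

lemma form_fmult_in:
  assumes f: "f \<in> A i" and w: "\<omega> \<in> forms A p j"
  shows "(\<lambda>Vs. f * \<omega> Vs) \<in> forms A p (i + j)"
proof (rule formI)
  show "f * \<omega> Vs \<in> A (i + j + sum_list (map fst Vs))" if "length Vs = p" "set Vs \<subseteq> vfields A" for Vs
    using mult_A[OF f formD(1)[OF w that]] by (simp add: add.assoc)
  show "f * \<omega> (vmult k g V # Vs) = sg (k * (i + j)) *\<^sub>R (g * (f * \<omega> (V # Vs)))"
    if g: "g \<in> A k" and V: "V \<in> vfields A" for k g V Vs
  proof -
    have "f * (g * x) = sg (k * i) *\<^sub>R (g * (f * x))" for x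
      using graded_comm[OF f g] by (simp add: mult.commute flip: mult.assoc)
    then show ?thesis
      by (simp add: formD(5)[OF w g V] distrib_left sg_add mult.commute)
  qed
  show "f * \<omega> (Us @ V # W # Vs) = - (sg (fst V * fst W) *\<^sub>R (f * \<omega> (Us @ W # V # Vs)))"
    if "V \<in> vfields A" "W \<in> vfields A" for Us V W Vs
    by (subst formD(6)[OF w that]) simp
qed (simp_all add: formD(2-4)[OF w] distrib_left)

lemma form_0_iff: "\<omega> \<in> forms A 0 j \<longleftrightarrow> (\<exists>f \<in> A j. \<omega> = form0 f)"
proof
  assume \<omega>: "\<omega> \<in> forms A 0 j"
  have "\<omega> [] \<in> A j"
    using formD(1)[OF \<omega>, of "[]"] by simp
  moreover have "\<omega> = form0 (\<omega> [])"
    using formD(2)[OF \<omega>] by (auto simp: form0_def fun_eq_iff)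
  ultimately show "\<exists>f \<in> A j. \<omega> = form0 f" by blast
next
  show "\<exists>f \<in> A j. \<omega> = form0 f \<Longrightarrow> \<omega> \<in> forms A 0 j"
    by (auto simp: form0_def intro!: formI split: if_splits)
qed

lemma iprod_form_0: "\<omega> \<in> forms A 0 j \<Longrightarrow> iprod k V \<omega> = (\<lambda>Vs. 0)"
  by (auto simp: form_0_iff)

lemma iprod_not_vfield: "\<omega> \<in> forms A p j \<Longrightarrow> V \<notin> vfields A \<Longrightarrow> iprod k V \<omega> = (\<lambda>Vs. 0)"
  by (simp add: iprod_def formD(2) fun_eq_iff)

lemma iprod_in:
  assumes \<omega>: "\<omega> \<in> forms A (Suc p) j" and V: "V \<in> vfields A"
  shows "iprod j V \<omega> \<in> forms A p (j + fst V)"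
proof -
  have "(\<lambda>Vs. \<omega> (V # Vs)) \<in> forms A p (j + fst V)"
  proof (rule formI)
    show "\<omega> (V # Vs) \<in> A (j + fst V + sum_list (map fst Vs))"
      if "length Vs = p" "set Vs \<subseteq> vfields A" for Vs
      using formD(1)[OF \<omega>, of "V # Vs"] that V by (simp add: add.assoc)
    show "\<omega> (V # Vs) = 0" if "\<not> (length Vs = p \<and> set Vs \<subseteq> vfields A)" for Vs
      using formD(2)[OF \<omega>, of "V # Vs"] that by auto
    show "\<omega> (V # vmult i f W # Vs) = sg (i * (j + fst V)) *\<^sub>R (f * \<omega> (V # W # Vs))"
      if f: "f \<in> A i" and W: "W \<in> vfields A" for f i W Vs
      using formD(6)[OF \<omega> V vmult_in[OF W f], of "[]" Vs] formD(5)[OF \<omega> f W, of "V # Vs"]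
        formD(6)[OF \<omega> V W, of "[]" Vs]
      by (cases "even i"; cases "even (fst V)"; cases "even (fst W)"; cases "even j"; simp add: sg_def)
    show "\<omega> (V # Us @ U # W # Vs) = - (sg (fst U * fst W) *\<^sub>R \<omega> (V # Us @ W # U # Vs))"
      if "U \<in> vfields A" "W \<in> vfields A" for Us U W Vs
      using formD(6)[OF \<omega> that, of "V # Us"] by simp
  qed (simp_all add: formD(3)[OF \<omega>, of _ _ "V # _", simplified] formD(4)[OF \<omega>, of _ "V # _", simplified])
  then show ?thesis
    unfolding iprod_def by (rule form_scale_in)
qed

lemma iprod_in': "\<omega> \<in> forms A p j \<Longrightarrow> V \<in> vfields A \<Longrightarrow> iprod j V \<omega> \<in> forms A (p - 1) (j + fst V)"
  by (cases p) (simp_all add: iprod_form_0 iprod_in)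

lemma iprod_vadd:
  "\<omega> \<in> forms A p j \<Longrightarrow> V \<in> vfields A \<Longrightarrow> W \<in> vfields A \<Longrightarrow> fst V = fst W \<Longrightarrow>
    iprod k (vadd V W) \<omega> = (\<lambda>Vs. iprod k V \<omega> Vs + iprod k W \<omega> Vs)"
  using formD(3)[of \<omega> p j V W "[]"] by (simp add: iprod_def scaleR_right_distrib)

lemma iprod_vscale:
  "\<omega> \<in> forms A p j \<Longrightarrow> V \<in> vfields A \<Longrightarrow> iprod k (vscale c V) \<omega> = (\<lambda>Vs. c *\<^sub>R iprod k V \<omega> Vs)"
  using formD(4)[of \<omega> p j V "[]"] by (simp add: iprod_def mult.commute)

lemma iprod_vmult:
  "\<omega> \<in> forms A p j \<Longrightarrow> f \<in> A i \<Longrightarrow> V \<in> vfields A \<Longrightarrow>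
    iprod j (vmult i f V) \<omega> = (\<lambda>Vs. f * iprod j V \<omega> Vs)"
  by (cases "even i"; cases "even j"; cases "even (fst V)";
      simp add: iprod_def formD(5) sg_def fun_eq_iff)

lemma iprod_iprod:
  assumes \<omega>: "\<omega> \<in> forms A p j" and U: "U \<in> vfields A" and V: "V \<in> vfields A"
  shows "iprod (j + fst V) U (iprod j V \<omega>) =
    (\<lambda>Vs. sg ((fst U - 1) * (fst V - 1)) *\<^sub>R iprod (j + fst U) V (iprod j U \<omega>) Vs)"
  using formD(6)[OF \<omega> U V, of "[]"]
  by (cases "even j"; cases "even (fst U)"; cases "even (fst V)";
      simp add: iprod_def sg_def fun_eq_iff)

lemma form_SucI:
  assumes nil: "\<omega> [] = 0"
    and out: "\<And>V Vs. V \<notin> vfields A \<Longrightarrow> \<omega> (V # Vs) = 0"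
    and inner: "\<And>V. V \<in> vfields A \<Longrightarrow> iprod j V \<omega> \<in> forms A p (j + fst V)"
    and add: "\<And>V W Vs. V \<in> vfields A \<Longrightarrow> W \<in> vfields A \<Longrightarrow> fst V = fst W \<Longrightarrow>
      iprod j (vadd V W) \<omega> Vs = iprod j V \<omega> Vs + iprod j W \<omega> Vs"
    and scale: "\<And>V c Vs. V \<in> vfields A \<Longrightarrow> iprod j (vscale c V) \<omega> Vs = c *\<^sub>R iprod j V \<omega> Vs"
    and mult: "\<And>V f i Vs. V \<in> vfields A \<Longrightarrow> f \<in> A i \<Longrightarrow>
      iprod j (vmult i f V) \<omega> Vs = f * iprod j V \<omega> Vs"
    and swap: "\<And>U V Vs. U \<in> vfields A \<Longrightarrow> V \<in> vfields A \<Longrightarrow>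
      iprod (j + fst V) U (iprod j V \<omega>) Vs =
        sg ((fst U - 1) * (fst V - 1)) *\<^sub>R iprod (j + fst U) V (iprod j U \<omega>) Vs"
  shows "\<omega> \<in> forms A (Suc p) j"
proof -
  note ev = eval_iprod[of \<omega> _ _ j]
  have out': "iprod j V \<omega> Vs = 0" if "V \<notin> vfields A" for V Vs
    using out[OF that] by (simp add: iprod_def)
  have 1: "\<omega> Vs \<in> A (j + sum_list (map fst Vs))" if "length Vs = Suc p" "set Vs \<subseteq> vfields A" for Vs
  proof (cases Vs)
    case (Cons V Ws)
    then show ?thesis
      using that formD(1)[OF inner[of V], of Ws] by (simp add: ev A_scale add.assoc)
  qed (use that in simp)
  have 2: "\<omega> Vs = 0" if "\<not> (length Vs = Suc p \<and> set Vs \<subseteq> vfields A)" for Vs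
  proof (cases Vs)
    case (Cons V Ws)
    then show ?thesis
      using that out' formD(2)[OF inner[of V], of Ws] by (cases "V \<in> vfields A") (auto simp: ev)
  qed (simp add: nil)
  have 3: "\<omega> (Us @ vadd V W # Vs) = \<omega> (Us @ V # Vs) + \<omega> (Us @ W # Vs)"
    if "V \<in> vfields A" "W \<in> vfields A" "fst V = fst W" for Us Vs V W
  proof (cases Us)
    case Nil
    then show ?thesis using add[OF that] that by (simp add: ev scaleR_right_distrib)
  next
    case (Cons U Us')
    then show ?thesis
      using out' formD(3)[OF inner[of U] that]
      by (cases "U \<in> vfields A") (simp_all add: ev scaleR_right_distrib)
  qed
  have 4: "\<omega> (Us @ vscale c V # Vs) = c *\<^sub>R \<omega> (Us @ V # Vs)" if "V \<in> vfields A" for Us Vs V c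
  proof (cases Us)
    case Nil
    then show ?thesis using scale[OF that] by (simp add: ev mult.commute)
  next
    case (Cons U Us')
    then show ?thesis
      using out' formD(4)[OF inner[of U] that]
      by (cases "U \<in> vfields A") (simp_all add: ev mult.commute)
  qed
  have 5: "\<omega> (vmult i f V # Vs) = sg (i * j) *\<^sub>R (f * \<omega> (V # Vs))"
    if "f \<in> A i" "V \<in> vfields A" for Vs V f i
    using mult[OF that(2,1)]
    by (cases "even i"; cases "even j"; cases "even (fst V)"; simp add: ev sg_def)
  have 6: "\<omega> (Us @ V # W # Vs) = - (sg (fst V * fst W) *\<^sub>R \<omega> (Us @ W # V # Vs))"
    if V: "V \<in> vfields A" and W: "W \<in> vfields A" for Us Vs V W
  proof (cases Us)
    case Nil
    then show ?thesis
      using swap[OF V W, of Vs]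
      by (cases "even j"; cases "even (fst V)"; cases "even (fst W)"; simp add: iprod_def sg_def)
  next
    case (Cons U Us')
    then show ?thesis
      using out' formD(6)[OF inner[of U] that]
      by (cases "U \<in> vfields A") (simp_all add: ev mult.commute)
  qed
  show ?thesis
    unfolding forms_def using 1 2 3 4 5 6 by blast
qed

lemma form_eqI:
  assumes "\<omega> [] = \<tau> []" and "\<And>V. iprod j V \<omega> = iprod j V \<tau>"
  shows "\<omega> = \<tau>"
proof
  show "\<omega> Vs = \<tau> Vs" for Vs
    using assms fun_cong[OF assms(2)]
    by (cases Vs) (auto simp: eval_iprod[of _ _ _ j])
qed

end

lemma wedge_Nil [simp]: "wedge p j \<alpha> k \<beta> [] = \<alpha> [] * \<beta> []"
  by (simp add: wedge_def)

lemma wedge_Cons: "wedge p j \<alpha> k \<beta> (V # Vs) = sg ((j + k) * (fst V - 1)) *\<^sub>R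
    (wedge (p - 1) (j + fst V) (iprod j V \<alpha>) k \<beta> Vs +
     sg ((fst V - 1) * (j + int p)) *\<^sub>R wedge p j \<alpha> (k + fst V) (iprod k V \<beta>) Vs)"
  by (simp add: wedge_def)

lemma iprod_wedge: "iprod (j + k) V (wedge p j \<alpha> k \<beta>) =
    (\<lambda>Vs. wedge (p - 1) (j + fst V) (iprod j V \<alpha>) k \<beta> Vs +
     sg ((fst V - 1) * (j + int p)) *\<^sub>R wedge p j \<alpha> (k + fst V) (iprod k V \<beta>) Vs)"
  by (simp add: iprod_def[of "j + k"] wedge_Cons)

lemma wedge_add_left: "wedge p j (\<lambda>Vs. \<alpha> Vs + \<alpha>' Vs) k \<beta> =
    (\<lambda>Vs. wedge p j \<alpha> k \<beta> Vs + wedge p j \<alpha>' k \<beta> Vs)"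
proof
  show "wedge p j (\<lambda>Vs. \<alpha> Vs + \<alpha>' Vs) k \<beta> Vs = wedge p j \<alpha> k \<beta> Vs + wedge p j \<alpha>' k \<beta> Vs" for Vs
    by (induction Vs arbitrary: p j \<alpha> \<alpha>' k \<beta>)
      (simp_all add: wedge_Cons distrib_right scaleR_right_distrib)
qed

lemma wedge_add_right: "wedge p j \<alpha> k (\<lambda>Vs. \<beta> Vs + \<beta>' Vs) =
    (\<lambda>Vs. wedge p j \<alpha> k \<beta> Vs + wedge p j \<alpha> k \<beta>' Vs)"
proof
  show "wedge p j \<alpha> k (\<lambda>Vs. \<beta> Vs + \<beta>' Vs) Vs = wedge p j \<alpha> k \<beta> Vs + wedge p j \<alpha> k \<beta>' Vs" for Vs
    by (induction Vs arbitrary: p j \<alpha> \<beta>' k \<beta>)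
      (simp_all add: wedge_Cons distrib_left scaleR_right_distrib)
qed

lemma wedge_scale_left: "wedge p j (\<lambda>Vs. c *\<^sub>R \<alpha> Vs) k \<beta> = (\<lambda>Vs. c *\<^sub>R wedge p j \<alpha> k \<beta> Vs)"
proof
  show "wedge p j (\<lambda>Vs. c *\<^sub>R \<alpha> Vs) k \<beta> Vs = c *\<^sub>R wedge p j \<alpha> k \<beta> Vs" for Vs
    by (induction Vs arbitrary: p j \<alpha> k \<beta>)
      (simp_all add: wedge_Cons scaleR_right_distrib mult.commute)
qed

lemma wedge_scale_right: "wedge p j \<alpha> k (\<lambda>Vs. c *\<^sub>R \<beta> Vs) = (\<lambda>Vs. c *\<^sub>R wedge p j \<alpha> k \<beta> Vs)"
proof
  show "wedge p j \<alpha> k (\<lambda>Vs. c *\<^sub>R \<beta> Vs) Vs = c *\<^sub>R wedge p j \<alpha> k \<beta> Vs" for Vs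
    by (induction Vs arbitrary: p j \<alpha> k \<beta>)
      (simp_all add: wedge_Cons scaleR_right_distrib mult.commute)
qed

lemma wedge_zero [simp]: "wedge p j (\<lambda>Vs. 0) k \<beta> = (\<lambda>Vs. 0)" "wedge p j \<alpha> k (\<lambda>Vs. 0) = (\<lambda>Vs. 0)"
  using wedge_scale_left[of p j 0] wedge_scale_right[of p j \<alpha> k 0] by simp_all

lemma wedge_diff_left: "wedge p j (\<lambda>Vs. \<alpha> Vs - \<alpha>' Vs) k \<beta> =
    (\<lambda>Vs. wedge p j \<alpha> k \<beta> Vs - wedge p j \<alpha>' k \<beta> Vs)"
  using wedge_add_left[of p j \<alpha> "\<lambda>Vs. (-1) *\<^sub>R \<alpha>' Vs"] wedge_scale_left[of p j "-1" \<alpha>'] by simp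

lemma wedge_diff_right: "wedge p j \<alpha> k (\<lambda>Vs. \<beta> Vs - \<beta>' Vs) =
    (\<lambda>Vs. wedge p j \<alpha> k \<beta> Vs - wedge p j \<alpha> k \<beta>' Vs)"
  using wedge_add_right[of p j \<alpha> k \<beta> "\<lambda>Vs. (-1) *\<^sub>R \<beta>' Vs"] wedge_scale_right[of p j \<alpha> k "-1" \<beta>']
  by simp

lemmas wedge_lin = wedge_add_left wedge_add_right wedge_scale_left wedge_scale_right
  wedge_diff_left wedge_diff_right

lemma wedge_form0_left: "wedge 0 j (form0 f) k \<beta> = (\<lambda>Vs. f * \<beta> Vs)"
proof
  show "wedge 0 j (form0 f) k \<beta> Vs = f * \<beta> Vs" for Vs
  proof (induction Vs arbitrary: k \<beta>)
    case (Cons V Vs)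
    then show ?case
      by (cases "even j"; cases "even k"; cases "even (fst V)";
          simp add: wedge_Cons iprod_def[of k] sg_def)
  qed (simp add: form0_def)
qed

lemma wedge_fmult_left:
  "wedge p (i + j) (\<lambda>Vs. f * \<alpha> Vs) k \<beta> = (\<lambda>Vs. f * wedge p j \<alpha> k \<beta> Vs)"
proof
  show "wedge p (i + j) (\<lambda>Vs. f * \<alpha> Vs) k \<beta> Vs = f * wedge p j \<alpha> k \<beta> Vs" for Vs
  proof (induction Vs arbitrary: p j k \<alpha> \<beta>)
    case (Cons V Vs)
    have "wedge p (i + j) (\<lambda>Vs. f * \<alpha> Vs) (k + fst V) (iprod k V \<beta>) Vs =
        f * wedge p j \<alpha> (k + fst V) (iprod k V \<beta>) Vs"
      "wedge (p - 1) (i + j + fst V) (\<lambda>Vs. f * iprod j V \<alpha> Vs) k \<beta> Vs =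
        f * wedge (p - 1) (j + fst V) (iprod j V \<alpha>) k \<beta> Vs"
      using Cons.IH[of p j] Cons.IH[of "p - 1" "j + fst V"] by (simp_all add: add.assoc)
    then show ?case
      unfolding wedge_Cons iprod_fmult wedge_scale_left
      by (cases "even i"; cases "even j"; cases "even k"; cases "even (fst V)"; cases "even p";
          simp add: sg_def distrib_left right_diff_distrib)
  qed (simp add: mult.assoc)
qed

context graded_comm_algebra
begin

lemma wedge_fmult_right:
  assumes f: "f \<in> A i" and \<alpha>: "\<alpha> \<in> forms A p j"
  shows "wedge p j \<alpha> (i + k) (\<lambda>Vs. f * \<beta> Vs) =
    (\<lambda>Vs. sg (i * (j + int p)) *\<^sub>R (f * wedge p j \<alpha> k \<beta> Vs))"
proof
  show "wedge p j \<alpha> (i + k) (\<lambda>Vs. f * \<beta> Vs) Vs = sg (i * (j + int p)) *\<^sub>R (f * wedge p j \<alpha> k \<beta> Vs)" for Vs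
    using \<alpha>
  proof (induction Vs arbitrary: p j k \<alpha> \<beta>)
    case Nil
    show ?case
    proof (cases p)
      case 0
      have "\<alpha> [] \<in> A j"
        using formD(1)[OF Nil, of "[]"] 0 by simp
      from graded_comm[OF f this] have "\<alpha> [] * f = sg (i * j) *\<^sub>R (f * \<alpha> [])"
        by simp
      then show ?thesis
        using 0 by (simp flip: mult.assoc)
    next
      case Suc
      then show ?thesis using formD(2)[OF Nil, of "[]"] by simp
    qed
  next
    case (Cons V Vs)
    have a: "wedge p j \<alpha> (i + (k + fst V)) (\<lambda>Vs. f * iprod k V \<beta> Vs) Vs =
        sg (i * (j + int p)) *\<^sub>R (f * wedge p j \<alpha> (k + fst V) (iprod k V \<beta>) Vs)"
      by (rule Cons.IH[OF Cons.prems])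
    have b: "wedge (p - 1) (j + fst V) (iprod j V \<alpha>) (i + k) (\<lambda>Vs. f * \<beta> Vs) Vs =
        sg (i * (j + fst V + int p - 1)) *\<^sub>R (f * wedge (p - 1) (j + fst V) (iprod j V \<alpha>) k \<beta> Vs)"
    proof (cases "p = 0 \<or> V \<notin> vfields A")
      case True
      then have "iprod j V \<alpha> = (\<lambda>Vs. 0)"
        using Cons.prems by (auto simp: iprod_form_0 iprod_not_vfield)
      then show ?thesis by simp
    next
      case False
      then have "int (p - 1) = int p - 1" "iprod j V \<alpha> \<in> forms A (p - 1) (j + fst V)"
        using iprod_in'[OF Cons.prems] by auto
      with Cons.IH[of "iprod j V \<alpha>" "p - 1" "j + fst V" k \<beta>] show ?thesis
        by (simp add: algebra_simps)
    qed
    note a' = a[folded add.assoc]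
    show ?case
      unfolding wedge_Cons iprod_fmult wedge_scale_right a' b
      by (cases "even i"; cases "even j"; cases "even k"; cases "even (fst V)"; cases "even p";
          simp add: sg_def distrib_left right_diff_distrib)
  qed
qed

lemma wedge_in:
  "\<alpha> \<in> forms A p j \<Longrightarrow> \<beta> \<in> forms A q k \<Longrightarrow> wedge p j \<alpha> k \<beta> \<in> forms A (p + q) (j + k)"
proof (induction "p + q" arbitrary: p q j k \<alpha> \<beta>)
  case 0
  then obtain f g where "f \<in> A j" "\<alpha> = form0 f" "g \<in> A k" "\<beta> = form0 g"
    by (auto simp: form_0_iff)
  moreover from this have "(\<lambda>Vs. f * form0 g Vs) = form0 (f * g)"
    by (auto simp: form0_def)
  ultimately show ?case
    using 0 by (auto simp: form_0_iff wedge_form0_left mult_A)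
next
  case (Suc n)
  note \<alpha> = Suc.prems(1) and \<beta> = Suc.prems(2)
  have int_p: "iprod j V \<alpha> = (\<lambda>Vs. 0) \<or> int (p - 1) = int p - 1" for V
    using \<alpha> by (cases p) (auto simp: iprod_form_0)
  have "wedge p j \<alpha> k \<beta> \<in> forms A (Suc n) (j + k)"
  proof (rule form_SucI)
    show "wedge p j \<alpha> k \<beta> [] = 0"
      using Suc.hyps(2) formD(2)[OF \<alpha>, of "[]"] formD(2)[OF \<beta>, of "[]"] by (cases p) auto
    show "wedge p j \<alpha> k \<beta> (V # Vs) = 0" if "V \<notin> vfields A" for V Vs
      using that by (simp add: wedge_Cons iprod_not_vfield[OF \<alpha>] iprod_not_vfield[OF \<beta>])
    show "iprod (j + k) V (wedge p j \<alpha> k \<beta>) \<in> forms A n (j + k + fst V)" if V: "V \<in> vfields A" for V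
      unfolding iprod_wedge
    proof (intro form_add_in form_scale_in)
      show "wedge (p - 1) (j + fst V) (iprod j V \<alpha>) k \<beta> \<in> forms A n (j + k + fst V)"
      proof (cases p)
        case 0
        then show ?thesis using \<alpha> by (simp add: iprod_form_0)
      next
        case (Suc p')
        with Suc.hyps(1)[OF _ iprod_in[OF \<alpha>[unfolded Suc] V] \<beta>] Suc.hyps(2) show ?thesis
          by (simp add: ac_simps)
      qed
      show "wedge p j \<alpha> (k + fst V) (iprod k V \<beta>) \<in> forms A n (j + k + fst V)"
      proof (cases q)
        case 0
        then show ?thesis using \<beta> by (simp add: iprod_form_0)
      next
        case (Suc q')
        with Suc.hyps(1)[OF _ \<alpha> iprod_in[OF \<beta>[unfolded Suc] V]] Suc.hyps(2) show ?thesis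
          by (simp add: ac_simps)
      qed
    qed
    show "iprod (j + k) (vadd V W) (wedge p j \<alpha> k \<beta>) Vs =
        iprod (j + k) V (wedge p j \<alpha> k \<beta>) Vs + iprod (j + k) W (wedge p j \<alpha> k \<beta>) Vs"
      if "V \<in> vfields A" "W \<in> vfields A" "fst V = fst W" for V W Vs
      using that by (simp add: iprod_wedge iprod_vadd[OF \<alpha>] iprod_vadd[OF \<beta>] wedge_lin
          scaleR_right_distrib)
    show "iprod (j + k) (vscale c V) (wedge p j \<alpha> k \<beta>) Vs =
        c *\<^sub>R iprod (j + k) V (wedge p j \<alpha> k \<beta>) Vs"
      if "V \<in> vfields A" for V c Vs
      using that by (simp add: iprod_wedge iprod_vscale[OF \<alpha>] iprod_vscale[OF \<beta>] wedge_lin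
          scaleR_right_distrib mult.commute)
    show "iprod (j + k) (vmult i f V) (wedge p j \<alpha> k \<beta>) Vs =
        f * iprod (j + k) V (wedge p j \<alpha> k \<beta>) Vs"
      if V: "V \<in> vfields A" and f: "f \<in> A i" for V f i Vs
    proof -
      have 1: "wedge (p - 1) (j + fst (vmult i f V)) (iprod j (vmult i f V) \<alpha>) k \<beta> =
          (\<lambda>Vs. f * wedge (p - 1) (j + fst V) (iprod j V \<alpha>) k \<beta> Vs)"
        using wedge_fmult_left[of "p - 1" i "j + fst V" f "iprod j V \<alpha>" k \<beta>]
        by (simp add: iprod_vmult[OF \<alpha> f V] ac_simps)
      have 2: "wedge p j \<alpha> (k + fst (vmult i f V)) (iprod k (vmult i f V) \<beta>) =
          (\<lambda>Vs. sg (i * (j + int p)) *\<^sub>R (f * wedge p j \<alpha> (k + fst V) (iprod k V \<beta>) Vs))"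
        using wedge_fmult_right[OF f \<alpha>, of "k + fst V" "iprod k V \<beta>"]
        by (simp add: iprod_vmult[OF \<beta> f V] ac_simps)
      show ?thesis
        unfolding iprod_wedge 1 2
        by (cases "even i"; cases "even j"; cases "even (fst V)"; cases "even p";
            simp add: sg_def distrib_left right_diff_distrib)
    qed
    show "iprod (j + k + fst V) U (iprod (j + k) V (wedge p j \<alpha> k \<beta>)) Vs =
        sg ((fst U - 1) * (fst V - 1)) *\<^sub>R
          iprod (j + k + fst U) V (iprod (j + k) U (wedge p j \<alpha> k \<beta>)) Vs"
      if U: "U \<in> vfields A" and V: "V \<in> vfields A" for U V Vs
    proof -
      have exp: "iprod (j + k + fst V) U (iprod (j + k) V (wedge p j \<alpha> k \<beta>)) =
        (\<lambda>Vs. wedge (p - 1 - 1) (j + fst V + fst U) (iprod (j + fst V) U (iprod j V \<alpha>)) k \<beta> Vs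
          + sg ((fst U - 1) * (j + fst V + int p - 1)) *\<^sub>R
            wedge (p - 1) (j + fst V) (iprod j V \<alpha>) (k + fst U) (iprod k U \<beta>) Vs
          + sg ((fst V - 1) * (j + int p)) *\<^sub>R
            (wedge (p - 1) (j + fst U) (iprod j U \<alpha>) (k + fst V) (iprod k V \<beta>) Vs
            + sg ((fst U - 1) * (j + int p)) *\<^sub>R
              wedge p j \<alpha> (k + fst V + fst U) (iprod (k + fst V) U (iprod k V \<beta>)) Vs))"
        for U V
      proof -
        have 1: "iprod (j + k + fst V) U (wedge (p - 1) (j + fst V) (iprod j V \<alpha>) k \<beta>) =
          (\<lambda>Vs. wedge (p - 1 - 1) (j + fst V + fst U) (iprod (j + fst V) U (iprod j V \<alpha>)) k \<beta> Vs
          + sg ((fst U - 1) * (j + fst V + int p - 1)) *\<^sub>R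
            wedge (p - 1) (j + fst V) (iprod j V \<alpha>) (k + fst U) (iprod k U \<beta>) Vs)"
          using iprod_wedge[of "j + fst V" k U "p - 1" "iprod j V \<alpha>" \<beta>] int_p[of V]
          by (auto simp: ac_simps add_diff_eq)
        have 2: "iprod (j + k + fst V) U (wedge p j \<alpha> (k + fst V) (iprod k V \<beta>)) =
          (\<lambda>Vs. wedge (p - 1) (j + fst U) (iprod j U \<alpha>) (k + fst V) (iprod k V \<beta>) Vs
            + sg ((fst U - 1) * (j + int p)) *\<^sub>R
              wedge p j \<alpha> (k + fst V + fst U) (iprod (k + fst V) U (iprod k V \<beta>)) Vs)"
          using iprod_wedge[of j "k + fst V" U p \<alpha> "iprod k V \<beta>"] by (simp add: ac_simps)
        show ?thesis
          unfolding iprod_wedge iprod_lin 1 2 ..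
      qed
      have 3: "wedge (p - 1 - 1) (j + fst V + fst U) (iprod (j + fst V) U (iprod j V \<alpha>)) k \<beta> Vs =
          sg ((fst U - 1) * (fst V - 1)) *\<^sub>R
          wedge (p - 1 - 1) (j + fst U + fst V) (iprod (j + fst U) V (iprod j U \<alpha>)) k \<beta> Vs"
        unfolding iprod_iprod[OF \<alpha> U V] wedge_lin by (simp add: ac_simps)
      have 4: "wedge p j \<alpha> (k + fst V + fst U) (iprod (k + fst V) U (iprod k V \<beta>)) Vs =
          sg ((fst U - 1) * (fst V - 1)) *\<^sub>R
          wedge p j \<alpha> (k + fst U + fst V) (iprod (k + fst U) V (iprod k U \<beta>)) Vs"
        unfolding iprod_iprod[OF \<beta> U V] wedge_lin by (simp add: ac_simps)
      show ?thesis
        unfolding exp 3 4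
        by (cases "even j"; cases "even (fst U)"; cases "even (fst V)"; cases "even p"; simp add: sg_def)
    qed
  qed
  then show ?case using Suc.hyps(2) by simp
qed

lemma wedge_comm:
  assumes "\<alpha> \<in> forms A p j" "\<beta> \<in> forms A q k"
  shows "wedge p j \<alpha> k \<beta> Vs = sg ((int p + j) * (int q + k)) *\<^sub>R wedge q k \<beta> j \<alpha> Vs"
  using assms
proof (induction Vs arbitrary: p q j k \<alpha> \<beta>)
  case Nil
  show ?case
  proof (cases "p = 0 \<and> q = 0")
    case True
    then have "\<alpha> [] \<in> A j" "\<beta> [] \<in> A k"
      using formD(1)[OF Nil(1), of "[]"] formD(1)[OF Nil(2), of "[]"] by auto
    from graded_comm[OF this] show ?thesis
      using True by simp
  next
    case False
    then have "\<alpha> [] = 0 \<or> \<beta> [] = 0"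
      using formD(2)[OF Nil(1), of "[]"] formD(2)[OF Nil(2), of "[]"] by auto
    then show ?thesis by auto
  qed
next
  case (Cons V Vs)
  note \<alpha> = Cons.prems(1) and \<beta> = Cons.prems(2)
  show ?case
  proof (cases "V \<in> vfields A")
    case False
    then show ?thesis
      by (simp add: wedge_Cons iprod_not_vfield[OF \<alpha>] iprod_not_vfield[OF \<beta>])
  next
    case V: True
    have a: "wedge (p - 1) (j + fst V) (iprod j V \<alpha>) k \<beta> Vs =
        sg ((int p - 1 + j + fst V) * (int q + k)) *\<^sub>R wedge q k \<beta> (j + fst V) (iprod j V \<alpha>) Vs"
      using Cons.IH[OF iprod_in'[OF \<alpha> V] \<beta>] \<alpha>
      by (cases p) (auto simp: iprod_form_0 algebra_simps)
    have b: "wedge p j \<alpha> (k + fst V) (iprod k V \<beta>) Vs =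
        sg ((int p + j) * (int q - 1 + k + fst V)) *\<^sub>R wedge (q - 1) (k + fst V) (iprod k V \<beta>) j \<alpha> Vs"
      using Cons.IH[OF \<alpha> iprod_in'[OF \<beta> V]] \<beta>
      by (cases q) (auto simp: iprod_form_0 algebra_simps)
    show ?thesis
      unfolding wedge_Cons a b
      by (cases "even j"; cases "even k"; cases "even (fst V)"; cases "even p"; cases "even q";
          simp add: sg_def)
  qed
qed

lemma wedge_assoc:
  assumes "\<alpha> \<in> forms A p j" "\<beta> \<in> forms A q k"
  shows "wedge (p + q) (j + k) (wedge p j \<alpha> k \<beta>) m \<gamma> Vs = wedge p j \<alpha> (k + m) (wedge q k \<beta> m \<gamma>) Vs"
  using assms
proof (induction Vs arbitrary: p q j k m \<alpha> \<beta> \<gamma>)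
  case Nil
  then show ?case by (simp add: mult.assoc)
next
  case (Cons V Vs)
  note \<alpha> = Cons.prems(1) and \<beta> = Cons.prems(2)
  show ?case
  proof (cases "V \<in> vfields A")
    case False
    show ?thesis
      unfolding wedge_Cons[of _ _ "wedge p j \<alpha> k \<beta>"] wedge_Cons[of _ _ \<alpha>] iprod_wedge wedge_lin
      using Cons.IH[OF \<alpha> \<beta>, of "m + fst V" "iprod m V \<gamma>"]
      by (cases "even j"; cases "even k"; cases "even (fst V)"; cases "even p"; cases "even q";
          simp add: iprod_not_vfield[OF \<alpha> False] iprod_not_vfield[OF \<beta> False] sg_def add.assoc)
  next
    case V: True
    have a: "wedge (p + q - 1) (j + k + fst V) (wedge (p - 1) (j + fst V) (iprod j V \<alpha>) k \<beta>) m \<gamma> Vs =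
        wedge (p - 1) (j + fst V) (iprod j V \<alpha>) (k + m) (wedge q k \<beta> m \<gamma>) Vs"
      using Cons.IH[OF iprod_in'[OF \<alpha> V] \<beta>, of m \<gamma>] \<alpha>
      by (cases p) (simp_all add: iprod_form_0 ac_simps)
    have b: "wedge (p + q - 1) (j + k + fst V) (wedge p j \<alpha> (k + fst V) (iprod k V \<beta>)) m \<gamma> Vs =
        wedge p j \<alpha> (k + m + fst V) (wedge (q - 1) (k + fst V) (iprod k V \<beta>) m \<gamma>) Vs"
      using Cons.IH[OF \<alpha> iprod_in'[OF \<beta> V], of m \<gamma>] \<beta>
      by (cases q) (simp_all add: iprod_form_0 ac_simps)
    have c: "wedge (p + q) (j + k) (wedge p j \<alpha> k \<beta>) (m + fst V) (iprod m V \<gamma>) Vs =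
        wedge p j \<alpha> (k + m + fst V) (wedge q k \<beta> (m + fst V) (iprod m V \<gamma>)) Vs"
      using Cons.IH[OF \<alpha> \<beta>, of "m + fst V" "iprod m V \<gamma>"] by (simp add: add.assoc)
    show ?thesis
      unfolding wedge_Cons[of _ _ "wedge p j \<alpha> k \<beta>"] wedge_Cons[of _ _ \<alpha>] iprod_wedge wedge_lin a b c
      by (cases "even j"; cases "even k"; cases "even m"; cases "even (fst V)"; cases "even p"; cases "even q";
          simp add: sg_def)
  qed
qed

end

lemma sg_neq_0 [simp]: "sg k \<noteq> 0"
  by (simp add: sg_def)

lemma form_Cons_eqI: "iprod j V \<omega> Vs = iprod j V \<tau> Vs \<Longrightarrow> \<omega> (V # Vs) = \<tau> (V # Vs)"
  by (simp add: iprod_def)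

context graded_comm_algebra
begin

subsection \<open>The bracket of vector fields\<close>

lemma vfield_eqI:
  assumes "fst V = fst W" and "\<And>i f. f \<in> A i \<Longrightarrow> snd V f = snd W f"
    and "\<And>f. f \<notin> (\<Union>i. A i) \<Longrightarrow> snd V f = snd W f"
  shows "V = W"
proof (rule prod_eqI[OF assms(1)], rule ext)
  show "snd V f = snd W f" for f
    using assms(2,3)[of f] by (cases "f \<in> (\<Union>i. A i)") auto
qed

lemma vbracket_vadd:
  assumes U: "U \<in> vfields A" and V: "V \<in> vfields A" and W: "W \<in> vfields A" and eq: "fst V = fst W"
  shows "vbracket U (vadd V W) = vadd (vbracket U V) (vbracket U W)"
    and "vbracket (vadd V W) U = vadd (vbracket V U) (vbracket W U)"
proof -
  have a: "snd U (snd V f + snd W f) = snd U (snd V f) + snd U (snd W f)" if f: "f \<in> A i" for f i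
    by (rule vfieldD(2)[OF U vfieldD(1)[OF V f]]) (use vfieldD(1)[OF W f] eq in simp)
  show "vbracket U (vadd V W) = vadd (vbracket U V) (vbracket U W)"
    by (rule vfield_eqI)
      (simp_all add: snd_vops a eq vfieldD(5)[OF U] vfieldD(5)[OF V] vfieldD(5)[OF W] scaleR_right_distrib U V W)
  show "vbracket (vadd V W) U = vadd (vbracket V U) (vbracket W U)"
    by (rule vfield_eqI)
      (simp_all add: snd_vops a eq vfieldD(5)[OF U] vfieldD(5)[OF V] vfieldD(5)[OF W]
        scaleR_right_distrib U V W)
qed

lemma vbracket_vscale:
  assumes U: "U \<in> vfields A" and V: "V \<in> vfields A"
  shows "vbracket U (vscale c V) = vscale c (vbracket U V)"
    and "vbracket (vscale c V) U = vscale c (vbracket V U)"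
proof -
  have a: "snd U (c *\<^sub>R snd V f) = c *\<^sub>R snd U (snd V f)" if f: "f \<in> A i" for f i
    by (rule vfieldD(3)[OF U vfieldD(1)[OF V f]])
  show "vbracket U (vscale c V) = vscale c (vbracket U V)"
    by (rule vfield_eqI)
      (simp_all add: snd_vops a vfieldD(5)[OF U] vfieldD(5)[OF V] scaleR_right_diff_distrib U V mult.commute)
  show "vbracket (vscale c V) U = vscale c (vbracket V U)"
    by (rule vfield_eqI)
      (simp_all add: snd_vops a vfieldD(5)[OF U] vfieldD(5)[OF V] scaleR_right_diff_distrib U V mult.commute)
qed

lemma vbracket_swap: "vbracket U V = vscale (- sg (fst U * fst V)) (vbracket V U)"
  by (rule prod_eqI) (simp_all add: snd_vops fun_eq_iff scaleR_right_diff_distrib mult.commute)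

lemma vbracket_vmult:
  assumes V: "V \<in> vfields A" and W: "W \<in> vfields A" and f: "f \<in> A i"
  shows "vbracket V (vmult i f W) =
      vadd (vmult (i + fst V) (snd V f) W) (vscale (sg (fst V * i)) (vmult i f (vbracket V W)))"
proof (rule vfield_eqI)
  fix g k assume g: "g \<in> A k"
  show "snd (vbracket V (vmult i f W)) g =
      snd (vadd (vmult (i + fst V) (snd V f) W) (vscale (sg (fst V * i)) (vmult i f (vbracket V W)))) g"
    by (simp add: snd_vops vfieldD(4)[OF V f vfieldD(1)[OF W g]] right_diff_distrib
        scaleR_right_diff_distrib distrib_left sg_add mult.commute)
qed (simp_all add: snd_vops vfieldD(5)[OF V] vfieldD(5)[OF W] V W)

lemma vbracket_vmult_left:
  assumes V: "V \<in> vfields A" and W: "W \<in> vfields A" and f: "f \<in> A i"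
  shows "vbracket (vmult i f V) W = vadd (vmult i f (vbracket V W))
      (vscale (- sg ((i + fst V) * fst W)) (vmult (i + fst W) (snd W f) V))"
proof (rule vfield_eqI)
  fix g k assume g: "g \<in> A k"
  show "snd (vbracket (vmult i f V) W) g = snd (vadd (vmult i f (vbracket V W))
      (vscale (- sg ((i + fst V) * fst W)) (vmult (i + fst W) (snd W f) V))) g"
    by (cases "even i"; cases "even (fst V)"; cases "even (fst W)";
        simp add: snd_vops vfieldD(4)[OF W f vfieldD(1)[OF V g]] sg_def algebra_simps)
qed (simp_all add: snd_vops vfieldD(5)[OF V] vfieldD(5)[OF W] V W)

lemma vbracket_jacobi:
  assumes U: "U \<in> vfields A" and V: "V \<in> vfields A" and W: "W \<in> vfields A"
  shows "vbracket U (vbracket V W) =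
      vadd (vbracket (vbracket U V) W) (vscale (sg (fst U * fst V)) (vbracket V (vbracket U W)))"
proof (rule vfield_eqI)
  fix g k assume g: "g \<in> A k"
  have a: "snd X (snd Y (snd Z g) - c *\<^sub>R snd Z (snd Y g)) =
      snd X (snd Y (snd Z g)) - c *\<^sub>R snd X (snd Z (snd Y g))"
    if X: "X \<in> vfields A" and Y: "Y \<in> vfields A" and Z: "Z \<in> vfields A" for X Y Z c
  proof -
    have 1: "snd Y (snd Z g) \<in> A (k + fst Y + fst Z)"
      by (rule A_cong[OF vfieldD(1)[OF Y vfieldD(1)[OF Z g]]]) simp
    have 2: "snd Z (snd Y g) \<in> A (k + fst Y + fst Z)"
      by (rule A_cong[OF vfieldD(1)[OF Z vfieldD(1)[OF Y g]]]) simp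
    show ?thesis
      by (simp add: vfield_diff[OF X 1 A_scale[OF 2]] vfieldD(3)[OF X 2])
  qed
  show "snd (vbracket U (vbracket V W)) g =
     snd (vadd (vbracket (vbracket U V) W) (vscale (sg (fst U * fst V)) (vbracket V (vbracket U W)))) g"
    by (simp only: snd_vops fst_vops a[OF U V W] a[OF V U W] a[OF W U V])
      (cases "even (fst U)"; cases "even (fst V)"; cases "even (fst W)"; simp add: sg_def)
qed (simp_all add: snd_vops vfieldD(5)[OF V] vfieldD(5)[OF W] vfieldD(5)[OF U] U V W)


subsection \<open>The natural action of vector fields on forms\<close>

lemma form_val: "\<omega> \<in> forms A p j \<Longrightarrow> set Ws \<subseteq> vfields A \<Longrightarrow> \<omega> Ws \<in> A (j + sum_list (map fst Ws))"
  using formD(1)[of \<omega> p j Ws] formD(2)[of \<omega> p j Ws] by (cases "length Ws = p") auto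

lemma nat_lie_not_vfield: "V \<notin> vfields A \<Longrightarrow> nat_lie A j V \<omega> = (\<lambda>Ws. 0)"
  and nat_lie_outside: "\<not> set Ws \<subseteq> vfields A \<Longrightarrow> nat_lie A j V \<omega> Ws = 0"
  and nat_lie_Nil: "V \<in> vfields A \<Longrightarrow> nat_lie A j V \<omega> [] = snd V (\<omega> [])"
  by (auto simp: nat_lie_def)

lemma nat_lie_zero [simp]: "nat_lie A j V (\<lambda>Ws. 0) = (\<lambda>Ws. 0)"
  by (auto simp: nat_lie_def)

lemma nat_lie_add:
  assumes w: "\<omega> \<in> forms A p j" and t: "\<tau> \<in> forms A p j"
  shows "nat_lie A j V (\<lambda>Ws. \<omega> Ws + \<tau> Ws) = (\<lambda>Ws. nat_lie A j V \<omega> Ws + nat_lie A j V \<tau> Ws)"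
proof
  fix Ws
  have "snd V (\<omega> Ws + \<tau> Ws) = snd V (\<omega> Ws) + snd V (\<tau> Ws)" if "V \<in> vfields A" "set Ws \<subseteq> vfields A"
    by (rule vfieldD(2)[OF that(1) form_val[OF w that(2)] form_val[OF t that(2)]])
  then show "nat_lie A j V (\<lambda>Ws. \<omega> Ws + \<tau> Ws) Ws = nat_lie A j V \<omega> Ws + nat_lie A j V \<tau> Ws"
    by (simp add: nat_lie_def scaleR_right_distrib sum.distrib)
qed

lemma nat_lie_scale:
  assumes w: "\<omega> \<in> forms A p j"
  shows "nat_lie A j V (\<lambda>Ws. c *\<^sub>R \<omega> Ws) = (\<lambda>Ws. c *\<^sub>R nat_lie A j V \<omega> Ws)"
proof
  fix Ws
  have "snd V (c *\<^sub>R \<omega> Ws) = c *\<^sub>R snd V (\<omega> Ws)" if "V \<in> vfields A" "set Ws \<subseteq> vfields A"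
    by (rule vfieldD(3)[OF that(1) form_val[OF w that(2)]])
  then show "nat_lie A j V (\<lambda>Ws. c *\<^sub>R \<omega> Ws) Ws = c *\<^sub>R nat_lie A j V \<omega> Ws"
    by (simp add: nat_lie_def scaleR_right_diff_distrib scaleR_sum_right mult.commute)
qed

lemma nat_lie_diff:
  assumes "\<omega> \<in> forms A p j" "\<tau> \<in> forms A p j"
  shows "nat_lie A j V (\<lambda>Ws. \<omega> Ws - \<tau> Ws) = (\<lambda>Ws. nat_lie A j V \<omega> Ws - nat_lie A j V \<tau> Ws)"
  using nat_lie_add[OF assms(1) form_scale_in[OF assms(2), of "-1"]] nat_lie_scale[OF assms(2), of V "-1"]
  by simp

lemma nat_lie_fmult:
  assumes w: "\<omega> \<in> forms A p j" and f: "f \<in> A i" and V: "V \<in> vfields A"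
  shows "nat_lie A (i + j) V (\<lambda>Ws. f * \<omega> Ws) =
    (\<lambda>Ws. snd V f * \<omega> Ws + sg (fst V * i) *\<^sub>R (f * nat_lie A j V \<omega> Ws))"
proof
  fix Ws
  show "nat_lie A (i + j) V (\<lambda>Ws. f * \<omega> Ws) Ws =
      snd V f * \<omega> Ws + sg (fst V * i) *\<^sub>R (f * nat_lie A j V \<omega> Ws)"
  proof (cases "set Ws \<subseteq> vfields A")
    case True
    have "sg (fst V * (i + j + x)) = sg (fst V * i) * sg (fst V * (j + x))" for x
      by (simp add: sg_add distrib_left)
    then show ?thesis
      using True V vfieldD(4)[OF V f form_val[OF w True]]
      by (simp add: nat_lie_def right_diff_distrib scaleR_right_diff_distrib sum_distrib_left scaleR_sum_right)
  next
    case False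
    then show ?thesis
      using formD(2)[OF w, of Ws] by (simp add: nat_lie_outside)
  qed
qed

lemma iprod_nat_lie:
  assumes w: "\<omega> \<in> forms A p j" and V: "V \<in> vfields A" and W: "W \<in> vfields A"
  shows "iprod (j + fst V) W (nat_lie A j V \<omega>) = (\<lambda>Ws. sg (fst V * (fst W - 1)) *\<^sub>R
    (nat_lie A (j + fst W) V (iprod j W \<omega>) Ws - iprod j (vbracket V W) \<omega> Ws))"
proof
  fix Ws
  show "iprod (j + fst V) W (nat_lie A j V \<omega>) Ws = sg (fst V * (fst W - 1)) *\<^sub>R
    (nat_lie A (j + fst W) V (iprod j W \<omega>) Ws - iprod j (vbracket V W) \<omega> Ws)"
  proof (cases "set Ws \<subseteq> vfields A")
    case True
    define S where "S = (\<Sum>i<length Ws. sg (fst V * (j + (fst W + sum_list (map fst (take i Ws))))) *\<^sub>R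
      \<omega> (W # Ws[i := vbracket V (Ws ! i)]))"
    have 1: "nat_lie A j V \<omega> (W # Ws) =
        snd V (\<omega> (W # Ws)) - (sg (fst V * j) *\<^sub>R \<omega> (vbracket V W # Ws) + S)"
      using True V W by (simp add: nat_lie_def S_def sum.lessThan_Suc_shift del: sum.lessThan_Suc)
    have "snd V (c *\<^sub>R \<omega> (W # Ws)) = c *\<^sub>R snd V (\<omega> (W # Ws))" for c
      by (rule vfieldD(3)[OF V form_val[OF w]]) (use True W in simp)
    then have 2: "nat_lie A (j + fst W) V (iprod j W \<omega>) Ws =
        sg (j * (fst W - 1)) *\<^sub>R (snd V (\<omega> (W # Ws)) - S)"
      using True V
      by (simp add: nat_lie_def S_def iprod_def scaleR_right_diff_distrib scaleR_sum_right mult.commute add.assoc)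
    show ?thesis
      unfolding 2 iprod_def[of "j + fst V"] iprod_def[of j "vbracket V W"] 1 fst_vops
      by (cases "even j"; cases "even (fst V)"; cases "even (fst W)"; simp add: sg_def)
  next
    case False
    then show ?thesis
      using formD(2)[OF w, of "vbracket V W # Ws"] by (simp add: iprod_def nat_lie_outside)
  qed
qed

lemma nat_lie_in:
  assumes V: "V \<in> vfields A"
  shows "\<omega> \<in> forms A p j \<Longrightarrow> nat_lie A j V \<omega> \<in> forms A p (j + fst V)"
proof (induction p arbitrary: j \<omega>)
  case 0
  then obtain f where f: "f \<in> A j" "\<omega> = form0 f"
    by (auto simp: form_0_iff)
  have "nat_lie A j V \<omega> Ws = form0 (snd V f) Ws" for Ws
  proof (cases Ws)
    case (Cons W Ws')
    then have "form0 f (Ws[i := U]) = 0" for i U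
      by (cases i) (simp_all add: form0_def)
    then show ?thesis
      using Cons V by (simp add: f nat_lie_def form0_def)
  qed (use V in \<open>simp add: f nat_lie_Nil form0_def\<close>)
  then have "nat_lie A j V \<omega> = form0 (snd V f)" by blast
  then show ?case
    using vfieldD(1)[OF V f(1)] by (auto simp: form_0_iff)
next
  case (Suc p)
  note w = Suc.prems
  have lie: "nat_lie A (j + fst W) V (iprod j W \<omega>) \<in> forms A p (j + fst V + fst W)"
    if W: "W \<in> vfields A" for W
    using Suc.IH[OF iprod_in[OF w W]] by (simp add: ac_simps)
  show ?case
  proof (rule form_SucI)
    show "nat_lie A j V \<omega> [] = 0"
      using formD(2)[OF w, of "[]"] V by (simp add: nat_lie_Nil)
    show "nat_lie A j V \<omega> (W # Vs) = 0" if "W \<notin> vfields A" for W Vs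
      using that by (simp add: nat_lie_outside)
    show "iprod (j + fst V) W (nat_lie A j V \<omega>) \<in> forms A p (j + fst V + fst W)"
      if W: "W \<in> vfields A" for W
      unfolding iprod_nat_lie[OF w V W]
      using iprod_in[OF w vbracket_in[OF V W]]
      by (intro form_scale_in form_diff_in lie[OF W]) (simp add: ac_simps)
    show "iprod (j + fst V) (vadd W W') (nat_lie A j V \<omega>) Vs =
        iprod (j + fst V) W (nat_lie A j V \<omega>) Vs + iprod (j + fst V) W' (nat_lie A j V \<omega>) Vs"
      if W: "W \<in> vfields A" and W': "W' \<in> vfields A" and eq: "fst W = fst W'" for W W' Vs
    proof -
      have "iprod j W' \<omega> \<in> forms A p (j + fst W)"
        using iprod_in[OF w W'] eq by simp
      then show ?thesis
        unfolding iprod_nat_lie[OF w V W] iprod_nat_lie[OF w V W'] iprod_nat_lie[OF w V vadd_in[OF W W' eq]]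
          iprod_vadd[OF w W W' eq] fst_vops vbracket_vadd(1)[OF V W W' eq]
        using iprod_vadd[OF w vbracket_in[OF V W] vbracket_in[OF V W']] eq
          nat_lie_add[OF iprod_in[OF w W], of "iprod j W' \<omega>" V]
        by (simp add: scaleR_right_distrib scaleR_right_diff_distrib)
    qed
    show "iprod (j + fst V) (vscale c W) (nat_lie A j V \<omega>) Vs = c *\<^sub>R iprod (j + fst V) W (nat_lie A j V \<omega>) Vs"
      if W: "W \<in> vfields A" for W c Vs
      unfolding iprod_nat_lie[OF w V W] iprod_nat_lie[OF w V vscale_in[OF W]] iprod_vscale[OF w W]
        fst_vops vbracket_vscale(1)[OF V W] iprod_vscale[OF w vbracket_in[OF V W]]
        nat_lie_scale[OF iprod_in[OF w W]]
      by (simp add: scaleR_right_diff_distrib mult.commute)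
    show "iprod (j + fst V) (vmult i f W) (nat_lie A j V \<omega>) Vs = f * iprod (j + fst V) W (nat_lie A j V \<omega>) Vs"
      if W: "W \<in> vfields A" and f: "f \<in> A i" for W f i Vs
    proof -
      have 1: "nat_lie A (j + (i + fst W)) V (\<lambda>Vs. f * iprod j W \<omega> Vs) Vs =
        snd V f * iprod j W \<omega> Vs + sg (fst V * i) *\<^sub>R (f * nat_lie A (j + fst W) V (iprod j W \<omega>) Vs)"
        using nat_lie_fmult[OF iprod_in[OF w W] f V] by (simp add: ac_simps)
      have Vf: "snd V f \<in> A (i + fst V)"
        by (rule vfieldD(1)[OF V f])
      have 2: "iprod j (vbracket V (vmult i f W)) \<omega> =
        (\<lambda>Vs. snd V f * iprod j W \<omega> Vs + sg (fst V * i) *\<^sub>R (f * iprod j (vbracket V W) \<omega> Vs))"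
        unfolding vbracket_vmult[OF V W f]
        using iprod_vadd[OF w vmult_in[OF W Vf] vscale_in[OF vmult_in[OF vbracket_in[OF V W] f]]]
        by (simp add: iprod_vscale[OF w vmult_in[OF vbracket_in[OF V W] f]]
            iprod_vmult[OF w f vbracket_in[OF V W]] iprod_vmult[OF w Vf W] add.assoc)
      show ?thesis
        unfolding iprod_nat_lie[OF w V W] iprod_nat_lie[OF w V vmult_in[OF W f]] iprod_vmult[OF w f W]
          2 fst_vops 1
        by (cases "even i"; cases "even (fst V)"; cases "even (fst W)";
            simp add: sg_def right_diff_distrib)
    qed
    show "iprod (j + fst V + fst W) U (iprod (j + fst V) W (nat_lie A j V \<omega>)) Vs =
        sg ((fst U - 1) * (fst W - 1)) *\<^sub>R
          iprod (j + fst V + fst U) W (iprod (j + fst V) U (nat_lie A j V \<omega>)) Vs"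
      if U: "U \<in> vfields A" and W: "W \<in> vfields A" for U W Vs
    proof -
      have exp: "iprod (j + fst V + fst W) U (iprod (j + fst V) W (nat_lie A j V \<omega>)) Vs =
          sg (fst V * (fst W - 1)) *\<^sub>R
          (sg (fst V * (fst U - 1)) *\<^sub>R
            (nat_lie A (j + fst W + fst U) V (iprod (j + fst W) U (iprod j W \<omega>)) Vs
              - iprod (j + fst W) (vbracket V U) (iprod j W \<omega>) Vs)
            - iprod (j + (fst V + fst W)) U (iprod j (vbracket V W) \<omega>) Vs)"
        if U: "U \<in> vfields A" and W: "W \<in> vfields A" for U W
      proof -
        have "iprod (j + fst V + fst W) U (nat_lie A (j + fst W) V (iprod j W \<omega>)) =
          (\<lambda>Vs. sg (fst V * (fst U - 1)) *\<^sub>R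
            (nat_lie A (j + fst W + fst U) V (iprod (j + fst W) U (iprod j W \<omega>)) Vs
              - iprod (j + fst W) (vbracket V U) (iprod j W \<omega>) Vs))"
          using iprod_nat_lie[OF iprod_in[OF w W] V U] by (simp add: ac_simps)
        then show ?thesis
          unfolding iprod_nat_lie[OF w V W] iprod_lin by (simp add: add.assoc)
      qed
      have 1: "nat_lie A (j + fst W + fst U) V (iprod (j + fst W) U (iprod j W \<omega>)) Vs =
          sg ((fst U - 1) * (fst W - 1)) *\<^sub>R nat_lie A (j + fst U + fst W) V (iprod (j + fst U) W (iprod j U \<omega>)) Vs"
      proof -
        have "iprod (j + fst U) W (iprod j U \<omega>) \<in> forms A (p - 1) (j + fst W + fst U)"
          using iprod_in'[OF iprod_in[OF w U] W] by (simp add: ac_simps)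
        from nat_lie_scale[OF this] show ?thesis
          unfolding iprod_iprod[OF w U W] by (simp add: ac_simps)
      qed
      have 2: "iprod (j + (fst V + fst W)) U (iprod j (vbracket V W) \<omega>) Vs =
          sg ((fst U - 1) * (fst V + fst W - 1)) *\<^sub>R iprod (j + fst U) (vbracket V W) (iprod j U \<omega>) Vs"
        using iprod_iprod[OF w U vbracket_in[OF V W]] by simp
      have 3: "iprod (j + (fst V + fst U)) W (iprod j (vbracket V U) \<omega>) Vs =
          sg ((fst W - 1) * (fst V + fst U - 1)) *\<^sub>R iprod (j + fst W) (vbracket V U) (iprod j W \<omega>) Vs"
        using iprod_iprod[OF w W vbracket_in[OF V U]] by simp
      show ?thesis
        unfolding exp[OF U W] exp[OF W U] 1 2 3
        by (cases "even (fst U)"; cases "even (fst V)"; cases "even (fst W)"; simp add: sg_def)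
    qed
  qed
qed

end

lemma ext_d_Nil [simp]: "ext_d A j \<omega> [] = 0"
  by (simp add: ext_d_def)

lemma iprod_ext_d: "iprod j V (ext_d A j \<omega>) =
    (\<lambda>Vs. nat_lie A j V \<omega> Vs - sg (fst V) *\<^sub>R ext_d A (j + fst V) (iprod j V \<omega>) Vs)"
  unfolding iprod_def[of j V "ext_d A j \<omega>"] by (simp add: ext_d_def)

context graded_comm_algebra
begin

lemma ext_d_zero [simp]: "ext_d A j (\<lambda>Vs. 0) = (\<lambda>Vs. 0)"
proof
  show "ext_d A j (\<lambda>Vs. 0) Vs = 0" for Vs
  proof (induction Vs arbitrary: j)
    case (Cons V Vs)
    then show ?case
      by (simp add: eval_iprod[of "ext_d A j _" _ _ j] iprod_ext_d)
  qed simp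
qed

lemma iprod_ext_d_not_vfield: "\<omega> \<in> forms A p j \<Longrightarrow> V \<notin> vfields A \<Longrightarrow> iprod j V (ext_d A j \<omega>) = (\<lambda>Vs. 0)"
  by (simp add: iprod_ext_d nat_lie_not_vfield iprod_not_vfield)

lemma nat_lie_vadd:
  assumes "V \<in> vfields A" "W \<in> vfields A" and eq: "fst V = fst W"
  shows "\<omega> \<in> forms A p j \<Longrightarrow>
    nat_lie A j (vadd V W) \<omega> Vs = nat_lie A j V \<omega> Vs + nat_lie A j W \<omega> Vs"
proof (induction Vs arbitrary: p j \<omega>)
  case Nil
  show ?case using assms vadd_in[OF assms] by (simp add: nat_lie_Nil snd_vops)
next
  case (Cons U Vs)
  note w = Cons.prems
  show ?case
  proof (cases "U \<in> vfields A")
    case U: True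
    note VW = vadd_in[OF assms]
    have 1: "iprod (j + fst V) U (nat_lie A j W \<omega>) =
        (\<lambda>Vs. sg (fst V * (fst U - 1)) *\<^sub>R
          (nat_lie A (j + fst U) W (iprod j U \<omega>) Vs - iprod j (vbracket W U) \<omega> Vs))"
      using iprod_nat_lie[OF w assms(2) U] eq by simp
    have 2: "iprod j (vbracket (vadd V W) U) \<omega> = (\<lambda>Vs. iprod j (vbracket V U) \<omega> Vs + iprod j (vbracket W U) \<omega> Vs)"
      using iprod_vadd[OF w vbracket_in[OF assms(1) U] vbracket_in[OF assms(2) U]] eq
      by (simp add: vbracket_vadd(2)[OF U assms])
    have 3: "iprod (j + fst V) U (nat_lie A j (vadd V W) \<omega>) =
        (\<lambda>Vs. sg (fst V * (fst U - 1)) *\<^sub>R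
          (nat_lie A (j + fst U) (vadd V W) (iprod j U \<omega>) Vs - iprod j (vbracket (vadd V W) U) \<omega> Vs))"
      using iprod_nat_lie[OF w VW U] by simp
    show ?thesis
      by (rule form_Cons_eqI[of "j + fst V"])
        (simp add: 1 2 3 iprod_nat_lie[OF w assms(1) U] Cons.IH[OF iprod_in'[OF w U]] scaleR_right_distrib
          scaleR_right_diff_distrib)
  qed (simp add: nat_lie_outside)
qed

lemma nat_lie_vscale:
  assumes V: "V \<in> vfields A"
  shows "\<omega> \<in> forms A p j \<Longrightarrow> nat_lie A j (vscale c V) \<omega> Vs = c *\<^sub>R nat_lie A j V \<omega> Vs"
proof (induction Vs arbitrary: p j \<omega>)
  case Nil
  show ?case using assms vscale_in[OF V] by (simp add: nat_lie_Nil snd_vops)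
next
  case (Cons U Vs)
  note w = Cons.prems
  show ?case
  proof (cases "U \<in> vfields A")
    case U: True
    have 3: "iprod (j + fst V) U (nat_lie A j (vscale c V) \<omega>) =
        (\<lambda>Vs. sg (fst V * (fst U - 1)) *\<^sub>R
          (nat_lie A (j + fst U) (vscale c V) (iprod j U \<omega>) Vs - c *\<^sub>R iprod j (vbracket V U) \<omega> Vs))"
      using iprod_nat_lie[OF w vscale_in[OF V] U]
      by (simp add: vbracket_vscale(2)[OF U V] iprod_vscale[OF w vbracket_in[OF V U]])
    show ?thesis
      by (rule form_Cons_eqI[of "j + fst V"])
        (simp add: 3 iprod_nat_lie[OF w V U] Cons.IH[OF iprod_in'[OF w U]] scaleR_right_diff_distrib mult.commute)
  qed (simp add: nat_lie_outside)
qed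

lemma nat_lie_nat_lie:
  assumes V: "V \<in> vfields A" and W: "W \<in> vfields A"
  shows "\<omega> \<in> forms A p j \<Longrightarrow> nat_lie A j (vbracket V W) \<omega> Vs =
    nat_lie A (j + fst W) V (nat_lie A j W \<omega>) Vs -
    sg (fst V * fst W) *\<^sub>R nat_lie A (j + fst V) W (nat_lie A j V \<omega>) Vs"
proof (induction Vs arbitrary: p j \<omega>)
  case Nil
  show ?case using V W vbracket_in[OF V W] by (simp add: nat_lie_Nil snd_vops)
next
  case (Cons U Vs)
  note w = Cons.prems
  show ?case
  proof (cases "U \<in> vfields A")
    case U: True
    note VW = vbracket_in[OF V W]
    have exp: "iprod (j + fst V + fst W) U (nat_lie A (j + fst W) V (nat_lie A j W \<omega>)) Vs =
        sg (fst V * (fst U - 1)) *\<^sub>R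
        (sg (fst W * (fst U - 1)) *\<^sub>R
          (nat_lie A (j + fst U + fst W) V (nat_lie A (j + fst U) W (iprod j U \<omega>)) Vs
           - nat_lie A (j + fst W + fst U) V (iprod j (vbracket W U) \<omega>) Vs)
          - (sg (fst W * (fst V + fst U - 1)) *\<^sub>R
          (nat_lie A (j + fst V + fst U) W (iprod j (vbracket V U) \<omega>) Vs - iprod j (vbracket W (vbracket V U)) \<omega> Vs)))"
      if V: "V \<in> vfields A" and W: "W \<in> vfields A" for V W
    proof -
      have in1: "nat_lie A (j + fst U) W (iprod j U \<omega>) \<in> forms A (p - 1) (j + fst W + fst U)"
        using nat_lie_in[OF W iprod_in'[OF w U]] by (simp add: ac_simps)
      have in2: "iprod j (vbracket W U) \<omega> \<in> forms A (p - 1) (j + fst W + fst U)"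
        using iprod_in'[OF w vbracket_in[OF W U]] by (simp add: ac_simps)
      have 1: "nat_lie A (j + fst W + fst U) V (\<lambda>Vs. sg (fst W * (fst U - 1)) *\<^sub>R
          (nat_lie A (j + fst U) W (iprod j U \<omega>) Vs - iprod j (vbracket W U) \<omega> Vs)) Vs =
          sg (fst W * (fst U - 1)) *\<^sub>R
          (nat_lie A (j + fst W + fst U) V (nat_lie A (j + fst U) W (iprod j U \<omega>)) Vs
           - nat_lie A (j + fst W + fst U) V (iprod j (vbracket W U) \<omega>) Vs)"
        by (simp add: nat_lie_scale[OF form_diff_in[OF in1 in2]] nat_lie_diff[OF in1 in2])
      have 2: "j + fst V + fst W = j + fst W + fst V" "j + fst W + fst U = j + fst U + fst W"
        by simp_all
      have 3: "iprod (j + fst W) (vbracket V U) (nat_lie A j W \<omega>) Vs =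
          sg (fst W * (fst V + fst U - 1)) *\<^sub>R
          (nat_lie A (j + fst V + fst U) W (iprod j (vbracket V U) \<omega>) Vs - iprod j (vbracket W (vbracket V U)) \<omega> Vs)"
        using iprod_nat_lie[OF w W vbracket_in[OF V U]] by (simp add: add.assoc)
      show ?thesis
        unfolding 2(1) iprod_nat_lie[OF nat_lie_in[OF W w] V U] iprod_nat_lie[OF w W U] 1 3
        by (simp add: 2(2))
    qed
    have jac: "iprod j (vbracket V (vbracket W U)) \<omega> Vs = iprod j (vbracket (vbracket V W) U) \<omega> Vs +
        sg (fst V * fst W) *\<^sub>R iprod j (vbracket W (vbracket V U)) \<omega> Vs"
      unfolding vbracket_jacobi[OF V W U]
      using iprod_vadd[OF w vbracket_in[OF VW U] vscale_in[OF vbracket_in[OF W vbracket_in[OF V U]]]]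
      by (simp add: iprod_vscale[OF w vbracket_in[OF W vbracket_in[OF V U]]])
    have IH: "nat_lie A (j + fst U) (vbracket V W) (iprod j U \<omega>) Vs =
        nat_lie A (j + fst U + fst W) V (nat_lie A (j + fst U) W (iprod j U \<omega>)) Vs -
        sg (fst V * fst W) *\<^sub>R nat_lie A (j + fst U + fst V) W (nat_lie A (j + fst U) V (iprod j U \<omega>)) Vs"
      by (rule Cons.IH[OF iprod_in'[OF w U]])
    have lhs: "iprod (j + fst V + fst W) U (nat_lie A j (vbracket V W) \<omega>) Vs =
        sg ((fst V + fst W) * (fst U - 1)) *\<^sub>R
        (nat_lie A (j + fst U) (vbracket V W) (iprod j U \<omega>) Vs - iprod j (vbracket (vbracket V W) U) \<omega> Vs)"
      using iprod_nat_lie[OF w VW U] by (simp add: add.assoc)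
    have e: "j + fst W + fst V = j + fst V + fst W" by simp
    have exp': "iprod (j + fst V + fst W) U (nat_lie A (j + fst V) W (nat_lie A j V \<omega>)) Vs =
        sg (fst W * (fst U - 1)) *\<^sub>R
        (sg (fst V * (fst U - 1)) *\<^sub>R
          (nat_lie A (j + fst U + fst V) W (nat_lie A (j + fst U) V (iprod j U \<omega>)) Vs
           - nat_lie A (j + fst V + fst U) W (iprod j (vbracket V U) \<omega>) Vs)
          - (sg (fst V * (fst W + fst U - 1)) *\<^sub>R
          (nat_lie A (j + fst W + fst U) V (iprod j (vbracket W U) \<omega>) Vs - iprod j (vbracket V (vbracket W U)) \<omega> Vs)))"
      using exp[OF W V] unfolding e .
    show ?thesis
      by (rule form_Cons_eqI[of "j + fst V + fst W"], unfold iprod_lin lhs exp[OF V W] exp' jac IH)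
        (cases "even (fst U)"; cases "even (fst V)"; cases "even (fst W)"; simp add: sg_def)
  qed (simp add: nat_lie_outside)
qed

lemma nat_lie_wedge:
  assumes V: "V \<in> vfields A"
  shows "\<alpha> \<in> forms A p j \<Longrightarrow> \<beta> \<in> forms A q k \<Longrightarrow> nat_lie A (j + k) V (wedge p j \<alpha> k \<beta>) Vs =
    wedge p (j + fst V) (nat_lie A j V \<alpha>) k \<beta> Vs +
    sg (fst V * (j + int p)) *\<^sub>R wedge p j \<alpha> (k + fst V) (nat_lie A k V \<beta>) Vs"
proof (induction Vs arbitrary: p q j k \<alpha> \<beta>)
  case Nil
  have a: "\<alpha> [] \<in> A j" "\<beta> [] \<in> A k"
    using form_val[OF Nil(1), of "[]"] form_val[OF Nil(2), of "[]"] by auto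
  have "p \<noteq> 0 \<Longrightarrow> \<alpha> [] = 0"
    using formD(2)[OF Nil(1), of "[]"] by simp
  then show ?case
    by (cases "p = 0") (simp_all add: nat_lie_Nil V vfieldD(4)[OF V a])
next
  case (Cons U Vs)
  note \<alpha> = Cons.prems(1) and \<beta> = Cons.prems(2)
  note lin_in = wedge_in[OF \<alpha> \<beta>]
  show ?case
  proof (cases "U \<in> vfields A")
    case False
    have "wedge p j' \<omega> k' \<tau> (U # Vs) = 0" if "\<omega> \<in> forms A p j''" "\<tau> \<in> forms A q k''" for \<omega> \<tau> j' k' j'' k''
      by (simp add: wedge_Cons iprod_not_vfield[OF that(1) False] iprod_not_vfield[OF that(2) False])
    with nat_lie_in[OF V \<alpha>] nat_lie_in[OF V \<beta>] \<alpha> \<beta> False show ?thesis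
      by (simp add: nat_lie_outside)
  next
    case U: True
    let ?W = "vbracket V U"
    note VU = vbracket_in[OF V U]
    have int_p: "iprod j U \<alpha> = (\<lambda>Vs. 0) \<or> int (p - 1) = int p - 1"
      using \<alpha> by (cases p) (auto simp: iprod_form_0)
    have \<alpha>U: "wedge (p - 1) (j + fst U) (iprod j U \<alpha>) k \<beta> \<in> forms A (p + q - 1) (j + k + fst U)"
      using wedge_in[OF iprod_in'[OF \<alpha> U] \<beta>] \<alpha> by (cases p) (auto simp: iprod_form_0 ac_simps)
    have \<beta>U: "wedge p j \<alpha> (k + fst U) (iprod k U \<beta>) \<in> forms A (p + q - 1) (j + k + fst U)"
      using wedge_in[OF \<alpha> iprod_in'[OF \<beta> U]] \<beta> by (cases q) (auto simp: iprod_form_0 ac_simps)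
    have 1: "nat_lie A (j + k + fst U) V (wedge (p - 1) (j + fst U) (iprod j U \<alpha>) k \<beta>) Vs =
        wedge (p - 1) (j + fst U + fst V) (nat_lie A (j + fst U) V (iprod j U \<alpha>)) k \<beta> Vs +
        sg (fst V * (j + fst U + int p - 1)) *\<^sub>R
          wedge (p - 1) (j + fst U) (iprod j U \<alpha>) (k + fst V) (nat_lie A k V \<beta>) Vs"
      using Cons.IH[OF iprod_in'[OF \<alpha> U] \<beta>] int_p by (auto simp: ac_simps add_diff_eq)
    have 2: "nat_lie A (j + k + fst U) V (wedge p j \<alpha> (k + fst U) (iprod k U \<beta>)) Vs =
        wedge p (j + fst V) (nat_lie A j V \<alpha>) (k + fst U) (iprod k U \<beta>) Vs +
        sg (fst V * (j + int p)) *\<^sub>R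
          wedge p j \<alpha> (k + fst U + fst V) (nat_lie A (k + fst U) V (iprod k U \<beta>)) Vs"
      using Cons.IH[OF \<alpha> iprod_in'[OF \<beta> U]] by (simp add: ac_simps)
    have 3: "iprod (j + k) ?W (wedge p j \<alpha> k \<beta>) Vs =
        wedge (p - 1) (j + fst V + fst U) (iprod j ?W \<alpha>) k \<beta> Vs +
        sg ((fst V + fst U - 1) * (j + int p)) *\<^sub>R wedge p j \<alpha> (k + fst V + fst U) (iprod k ?W \<beta>) Vs"
      unfolding iprod_wedge by (simp add: add.assoc)
    have lhs: "iprod (j + k + fst V) U (nat_lie A (j + k) V (wedge p j \<alpha> k \<beta>)) Vs =
      sg (fst V * (fst U - 1)) *\<^sub>R
      (nat_lie A (j + k + fst U) V (wedge (p - 1) (j + fst U) (iprod j U \<alpha>) k \<beta>) Vs +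
        sg ((fst U - 1) * (j + int p)) *\<^sub>R
          nat_lie A (j + k + fst U) V (wedge p j \<alpha> (k + fst U) (iprod k U \<beta>)) Vs
        - iprod (j + k) ?W (wedge p j \<alpha> k \<beta>) Vs)"
      unfolding iprod_nat_lie[OF lin_in V U] iprod_wedge[of j k U] nat_lie_add[OF \<alpha>U form_scale_in[OF \<beta>U]]
        nat_lie_scale[OF \<beta>U] ..
    have r1: "iprod (j + k + fst V) U (wedge p (j + fst V) (nat_lie A j V \<alpha>) k \<beta>) Vs =
        sg (fst V * (fst U - 1)) *\<^sub>R
          (wedge (p - 1) (j + fst U + fst V) (nat_lie A (j + fst U) V (iprod j U \<alpha>)) k \<beta> Vs -
           wedge (p - 1) (j + fst V + fst U) (iprod j ?W \<alpha>) k \<beta> Vs) +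
        sg ((fst U - 1) * (j + fst V + int p)) *\<^sub>R
          wedge p (j + fst V) (nat_lie A j V \<alpha>) (k + fst U) (iprod k U \<beta>) Vs"
    proof -
      have e: "j + k + fst V = j + fst V + k" "j + fst U + fst V = j + fst V + fst U" by simp_all
      show ?thesis
        unfolding e iprod_wedge iprod_nat_lie[OF \<alpha> V U] wedge_lin ..
    qed
    have r2: "iprod (j + k + fst V) U (wedge p j \<alpha> (k + fst V) (nat_lie A k V \<beta>)) Vs =
        wedge (p - 1) (j + fst U) (iprod j U \<alpha>) (k + fst V) (nat_lie A k V \<beta>) Vs +
        sg ((fst U - 1) * (j + int p)) *\<^sub>R sg (fst V * (fst U - 1)) *\<^sub>R
          (wedge p j \<alpha> (k + fst U + fst V) (nat_lie A (k + fst U) V (iprod k U \<beta>)) Vs -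
           wedge p j \<alpha> (k + fst V + fst U) (iprod k ?W \<beta>) Vs)"
    proof -
      have e: "j + k + fst V = j + (k + fst V)" "k + fst U + fst V = k + fst V + fst U" by simp_all
      show ?thesis
        unfolding e iprod_wedge iprod_nat_lie[OF \<beta> V U] wedge_lin ..
    qed
    show ?thesis
      by (rule form_Cons_eqI[of "j + k + fst V"], unfold iprod_lin lhs r1 r2 1 2 3)
        (cases "even j"; cases "even p"; cases "even (fst U)"; cases "even (fst V)"; simp add: sg_def)
  qed
qed


lemma ext_d_add:
  "\<omega> \<in> forms A p j \<Longrightarrow> \<tau> \<in> forms A p j \<Longrightarrow>
    ext_d A j (\<lambda>Vs. \<omega> Vs + \<tau> Vs) Vs = ext_d A j \<omega> Vs + ext_d A j \<tau> Vs"
proof (induction Vs arbitrary: p j \<omega> \<tau>)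
  case (Cons V Vs)
  note w = Cons.prems(1) and t = Cons.prems(2)
  show ?case
  proof (cases "V \<in> vfields A")
    case V: True
    show ?thesis
      by (rule form_Cons_eqI[of j])
        (simp add: iprod_ext_d nat_lie_add[OF w t] Cons.IH[OF iprod_in'[OF w V] iprod_in'[OF t V]]
          scaleR_right_distrib)
  next
    case False
    show ?thesis
      by (rule form_Cons_eqI[of j])
        (simp add: iprod_ext_d_not_vfield[OF w False] iprod_ext_d_not_vfield[OF t False]
          iprod_ext_d_not_vfield[OF form_add_in[OF w t] False])
  qed
qed simp

lemma ext_d_scale:
  "\<omega> \<in> forms A p j \<Longrightarrow> ext_d A j (\<lambda>Vs. c *\<^sub>R \<omega> Vs) Vs = c *\<^sub>R ext_d A j \<omega> Vs"
proof (induction Vs arbitrary: p j \<omega>)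
  case (Cons V Vs)
  note w = Cons.prems(1)
  show ?case
  proof (cases "V \<in> vfields A")
    case V: True
    show ?thesis
      by (rule form_Cons_eqI[of j])
        (simp add: iprod_ext_d nat_lie_scale[OF w] Cons.IH[OF iprod_in'[OF w V]]
          scaleR_right_diff_distrib mult.commute)
  next
    case False
    show ?thesis
      by (rule form_Cons_eqI[of j])
        (simp add: iprod_ext_d_not_vfield[OF w False]
          iprod_ext_d_not_vfield[OF form_scale_in[OF w] False])
  qed
qed simp

lemma ext_d_diff:
  assumes "\<omega> \<in> forms A p j" "\<tau> \<in> forms A p j"
  shows "ext_d A j (\<lambda>Vs. \<omega> Vs - \<tau> Vs) Vs = ext_d A j \<omega> Vs - ext_d A j \<tau> Vs"
  using ext_d_add[OF assms(1) form_scale_in[OF assms(2), of "-1"]] ext_d_scale[OF assms(2), of "-1"]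
  by simp

lemma form0_in: "f \<in> A i \<Longrightarrow> form0 f \<in> forms A 0 i"
  by (auto simp: form_0_iff)

lemma nat_lie_form0:
  assumes V: "V \<in> vfields A" and f: "f \<in> A i"
  shows "nat_lie A i V (form0 f) = form0 (snd V f)"
proof -
  obtain g where g: "nat_lie A i V (form0 f) = form0 g"
    using nat_lie_in[OF V form0_in[OF f]] by (auto simp: form_0_iff)
  have "g = snd V f"
    using fun_cong[OF g, of "[]"] V by (simp add: nat_lie_Nil form0_def)
  with g show ?thesis by simp
qed

lemma iprod_ext_d_form0:
  assumes V: "V \<in> vfields A" and f: "f \<in> A i"
  shows "iprod i V (ext_d A i (form0 f)) = form0 (snd V f)"
  by (simp add: iprod_ext_d nat_lie_form0[OF V f])

lemma ext_d_fmult: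
  assumes f: "f \<in> A i"
  shows "\<omega> \<in> forms A p j \<Longrightarrow> ext_d A (i + j) (\<lambda>Vs. f * \<omega> Vs) Vs =
    wedge 1 i (ext_d A i (form0 f)) j \<omega> Vs + sg i *\<^sub>R (f * ext_d A j \<omega> Vs)"
proof (induction Vs arbitrary: p j \<omega>)
  case (Cons U Vs)
  note w = Cons.prems
  show ?case
  proof (cases "U \<in> vfields A")
    case U: True
    have Uf: "snd U f \<in> A (i + fst U)"
      by (rule vfieldD(1)[OF U f])
    have IH: "ext_d A (i + j + fst U) (\<lambda>Vs. f * iprod j U \<omega> Vs) Vs =
        wedge 1 i (ext_d A i (form0 f)) (j + fst U) (iprod j U \<omega>) Vs +
        sg i *\<^sub>R (f * ext_d A (j + fst U) (iprod j U \<omega>) Vs)"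
      using Cons.IH[OF iprod_in'[OF w U]] by (simp add: add.assoc)
    have l: "iprod (i + j) U (ext_d A (i + j) (\<lambda>Vs. f * \<omega> Vs)) Vs =
        snd U f * \<omega> Vs + sg (fst U * i) *\<^sub>R (f * nat_lie A j U \<omega> Vs) -
        sg (fst U) *\<^sub>R sg (i * (fst U - 1)) *\<^sub>R ext_d A (i + j + fst U) (\<lambda>Vs. f * iprod j U \<omega> Vs) Vs"
    proof -
      have "(\<lambda>Vs. f * iprod j U \<omega> Vs) \<in> forms A (p - 1) (i + j + fst U)"
        using form_fmult_in[OF f iprod_in'[OF w U]] by (simp add: add.assoc)
      from ext_d_scale[OF this] show ?thesis
        unfolding iprod_ext_d nat_lie_fmult[OF w f U] iprod_fmult by simp
    qed
    have r: "iprod (i + j) U (\<lambda>Vs. wedge 1 i (ext_d A i (form0 f)) j \<omega> Vs +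
          sg i *\<^sub>R (f * ext_d A j \<omega> Vs)) Vs =
        snd U f * \<omega> Vs + sg ((fst U - 1) * (i + 1)) *\<^sub>R
          wedge 1 i (ext_d A i (form0 f)) (j + fst U) (iprod j U \<omega>) Vs +
        sg i *\<^sub>R sg (i * (fst U - 1)) *\<^sub>R
          (f * (nat_lie A j U \<omega> Vs - sg (fst U) *\<^sub>R ext_d A (j + fst U) (iprod j U \<omega>) Vs))"
      unfolding iprod_lin iprod_wedge iprod_ext_d_form0[OF U f] iprod_fmult unfolding iprod_ext_d
      by (simp add: wedge_form0_left)
    show ?thesis
      by (rule form_Cons_eqI[of "i + j"], unfold l r IH)
        (cases "even i"; cases "even (fst U)"; simp add: sg_def right_diff_distrib distrib_left)
  next
    case False
    show ?thesis
      by (rule form_Cons_eqI[of "i + j"])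
        (simp add: iprod_ext_d_not_vfield[OF form_fmult_in[OF f w] False] iprod_wedge
          iprod_ext_d_not_vfield[OF form0_in[OF f] False] iprod_not_vfield[OF w False] iprod_fmult
          iprod_ext_d_not_vfield[OF w False])
  qed
qed simp

lemma nat_lie_vmult:
  assumes f: "f \<in> A i" and V: "V \<in> vfields A"
  shows "\<omega> \<in> forms A p j \<Longrightarrow> nat_lie A j (vmult i f V) \<omega> Vs = f * nat_lie A j V \<omega> Vs +
    sg (i + fst V) *\<^sub>R wedge 1 i (ext_d A i (form0 f)) (j + fst V) (iprod j V \<omega>) Vs"
proof (induction Vs arbitrary: p j \<omega>)
  case Nil
  show ?case
    using V vmult_in[OF V f] by (simp add: nat_lie_Nil snd_vops)
next
  case (Cons U Vs)
  note w = Cons.prems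
  note fV = vmult_in[OF V f]
  show ?case
  proof (cases "U \<in> vfields A")
    case U: True
    let ?df = "ext_d A i (form0 f)"
    have Uf: "snd U f \<in> A (i + fst U)"
      by (rule vfieldD(1)[OF U f])
    have br: "iprod j (vbracket (vmult i f V) U) \<omega> Vs = f * iprod j (vbracket V U) \<omega> Vs -
        sg ((i + fst V) * fst U) *\<^sub>R (snd U f * iprod j V \<omega> Vs)"
      unfolding vbracket_vmult_left[OF V U f]
      using iprod_vadd[OF w vmult_in[OF vbracket_in[OF V U] f] vscale_in[OF vmult_in[OF V Uf]]]
      by (simp add: iprod_vscale[OF w vmult_in[OF V Uf]]
          iprod_vmult[OF w f vbracket_in[OF V U]] iprod_vmult[OF w Uf V])
    have 1: "iprod (j + (i + fst V)) U (nat_lie A j (vmult i f V) \<omega>) Vs =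
        sg ((i + fst V) * (fst U - 1)) *\<^sub>R
        (nat_lie A (j + fst U) (vmult i f V) (iprod j U \<omega>) Vs - iprod j (vbracket (vmult i f V) U) \<omega> Vs)"
      using iprod_nat_lie[OF w fV U] by simp
    have 2: "iprod (j + (i + fst V)) U (\<lambda>Vs. f * nat_lie A j V \<omega> Vs) Vs =
        sg (i * (fst U - 1)) *\<^sub>R (f * (sg (fst V * (fst U - 1)) *\<^sub>R
          (nat_lie A (j + fst U) V (iprod j U \<omega>) Vs - iprod j (vbracket V U) \<omega> Vs)))"
      using iprod_fmult[of i "j + fst V" U f "nat_lie A j V \<omega>"] iprod_nat_lie[OF w V U]
      by (simp add: ac_simps)
    have 3: "iprod (j + (i + fst V)) U (wedge 1 i ?df (j + fst V) (iprod j V \<omega>)) Vs =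
        snd U f * iprod j V \<omega> Vs + sg ((fst U - 1) * (i + 1)) *\<^sub>R
          sg ((fst U - 1) * (fst V - 1)) *\<^sub>R
          wedge 1 i ?df (j + fst U + fst V) (iprod (j + fst U) V (iprod j U \<omega>)) Vs"
    proof -
      have e: "j + (i + fst V) = i + (j + fst V)" "j + fst V + fst U = j + fst U + fst V" by simp_all
      show ?thesis
        unfolding e iprod_wedge iprod_ext_d_form0[OF U f] iprod_iprod[OF w U V] wedge_lin
        by (simp add: wedge_form0_left)
    qed
    show ?thesis
      by (rule form_Cons_eqI[of "j + (i + fst V)"],
          unfold iprod_lin 1 2 3 br Cons.IH[OF iprod_in'[OF w U]])
        (cases "even i"; cases "even (fst U)"; cases "even (fst V)"; simp add: sg_def right_diff_distrib distrib_left)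
  next
    case False
    show ?thesis
      using False
      by (simp add: nat_lie_outside wedge_Cons iprod_ext_d_not_vfield[OF form0_in[OF f] False]
          iprod_not_vfield[OF iprod_in'[OF w V] False])
  qed
qed

lemma ext_d_in: "\<omega> \<in> forms A p j \<Longrightarrow> ext_d A j \<omega> \<in> forms A (Suc p) j"
proof (induction p arbitrary: j \<omega> rule: less_induct)
  case (less p)
  note w = less.prems
  have d_in: "ext_d A (j + fst V) (iprod j V \<omega>) \<in> forms A p (j + fst V)" if V: "V \<in> vfields A" for V
  proof (cases p)
    case 0
    then show ?thesis using w by (simp add: iprod_form_0)
  next
    case (Suc q)
    then show ?thesis
      using less.IH[of q "iprod j V \<omega>" "j + fst V"] iprod_in'[OF w V] by simp
  qed
  show ?case
  proof (rule form_SucI)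
    show "ext_d A j \<omega> (V # Vs) = 0" if "V \<notin> vfields A" for V Vs
      by (simp add: eval_iprod[of "ext_d A j \<omega>" _ _ j] iprod_ext_d_not_vfield[OF w that])
    show "iprod j V (ext_d A j \<omega>) \<in> forms A p (j + fst V)" if V: "V \<in> vfields A" for V
      unfolding iprod_ext_d by (intro form_diff_in form_scale_in nat_lie_in[OF V w] d_in[OF V])
    show "iprod j (vadd V W) (ext_d A j \<omega>) Vs = iprod j V (ext_d A j \<omega>) Vs + iprod j W (ext_d A j \<omega>) Vs"
      if V: "V \<in> vfields A" and W: "W \<in> vfields A" and eq: "fst V = fst W" for V W Vs
    proof -
      have "iprod j W \<omega> \<in> forms A (p - 1) (j + fst V)"
        using iprod_in'[OF w W] eq by simp
      from ext_d_add[OF iprod_in'[OF w V] this] show ?thesis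
        unfolding iprod_ext_d iprod_vadd[OF w V W eq] nat_lie_vadd[OF V W eq w]
        by (simp add: scaleR_right_distrib eq)
    qed
    show "iprod j (vscale c V) (ext_d A j \<omega>) Vs = c *\<^sub>R iprod j V (ext_d A j \<omega>) Vs"
      if V: "V \<in> vfields A" for V c Vs
      unfolding iprod_ext_d iprod_vscale[OF w V] nat_lie_vscale[OF V w] fst_vops
        ext_d_scale[OF iprod_in'[OF w V]]
      by (simp add: scaleR_right_diff_distrib mult.commute)
    show "iprod j (vmult i f V) (ext_d A j \<omega>) Vs = f * iprod j V (ext_d A j \<omega>) Vs"
      if V: "V \<in> vfields A" and f: "f \<in> A i" for V f i Vs
    proof -
      have "ext_d A (j + (i + fst V)) (\<lambda>Vs. f * iprod j V \<omega> Vs) Vs =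
          wedge 1 i (ext_d A i (form0 f)) (j + fst V) (iprod j V \<omega>) Vs +
          sg i *\<^sub>R (f * ext_d A (j + fst V) (iprod j V \<omega>) Vs)"
        using ext_d_fmult[OF f iprod_in'[OF w V]] by (simp add: ac_simps)
      then show ?thesis
        unfolding iprod_ext_d iprod_vmult[OF w f V] nat_lie_vmult[OF f V w] fst_vops
        by (simp only:)
          (cases "even i"; cases "even (fst V)"; simp add: sg_def right_diff_distrib distrib_left)
    qed
    show "iprod (j + fst V) U (iprod j V (ext_d A j \<omega>)) Vs =
        sg ((fst U - 1) * (fst V - 1)) *\<^sub>R iprod (j + fst U) V (iprod j U (ext_d A j \<omega>)) Vs"
      if U: "U \<in> vfields A" and V: "V \<in> vfields A" for U V Vs
    proof -
      have exp: "iprod (j + fst V) U (iprod j V (ext_d A j \<omega>)) Vs =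
          sg (fst V * (fst U - 1)) *\<^sub>R (nat_lie A (j + fst U) V (iprod j U \<omega>) Vs - iprod j (vbracket V U) \<omega> Vs)
          - sg (fst V) *\<^sub>R (nat_lie A (j + fst V) U (iprod j V \<omega>) Vs
            - sg (fst U) *\<^sub>R ext_d A (j + fst V + fst U) (iprod (j + fst V) U (iprod j V \<omega>)) Vs)"
        if U: "U \<in> vfields A" and V: "V \<in> vfields A" for U V
        unfolding iprod_ext_d iprod_lin iprod_nat_lie[OF w V U] ..
      have in1: "iprod (j + fst U) V (iprod j U \<omega>) \<in> forms A (p - 1 - 1) (j + fst V + fst U)"
        using iprod_in'[OF iprod_in'[OF w U] V] by (simp add: ac_simps)
      have 1: "ext_d A (j + fst V + fst U) (iprod (j + fst V) U (iprod j V \<omega>)) Vs =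
          sg ((fst U - 1) * (fst V - 1)) *\<^sub>R
            ext_d A (j + fst U + fst V) (iprod (j + fst U) V (iprod j U \<omega>)) Vs"
        unfolding iprod_iprod[OF w U V] ext_d_scale[OF in1] by (simp add: ac_simps)
      have 2: "iprod j (vbracket V U) \<omega> Vs = - (sg (fst U * fst V) *\<^sub>R iprod j (vbracket U V) \<omega> Vs)"
        unfolding vbracket_swap[of V U] iprod_vscale[OF w vbracket_in[OF U V]] by (simp add: mult.commute)
      show ?thesis
        unfolding exp[OF U V] exp[OF V U] 1 2
        by (cases "even (fst U)"; cases "even (fst V)"; simp add: sg_def)
    qed
  qed simp
qed

lemma nat_lie_ext_d:
  assumes V: "V \<in> vfields A"
  shows "\<omega> \<in> forms A p j \<Longrightarrow>
    nat_lie A j V (ext_d A j \<omega>) Vs = sg (fst V) *\<^sub>R ext_d A (j + fst V) (nat_lie A j V \<omega>) Vs"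
proof (induction Vs arbitrary: p j \<omega>)
  case Nil
  then show ?case using V by (simp add: nat_lie_Nil)
next
  case (Cons U Vs)
  note w = Cons.prems
  show ?case
  proof (cases "U \<in> vfields A")
    case U: True
    note dU = ext_d_in[OF iprod_in'[OF w U]]
    have NU: "nat_lie A j U \<omega> \<in> forms A p (j + fst U)" by (rule nat_lie_in[OF U w])
    have dU': "ext_d A (j + fst U) (iprod j U \<omega>) \<in> forms A p (j + fst U)"
      using dU w by (cases p) (auto simp: iprod_form_0)
    have l: "iprod (j + fst V) U (nat_lie A j V (ext_d A j \<omega>)) Vs = sg (fst V * (fst U - 1)) *\<^sub>R
       (nat_lie A (j + fst U) V (nat_lie A j U \<omega>) Vs
        - sg (fst U) *\<^sub>R nat_lie A (j + fst U) V (ext_d A (j + fst U) (iprod j U \<omega>)) Vs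
        - (nat_lie A j (vbracket V U) \<omega> Vs
           - sg (fst V + fst U) *\<^sub>R ext_d A (j + fst V + fst U) (iprod j (vbracket V U) \<omega>) Vs))"
      unfolding iprod_nat_lie[OF ext_d_in[OF w] V U] iprod_ext_d
        nat_lie_diff[OF NU form_scale_in[OF dU']] nat_lie_scale[OF dU'] by (simp add: add.assoc)
    have in1: "nat_lie A (j + fst U) V (iprod j U \<omega>) \<in> forms A (p - 1) (j + fst V + fst U)"
      using nat_lie_in[OF V iprod_in'[OF w U]] by (simp add: ac_simps)
    have in2: "iprod j (vbracket V U) \<omega> \<in> forms A (p - 1) (j + fst V + fst U)"
      using iprod_in'[OF w vbracket_in[OF V U]] by (simp add: add.assoc)
    have r: "iprod (j + fst V) U (ext_d A (j + fst V) (nat_lie A j V \<omega>)) Vs =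
        nat_lie A (j + fst V) U (nat_lie A j V \<omega>) Vs - sg (fst U) *\<^sub>R sg (fst V * (fst U - 1)) *\<^sub>R
        (ext_d A (j + fst V + fst U) (nat_lie A (j + fst U) V (iprod j U \<omega>)) Vs
         - ext_d A (j + fst V + fst U) (iprod j (vbracket V U) \<omega>) Vs)"
      unfolding iprod_ext_d[of "j + fst V"] iprod_nat_lie[OF w V U]
        ext_d_scale[OF form_diff_in[OF in1 in2]] ext_d_diff[OF in1 in2] ..
    have e: "j + fst U + fst V = j + fst V + fst U" by simp
    show ?thesis
      by (rule form_Cons_eqI[of "j + fst V"],
          unfold iprod_lin l r Cons.IH[OF iprod_in'[OF w U]] nat_lie_nat_lie[OF V U w] e)
        (cases "even (fst U)"; cases "even (fst V)"; simp add: sg_def)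
  next
    case False
    show ?thesis
      by (rule form_Cons_eqI[of "j + fst V"], unfold iprod_lin)
        (simp add: iprod_not_vfield[OF nat_lie_in[OF V ext_d_in[OF w]] False]
          iprod_not_vfield[OF ext_d_in[OF nat_lie_in[OF V w]] False])
  qed
qed

lemma ext_d_ext_d: "\<omega> \<in> forms A p j \<Longrightarrow> ext_d A j (ext_d A j \<omega>) Vs = 0"
proof (induction Vs arbitrary: p j \<omega>)
  case (Cons V Vs)
  note w = Cons.prems
  have "iprod j V (ext_d A j (ext_d A j \<omega>)) Vs = 0"
  proof (cases "V \<in> vfields A")
    case V: True
    have dV: "ext_d A (j + fst V) (iprod j V \<omega>) \<in> forms A p (j + fst V)"
      using ext_d_in[OF iprod_in'[OF w V]] w by (cases p) (auto simp: iprod_form_0)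
    show ?thesis
      unfolding iprod_ext_d nat_lie_ext_d[OF V w]
        ext_d_diff[OF nat_lie_in[OF V w] form_scale_in[OF dV]] ext_d_scale[OF dV]
        Cons.IH[OF iprod_in'[OF w V]] by simp
  next
    case False
    then show ?thesis
      using iprod_ext_d_not_vfield[OF ext_d_in[OF w] False] by simp
  qed
  then show ?case
    by (simp add: eval_iprod[of "ext_d A j (ext_d A j \<omega>)" _ _ j])
qed simp

lemma ext_d_wedge:
  "\<alpha> \<in> forms A p j \<Longrightarrow> \<beta> \<in> forms A q k \<Longrightarrow> ext_d A (j + k) (wedge p j \<alpha> k \<beta>) Vs =
    wedge (p + 1) j (ext_d A j \<alpha>) k \<beta> Vs + sg (j + int p) *\<^sub>R wedge p j \<alpha> k (ext_d A k \<beta>) Vs"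
proof (induction Vs arbitrary: p q j k \<alpha> \<beta>)
  case (Cons U Vs)
  note \<alpha> = Cons.prems(1) and \<beta> = Cons.prems(2)
  show ?case
  proof (cases "U \<in> vfields A")
    case U: True
    have \<alpha>U: "wedge (p - 1) (j + fst U) (iprod j U \<alpha>) k \<beta> \<in> forms A (p + q - 1) (j + k + fst U)"
      using wedge_in[OF iprod_in'[OF \<alpha> U] \<beta>] \<alpha> by (cases p) (auto simp: iprod_form_0 ac_simps)
    have \<beta>U: "wedge p j \<alpha> (k + fst U) (iprod k U \<beta>) \<in> forms A (p + q - 1) (j + k + fst U)"
      using wedge_in[OF \<alpha> iprod_in'[OF \<beta> U]] \<beta> by (cases q) (auto simp: iprod_form_0 ac_simps)
    have 1: "ext_d A (j + k + fst U) (wedge (p - 1) (j + fst U) (iprod j U \<alpha>) k \<beta>) Vs =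
        wedge p (j + fst U) (ext_d A (j + fst U) (iprod j U \<alpha>)) k \<beta> Vs +
        sg (j + fst U + int p - 1) *\<^sub>R wedge (p - 1) (j + fst U) (iprod j U \<alpha>) k (ext_d A k \<beta>) Vs"
      using Cons.IH[OF iprod_in'[OF \<alpha> U] \<beta>] \<alpha>
      by (cases p) (auto simp: iprod_form_0 ac_simps add_diff_eq)
    have 2: "ext_d A (j + k + fst U) (wedge p j \<alpha> (k + fst U) (iprod k U \<beta>)) Vs =
        wedge (p + 1) j (ext_d A j \<alpha>) (k + fst U) (iprod k U \<beta>) Vs +
        sg (j + int p) *\<^sub>R wedge p j \<alpha> (k + fst U) (ext_d A (k + fst U) (iprod k U \<beta>)) Vs"
      using Cons.IH[OF \<alpha> iprod_in'[OF \<beta> U]] by (simp add: ac_simps)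
    have l: "iprod (j + k) U (ext_d A (j + k) (wedge p j \<alpha> k \<beta>)) Vs =
        wedge p (j + fst U) (nat_lie A j U \<alpha>) k \<beta> Vs +
        sg (fst U * (j + int p)) *\<^sub>R wedge p j \<alpha> (k + fst U) (nat_lie A k U \<beta>) Vs
        - sg (fst U) *\<^sub>R (ext_d A (j + k + fst U) (wedge (p - 1) (j + fst U) (iprod j U \<alpha>) k \<beta>) Vs +
          sg ((fst U - 1) * (j + int p)) *\<^sub>R
            ext_d A (j + k + fst U) (wedge p j \<alpha> (k + fst U) (iprod k U \<beta>)) Vs)"
      unfolding iprod_ext_d iprod_wedge nat_lie_wedge[OF U \<alpha> \<beta>]
        ext_d_add[OF \<alpha>U form_scale_in[OF \<beta>U]] ext_d_scale[OF \<beta>U] ..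
    have r1: "iprod (j + k) U (wedge (p + 1) j (ext_d A j \<alpha>) k \<beta>) Vs =
        wedge p (j + fst U) (nat_lie A j U \<alpha>) k \<beta> Vs
        - sg (fst U) *\<^sub>R wedge p (j + fst U) (ext_d A (j + fst U) (iprod j U \<alpha>)) k \<beta> Vs
        + sg ((fst U - 1) * (j + int p + 1)) *\<^sub>R
          wedge (p + 1) j (ext_d A j \<alpha>) (k + fst U) (iprod k U \<beta>) Vs"
      unfolding iprod_wedge iprod_ext_d wedge_lin by (simp add: ac_simps)
    have r2: "iprod (j + k) U (wedge p j \<alpha> k (ext_d A k \<beta>)) Vs =
        wedge (p - 1) (j + fst U) (iprod j U \<alpha>) k (ext_d A k \<beta>) Vs
        + sg ((fst U - 1) * (j + int p)) *\<^sub>R (wedge p j \<alpha> (k + fst U) (nat_lie A k U \<beta>) Vs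
          - sg (fst U) *\<^sub>R wedge p j \<alpha> (k + fst U) (ext_d A (k + fst U) (iprod k U \<beta>)) Vs)"
      unfolding iprod_wedge iprod_ext_d wedge_lin ..
    show ?thesis
      by (rule form_Cons_eqI[of "j + k"], unfold iprod_lin l r1 r2 1 2)
        (cases "even j"; cases "even p"; cases "even (fst U)"; simp add: sg_def)
  next
    case False
    show ?thesis
      by (rule form_Cons_eqI[of "j + k"], unfold iprod_lin iprod_wedge)
        (simp add: iprod_ext_d_not_vfield[OF wedge_in[OF \<alpha> \<beta>] False] iprod_not_vfield[OF \<alpha> False]
          iprod_not_vfield[OF \<beta> False] iprod_ext_d_not_vfield[OF \<alpha> False]
          iprod_ext_d_not_vfield[OF \<beta> False])
  qed
qed simp

theorem exterior_differential_ext_d: "exterior_differential A (ext_d A)"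
  unfolding exterior_differential_def
  by (intro conjI allI ballI ext)
    (simp_all add: ext_d_in ext_d_add ext_d_scale ext_d_ext_d iprod_ext_d_form0 ext_d_wedge)

theorem wedge_properties:
  assumes \<alpha>: "\<alpha> \<in> forms A p j" and \<beta>: "\<beta> \<in> forms A q k"
  shows "wedge p j \<alpha> k \<beta> \<in> forms A (p + q) (j + k)"
    and "wedge p j \<alpha> k \<beta> = (\<lambda>Vs. sg ((int p + j) * (int q + k)) *\<^sub>R wedge q k \<beta> j \<alpha> Vs)"
    and "wedge 0 i (form0 f) k \<beta> = (\<lambda>Vs. f * \<beta> Vs)"
    and "iprod (j + k) V (wedge p j \<alpha> k \<beta>) =
      (\<lambda>Vs. wedge (p - 1) (j + fst V) (iprod j V \<alpha>) k \<beta> Vs +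
       sg ((fst V - 1) * (j + int p)) *\<^sub>R wedge p j \<alpha> (k + fst V) (iprod k V \<beta>) Vs)"
    and "\<gamma> \<in> forms A r m \<Longrightarrow>
      wedge (p + q) (j + k) (wedge p j \<alpha> k \<beta>) m \<gamma> = wedge p j \<alpha> (k + m) (wedge q k \<beta> m \<gamma>)"
  using wedge_in[OF \<alpha> \<beta>] wedge_comm[OF \<alpha> \<beta>] wedge_assoc[OF \<alpha> \<beta>] wedge_form0_left iprod_wedge
  by blast+

lemma lie_eq_nat_lie: "lie A j V \<omega> = nat_lie A j V \<omega>"
  by (simp add: lie_def iprod_ext_d)

end

end

theory Submission
  imports Defs
begin

text \<open>
  With \<open>\<Theta> = \<theta> + i\<^sub>Q H\<close>, the formula to be characterised reads
  \<open>\<Delta>(X, \<xi>) = ([Q, X], (-1)\<^sup>l (L\<^sub>Q \<xi> + \<Theta>(X, \<cdot>)))\<close>: the Lie derivative along \<open>Q\<close> on both summands,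
  twisted by a \<open>2\<close>-form (\<open>twisted_lie\<close>).

  Every differential has this form. The anchor condition (iv) says that the first component is
  \<open>[Q, X]\<close>. Pairing \<open>\<Delta>(X, \<xi>)\<close> with \<open>(Y, 0)\<close> in condition (iii) expresses its second component at \<open>Y\<close>
  by \<open>L\<^sub>Q \<xi>\<close> and by the second component \<open>\<beta>\<^sub>X\<close> of \<open>\<Delta>(X, 0)\<close>; the same condition for \<open>(X, 0)\<close> and
  \<open>(Y, 0)\<close> makes \<open>(X, Y) \<mapsto> \<beta>\<^sub>X(Y)\<close> skew, and the Leibniz rule (ii) makes it linear over functions. So
  \<open>\<beta>\<^sub>X = (-1)\<^sup>l \<Theta>(X, \<cdot>)\<close> for a \<open>2\<close>-form \<open>\<Theta>\<close> (\<open>ex_twisted_lie\<close>).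

  Conversely, an operator of this form satisfies (ii), (iii) and (iv) for every \<open>\<Theta>\<close>, so only the
  square and the bracket impose conditions (\<open>courant_differential_iff\<close>). Since \<open>Q\<close> is odd,
  \<open>L\<^sub>Q L\<^sub>Q\<close> is half of \<open>L\<^bsub>[Q,Q]\<^esub>\<close>, and the square sends \<open>(X, \<xi>)\<close> to half of \<open>L\<^bsub>[Q,Q]\<^esub> (X, \<xi>)\<close> plus
  \<open>(0, (L\<^sub>Q \<Theta>)(X, \<cdot>))\<close>. In the derivation rule for the bracket everything cancels by the Cartan
  calculus, except for the form \<open>L\<^sub>Q H + d\<Theta>\<close> evaluated at \<open>X, Y\<close> (\<open>twisted_lie_dorfman\<close>); as \<open>H\<close> is
  closed, \<open>L\<^sub>Q H = - d i\<^sub>Q H\<close>, and the obstruction is \<open>d\<theta>\<close>.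

  The Euler vector field, which multiplies a function of degree \<open>k\<close> by \<open>k\<close>, does two things. Its
  bracket with a vector field \<open>V\<close> is \<open>|V| V\<close>, so that \<open>[[Q, Q], X] = 0\<close> for all \<open>X\<close> forces
  \<open>[Q, Q] = 0\<close>. It acts on forms of degree \<open>j\<close> as multiplication by \<open>j\<close>, so by Cartan's formula closed
  forms of non-zero degree are exact; this gives \<open>\<theta> = d\<vartheta>\<close> for \<open>l \<noteq> 1\<close>.
\<close>

section \<open>Insertion of vector fields into forms\<close>

context graded_comm_algebra
begin

text \<open>
  The bracket \<open>dorfman\<close> mixes the signed contraction \<open>iprod\<close> with plain insertion of vector fields into
  \<open>H\<close>. The following lemmas restate the Cartan calculus for plain insertion \<open>\<omega>(V, \<cdot>)\<close>, which keeps
  the signs of all terms comparable.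
\<close>

lemma contract_in:
  assumes w: "\<omega> \<in> forms A (Suc p) j" and V: "V \<in> vfields A"
  shows "(\<lambda>Vs. \<omega> (V # Vs)) \<in> forms A p (j + fst V)"
  unfolding eval_iprod[of \<omega> V _ j] by (intro form_scale_in iprod_in[OF w V])

lemma nat_lie_contract:
  assumes w: "\<omega> \<in> forms A (Suc p) j" and V: "V \<in> vfields A" and W: "W \<in> vfields A"
  shows "nat_lie A (j + fst W) V (\<lambda>Vs. \<omega> (W # Vs)) Vs =
    nat_lie A j V \<omega> (W # Vs) + sg (fst V * j) *\<^sub>R \<omega> (vbracket V W # Vs)"
proof -
  have "nat_lie A j V \<omega> (W # Vs) = sg ((j + fst V) * (fst W - 1)) *\<^sub>R
      iprod (j + fst V) W (nat_lie A j V \<omega>) Vs"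
    by (rule eval_iprod)
  also have "\<dots> = sg ((j + fst V) * (fst W - 1)) *\<^sub>R sg (fst V * (fst W - 1)) *\<^sub>R
      (nat_lie A (j + fst W) V (iprod j W \<omega>) Vs - iprod j (vbracket V W) \<omega> Vs)"
    unfolding iprod_nat_lie[OF w V W] ..
  finally show ?thesis
    unfolding eval_iprod[of \<omega> _ _ j] nat_lie_scale[OF iprod_in[OF w W]]
    by (cases "even j"; cases "even (fst V)"; cases "even (fst W)"; simp add: sg_def)
qed

lemma ext_d_contract:
  assumes w: "\<omega> \<in> forms A (Suc p) j" and V: "V \<in> vfields A"
  shows "ext_d A j \<omega> (V # Vs) = sg (j * (fst V - 1)) *\<^sub>R nat_lie A j V \<omega> Vs
    - sg (fst V) *\<^sub>R ext_d A (j + fst V) (\<lambda>Vs. \<omega> (V # Vs)) Vs"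
  unfolding eval_iprod[of \<omega> V _ j] ext_d_scale[OF iprod_in[OF w V]]
    eval_iprod[of "ext_d A j \<omega>" V _ j] iprod_ext_d
  by (simp add: scaleR_right_diff_distrib mult.commute)

lemma ext_d_2form:
  assumes t: "\<Theta> \<in> forms A 2 k" and X: "X \<in> vfields A" and Y: "Y \<in> vfields A"
  shows "ext_d A k \<Theta> (X # Y # Vs) =
    sg (k * (fst X - 1)) *\<^sub>R nat_lie A (k + fst Y) X (\<lambda>Vs. \<Theta> (Y # Vs)) Vs
    - sg k *\<^sub>R \<Theta> (vbracket X Y # Vs)
    - sg (fst X) *\<^sub>R ext_d A (k + fst X) (\<lambda>Vs. \<Theta> (X # Vs)) (Y # Vs)"
proof -
  have t': "\<Theta> \<in> forms A (Suc (Suc 0)) k" using t by (simp add: numeral_2_eq_2)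
  show ?thesis
    unfolding nat_lie_contract[OF t' X Y] ext_d_contract[OF t' X]
    by (cases "even k"; cases "even (fst X)"; simp add: sg_def)
qed

lemma nat_lie_1form:
  assumes "V \<in> vfields A" "W \<in> vfields A"
  shows "nat_lie A j V \<xi> [W] = snd V (\<xi> [W]) - sg (fst V * j) *\<^sub>R \<xi> [vbracket V W]"
  using assms by (simp add: nat_lie_def)

lemma form_1_eqI:
  assumes x: "\<xi> \<in> forms A 1 i" and e: "\<eta> \<in> forms A 1 j"
    and eq: "\<And>V. V \<in> vfields A \<Longrightarrow> \<xi> [V] = \<eta> [V]"
  shows "\<xi> = \<eta>"
proof
  fix Vs
  show "\<xi> Vs = \<eta> Vs"
  proof (cases "length Vs = 1 \<and> set Vs \<subseteq> vfields A")
    case True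
    then show ?thesis using eq by (auto simp: length_Suc_conv)
  next
    case False
    then show ?thesis using formD(2)[OF x False] formD(2)[OF e False] by simp
  qed
qed

lemma vfield_0_in: "(k, \<lambda>f. 0) \<in> vfields A"
  by (rule vfieldI) auto

lemma sections_0_in: "X \<in> vfields A \<Longrightarrow> (X, \<lambda>Vs. 0) \<in> sections A l (fst X - l)"
  by (simp add: sections_def)

section \<open>The Euler vector field\<close>

definition euler_field :: "'f hvf"
  where "euler_field = (0, \<lambda>f. if f \<in> (\<Union>i. A i) then of_int (THE i. f \<in> A i) *\<^sub>R f else 0)"

lemma fst_euler_field [simp]: "fst euler_field = 0"
  by (simp add: euler_field_def)

lemma snd_euler_field:
  assumes f: "f \<in> A i"
  shows "snd euler_field f = of_int i *\<^sub>R f"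
proof (cases "f = 0")
  case False
  then have "(THE i. f \<in> A i) = i"
    using f A_disjoint by (intro the_equality) blast+
  then show ?thesis using f by (auto simp: euler_field_def)
qed (simp add: euler_field_def)

lemma euler_field_in: "euler_field \<in> vfields A"
proof -
  note e = snd_euler_field
  have "(0, snd euler_field) \<in> vfields A"
  proof (rule vfieldI)
    fix i f assume f: "f \<in> A i"
    show "snd euler_field f \<in> A (i + 0)"
      by (simp add: e[OF f] A_scale[OF f])
    show "snd euler_field (f + g) = snd euler_field f + snd euler_field g" if g: "g \<in> A i" for g
      by (simp add: e[OF f] e[OF g] e[OF A_add[OF f g]] scaleR_right_distrib)
    show "snd euler_field (c *\<^sub>R f) = c *\<^sub>R snd euler_field f" for c
      by (simp add: e[OF f] e[OF A_scale[OF f]])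
    show "snd euler_field (f * g) = snd euler_field f * g + sg (0 * i) *\<^sub>R (f * snd euler_field g)"
      if g: "g \<in> A j" for j g
      by (simp add: e[OF f] e[OF g] e[OF mult_A[OF f g]] scaleR_left_distrib)
  qed (auto simp: euler_field_def)
  then show ?thesis by (metis fst_euler_field prod.collapse)
qed

lemma vbracket_euler_field:
  assumes V: "V \<in> vfields A"
  shows "vbracket euler_field V = vscale (of_int (fst V)) V"
proof (rule vfield_eqI)
  fix i f assume f: "f \<in> A i"
  show "snd (vbracket euler_field V) f = snd (vscale (of_int (fst V)) V) f"
    by (simp add: snd_vops snd_euler_field[OF f] snd_euler_field[OF vfieldD(1)[OF V f]]
        vfieldD(3)[OF V f] scaleR_left_distrib)
qed (simp_all add: snd_vops vfieldD(5)[OF V] vfieldD(5)[OF euler_field_in] euler_field_in V)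

text \<open>
  Cartan's recursion contracts one argument at a time: the contracted form has degree \<open>j + |V|\<close>, and
  the extra \<open>|V|\<close> is cancelled by the term from \<open>[E, V] = |V| V\<close>.
\<close>

lemma nat_lie_euler_field:
  "\<omega> \<in> forms A p j \<Longrightarrow> nat_lie A j euler_field \<omega> Vs = of_int j *\<^sub>R \<omega> Vs"
proof (induction Vs arbitrary: p j \<omega>)
  case Nil
  show ?case
    using snd_euler_field[OF form_val[OF Nil, of "[]"]] by (simp add: nat_lie_Nil euler_field_in)
next
  case (Cons V Vs)
  note w = Cons.prems
  show ?case
  proof (cases "V \<in> vfields A")
    case V: True
    show ?thesis
      by (rule form_Cons_eqI[of "j + fst euler_field"])
        (simp only: iprod_nat_lie[OF w euler_field_in V] Cons.IH[OF iprod_in'[OF w V]]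
          vbracket_euler_field[OF V] iprod_vscale[OF w V] iprod_lin,
          simp add: scaleR_left_distrib)
  next
    case False
    then show ?thesis using formD(2)[OF w, of "V # Vs"] by (simp add: nat_lie_outside)
  qed
qed

text \<open>
  The graded substitute for the Poincare lemma: for closed \<open>\<omega>\<close>, Cartan's formula for the Euler vector
  field \<open>E\<close> reduces to \<open>j \<omega> = d (i\<^sub>E \<omega>)\<close>.
\<close>

lemma closed_form_exact:
  assumes w: "\<omega> \<in> forms A (Suc p) j" and closed: "ext_d A j \<omega> = (\<lambda>Vs. 0)" and j: "j \<noteq> 0"
  shows "\<exists>\<tau> \<in> forms A p j. \<omega> = ext_d A j \<tau>"
proof
  have i: "iprod j euler_field \<omega> \<in> forms A p j"
    using iprod_in[OF w euler_field_in] by simp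
  then show "(\<lambda>Vs. inverse (of_int j) *\<^sub>R iprod j euler_field \<omega> Vs) \<in> forms A p j"
    by (rule form_scale_in)
  have "ext_d A j (iprod j euler_field \<omega>) Vs = of_int j *\<^sub>R \<omega> Vs" for Vs
    using fun_cong[OF iprod_ext_d[of j euler_field A \<omega>], of Vs]
    by (simp add: closed nat_lie_euler_field[OF w])
  then show "\<omega> = ext_d A j (\<lambda>Vs. inverse (of_int j) *\<^sub>R iprod j euler_field \<omega> Vs)"
    using j by (simp add: ext_d_scale[OF i] fun_eq_iff)
qed

lemma eq_0_of_bracket_euler_field:
  assumes V: "V \<in> vfields A" and deg: "fst V \<noteq> 0"
    and 0: "\<And>f. snd (vbracket V euler_field) f = 0"
  shows "V = (fst V, \<lambda>f. 0)"
proof (rule prod_eqI)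
  have "snd (vbracket V euler_field) f = - (of_int (fst V) *\<^sub>R snd V f)" for f
    unfolding vbracket_swap[of V] vbracket_euler_field[OF V] by (simp add: snd_vops)
  with 0 deg show "snd V = snd (fst V, \<lambda>f. 0)" by (auto simp: fun_eq_iff)
qed simp

end

section \<open>Lie derivatives twisted by a two-form\<close>

text \<open>
  The degree of \<open>\<xi>\<close> is recovered from \<open>|\<xi>| = |X| - l\<close>. The summands \<open>\<theta>(X, \<cdot>)\<close> and \<open>H(Q, X, \<cdot>)\<close> are
  collected in \<open>\<Theta>(X, \<cdot>)\<close>: only the derivation rule for the bracket tells them apart.
\<close>

definition twisted_lie ::
    "(int \<Rightarrow> 'f::real_algebra set) \<Rightarrow> int \<Rightarrow> 'f hvf \<Rightarrow> 'f form \<Rightarrow> 'f esection \<Rightarrow> 'f esection"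
  where "twisted_lie A l Q \<Theta> = (\<lambda>(X, \<xi>). (vbracket Q X,
    \<lambda>Vs. sg l *\<^sub>R (nat_lie A (fst X - l) Q \<xi> Vs + \<Theta> (X # Vs))))"

context graded_comm_algebra
begin

context
  fixes l :: int and Q :: "'f hvf" and \<Theta> :: "'f form"
  assumes Q: "Q \<in> vfields A" and Q1: "fst Q = 1" and \<Theta>: "\<Theta> \<in> forms A 2 (1 - l)"
begin

lemma Theta_Suc_Suc: "\<Theta> \<in> forms A (Suc (Suc 0)) (1 - l)" and Theta_Suc_1: "\<Theta> \<in> forms A (Suc 1) (1 - l)"
  using \<Theta> by (simp_all add: numeral_2_eq_2)

lemma Theta_contract_in: "X \<in> vfields A \<Longrightarrow> (\<lambda>Vs. \<Theta> (X # Vs)) \<in> forms A 1 (fst X + 1 - l)"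
  using contract_in[OF Theta_Suc_1] by (simp add: algebra_simps)

lemma nat_lie_1form_in: "X \<in> vfields A \<Longrightarrow> \<xi> \<in> forms A 1 (fst X - l) \<Longrightarrow>
    nat_lie A (fst X - l) Q \<xi> \<in> forms A 1 (fst X + 1 - l)"
  using nat_lie_in[OF Q, of \<xi> 1 "fst X - l"] by (simp add: Q1 algebra_simps)

lemma twisted_lie_in:
  assumes "\<psi> \<in> sections A l j"
  shows "twisted_lie A l Q \<Theta> \<psi> \<in> sections A l (j + 1)"
proof -
  obtain X \<xi> where \<psi>: "\<psi> = (X, \<xi>)" and X: "X \<in> vfields A" and j: "j = fst X - l"
    and \<xi>: "\<xi> \<in> forms A 1 (fst X - l)"
    using assms by (auto simp: sections_def)
  show ?thesis
    using form_scale_in[OF form_add_in[OF nat_lie_1form_in[OF X \<xi>] Theta_contract_in[OF X]], of "sg l"]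
    by (simp add: \<psi> twisted_lie_def sections_def j Q1 vbracket_in[OF Q X] add_diff_eq add.commute)
qed

lemma twisted_lie_anchor:
  assumes X: "X \<in> vfields A"
  shows "anchor (twisted_lie A l Q \<Theta> (X, \<xi>)) = vscale (sg l) (vbracket (vscale (sg l) Q) X)"
  unfolding vbracket_vscale[OF X Q] by (rule prod_eqI) (simp_all add: anchor_def twisted_lie_def snd_vops)

text \<open>
  The two contributions of \<open>\<Theta>\<close> cancel by its skew symmetry; what remains is the Leibniz rule of
  \<open>L\<^sub>Q\<close> for the evaluation of \<open>1\<close>-forms.
\<close>

lemma twisted_lie_pairing:
  assumes \<psi>: "(X, \<xi>) \<in> sections A l j" and \<psi>': "(Y, \<eta>) \<in> sections A l k"
  shows "snd (vscale (sg l) Q) (pairing (X, \<xi>) (Y, \<eta>)) =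
    pairing (twisted_lie A l Q \<Theta> (X, \<xi>)) (Y, \<eta>) +
    sg (j + l) *\<^sub>R pairing (X, \<xi>) (twisted_lie A l Q \<Theta> (Y, \<eta>))"
proof -
  have X: "X \<in> vfields A" and j: "j = fst X - l" and \<xi>: "\<xi> \<in> forms A 1 (fst X - l)"
    and Y: "Y \<in> vfields A" and \<eta>: "\<eta> \<in> forms A 1 (fst Y - l)"
    using \<psi> \<psi>' by (auto simp: sections_def)
  have 1: "\<xi> [Y] \<in> A (fst X + fst Y - l)"
    using form_val[OF \<xi>, of "[Y]"] Y by (simp add: algebra_simps)
  have 2: "\<eta> [X] \<in> A (fst X + fst Y - l)"
    using form_val[OF \<eta>, of "[X]"] X by (simp add: algebra_simps)
  have sk: "\<Theta> [Y, X] = - (sg (fst Y * fst X) *\<^sub>R \<Theta> [X, Y])"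
    using formD(6)[OF \<Theta> Y X, of "[]" "[]"] by simp
  have e: "snd Q (\<xi> [Y] + sg (fst X * fst Y) *\<^sub>R \<eta> [X]) =
      snd Q (\<xi> [Y]) + sg (fst X * fst Y) *\<^sub>R snd Q (\<eta> [X])"
    by (simp add: vfieldD(2)[OF Q 1 A_scale[OF 2]] vfieldD(3)[OF Q 2])
  show ?thesis
    by (simp add: snd_vops twisted_lie_def pairing_def e nat_lie_1form[OF Q X] nat_lie_1form[OF Q Y] sk Q1 j,
      cases "even l"; cases "even (fst X)"; cases "even (fst Y)"; simp add: sg_def algebra_simps)
qed

text \<open>
  The factor \<open>(-1)\<^bsup>|f|l\<^esup>\<close> with which \<open>f\<close> acts on \<open>X\<close> turns the sign \<open>(-1)\<^bsup>|f||\<Theta>|\<^esup>\<close>, where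
  \<open>|\<Theta>| = 1 - l\<close>, into the sign \<open>(-1)\<^bsup>|f|\<^esup>\<close> of an operator of degree \<open>1\<close>.
\<close>

lemma twisted_lie_smult:
  assumes \<psi>: "(X, \<xi>) \<in> sections A l j" and f: "f \<in> A i"
  shows "twisted_lie A l Q \<Theta> (smult l i f (X, \<xi>)) =
    sadd (sscale (sg i) (smult l i f (twisted_lie A l Q \<Theta> (X, \<xi>))))
      (smult l (i + 1) (snd (vscale (sg l) Q) f) (X, \<xi>))"
proof -
  have X: "X \<in> vfields A" and j: "j = fst X - l" and \<xi>: "\<xi> \<in> forms A 1 (fst X - l)"
    using \<psi> by (auto simp: sections_def)
  have v: "vbracket Q (vscale (sg (i * l)) (vmult i f X)) =
      vadd (vscale (sg i) (vscale (sg (i * l)) (vmult i f (vbracket Q X))))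
        (vscale (sg ((i + 1) * l)) (vmult (i + 1) (sg l *\<^sub>R snd Q f) X))"
    unfolding vbracket_vscale(1)[OF Q vmult_in[OF X f]] vbracket_vmult[OF Q X f]
    by (cases "even l"; cases "even i"; simp add: vadd_def vscale_def vmult_def Q1 sg_def algebra_simps)
  have fx: "nat_lie A (i + fst X - l) Q (\<lambda>Vs. f * \<xi> Vs) =
      (\<lambda>Ws. snd Q f * \<xi> Ws + sg i *\<^sub>R (f * nat_lie A (fst X - l) Q \<xi> Ws))"
    using nat_lie_fmult[OF \<xi> f Q] by (simp add: Q1 add_diff_eq)
  have t: "\<Theta> (vscale (sg (i * l)) (vmult i f X) # Vs) = sg i *\<^sub>R (f * \<Theta> (X # Vs))" for Vs
    using formD(4)[OF \<Theta> vmult_in[OF X f], of "[]"] formD(5)[OF \<Theta> f X]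
    by (cases "even l"; cases "even i"; simp add: sg_def)
  show ?thesis
    by (simp add: twisted_lie_def smult_def sadd_def sscale_def v fx t snd_vops fun_eq_iff
        scaleR_right_distrib distrib_left mult.commute)
qed

text \<open>
  The two terms with \<open>\<Theta>\<close>, namely \<open>L\<^sub>Q (\<Theta>(X, \<cdot>))\<close> and \<open>(-1)\<^sup>l \<Theta>([Q, X], \<cdot>)\<close>, combine to the Lie
  derivative of \<open>\<Theta>\<close> itself.
\<close>

lemma twisted_lie_square:
  assumes \<psi>: "(X, \<xi>) \<in> sections A l j"
  shows "twisted_lie A l Q \<Theta> (twisted_lie A l Q \<Theta> (X, \<xi>)) = (vbracket Q (vbracket Q X),
    \<lambda>Vs. nat_lie A (fst X + 1 - l) Q (nat_lie A (fst X - l) Q \<xi>) Vs + nat_lie A (1 - l) Q \<Theta> (X # Vs))"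
proof -
  have X: "X \<in> vfields A" and \<xi>: "\<xi> \<in> forms A 1 (fst X - l)"
    using \<psi> by (auto simp: sections_def)
  note 1 = nat_lie_1form_in[OF X \<xi>] and 2 = Theta_contract_in[OF X]
  have 3: "nat_lie A (fst X + 1 - l) Q (\<lambda>Vs. \<Theta> (X # Vs)) Vs =
      nat_lie A (1 - l) Q \<Theta> (X # Vs) + sg (1 - l) *\<^sub>R \<Theta> (vbracket Q X # Vs)" for Vs
    using nat_lie_contract[OF Theta_Suc_Suc Q X, of Vs] by (simp add: Q1 algebra_simps)
  show ?thesis
    unfolding twisted_lie_def prod.case fst_vops Q1 add.commute[of 1 "fst X"]
      nat_lie_scale[OF form_add_in[OF 1 2]] nat_lie_add[OF 1 2] 3
    by (cases "even l"; simp add: sg_def)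
qed

lemma vbracket_odd_square:
  assumes X: "X \<in> vfields A"
  shows "vbracket (vbracket Q Q) X = vscale 2 (vbracket Q (vbracket Q X))"
proof -
  have "snd (vbracket Q (vbracket Q X)) f =
      snd (vbracket (vbracket Q Q) X) f - snd (vbracket Q (vbracket Q X)) f" for f
    using arg_cong[OF vbracket_jacobi[OF Q Q X], of "\<lambda>V. snd V f"]
    by (simp only: snd_vops(1,2) Q1) (simp add: sg_def)
  then show ?thesis
    by (intro prod_eqI) (simp_all add: snd_vops(2) fun_eq_iff scaleR_2 diff_eq_eq[symmetric] eq_diff_eq)
qed

lemma nat_lie_odd_square:
  assumes w: "\<omega> \<in> forms A p j"
  shows "nat_lie A j (vbracket Q Q) \<omega> Vs = 2 *\<^sub>R nat_lie A (j + 1) Q (nat_lie A j Q \<omega>) Vs"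
  unfolding nat_lie_nat_lie[OF Q Q w] by (simp add: Q1 sg_def scaleR_2)

text \<open>
  Applying the square to \<open>(E, 0)\<close> with the Euler vector field \<open>E\<close> isolates \<open>[Q, Q]\<close>:
  the first component is \<open>[Q, [Q, E]]\<close>, which is half of \<open>[[Q, Q], E] = - 2 [Q, Q]\<close>.
\<close>

lemma twisted_lie_square_0_iff:
  "(\<forall>j. \<forall>\<psi> \<in> sections A l j.
      twisted_lie A l Q \<Theta> (twisted_lie A l Q \<Theta> \<psi>) = ((j + 2 + l, \<lambda>f. 0), \<lambda>Vs. 0)) \<longleftrightarrow>
    vbracket Q Q = (2, \<lambda>f. 0) \<and> nat_lie A (1 - l) Q \<Theta> = (\<lambda>Vs. 0)"
    (is "?L \<longleftrightarrow> ?R")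
proof
  assume L: ?L
  have 0: "vbracket Q (vbracket Q X) = (fst X + 2, \<lambda>f. 0)" "nat_lie A (1 - l) Q \<Theta> (X # Vs) = 0"
    if X: "X \<in> vfields A" for X Vs
    using L[rule_format, OF sections_0_in[OF X]]
    unfolding twisted_lie_square[OF sections_0_in[OF X]] by (simp_all add: fun_eq_iff)
  have "vbracket Q Q = (fst (vbracket Q Q), \<lambda>f. 0)"
    by (rule eq_0_of_bracket_euler_field[OF vbracket_in[OF Q Q]])
      (simp_all add: Q1 vbracket_odd_square[OF euler_field_in] 0[OF euler_field_in] snd_vops)
  moreover have "nat_lie A (1 - l) Q \<Theta> Vs = 0" for Vs
  proof (cases Vs)
    case Nil
    then show ?thesis using formD(2)[OF \<Theta>, of "[]"] Q by (simp add: nat_lie_Nil)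
  next
    case (Cons V Ws)
    then show ?thesis using 0(2) by (cases "V \<in> vfields A") (simp_all add: nat_lie_outside)
  qed
  ultimately show ?R by (simp add: Q1 fun_eq_iff)
next
  assume R: ?R
  show ?L
  proof (intro allI ballI)
    fix j \<psi> assume \<psi>: "\<psi> \<in> sections A l j"
    then obtain X \<xi> where \<psi>_eq: "\<psi> = (X, \<xi>)" and X: "X \<in> vfields A" and j: "fst X = j + l"
      and \<xi>: "\<xi> \<in> forms A 1 (fst X - l)"
      by (auto simp: sections_def)
    have Q0: "vbracket Q Q = vscale 0 (2, \<lambda>f. 0)"
      using R by (simp add: vscale_def)
    have "nat_lie A (fst X - l) (vbracket Q Q) \<xi> Vs = 0" for Vs
      unfolding Q0 nat_lie_vscale[OF vfield_0_in \<xi>] by simp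
    then have "nat_lie A (fst X + 1 - l) Q (nat_lie A (fst X - l) Q \<xi>) Vs = 0" for Vs
      unfolding nat_lie_odd_square[OF \<xi>] by (simp add: algebra_simps)
    moreover have "vscale 2 (vbracket Q (vbracket Q X)) = vscale 2 (2 + fst X, \<lambda>f. 0)"
      unfolding vbracket_odd_square[OF X, symmetric] Q0 vbracket_vscale(2)[OF X vfield_0_in]
      by (simp add: vscale_def)
    then have "vbracket Q (vbracket Q X) = (2 + fst X, \<lambda>f. 0)"
      by (simp add: vscale_def prod_eq_iff fun_eq_iff)
    ultimately show "twisted_lie A l Q \<Theta> (twisted_lie A l Q \<Theta> \<psi>) = ((j + 2 + l, \<lambda>f. 0), \<lambda>Vs. 0)"
      using R \<psi> by (simp add: \<psi>_eq twisted_lie_square j)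
  qed
qed

text \<open>
  The derivation rule fails by one exact \<open>3\<close>-form. Terms with \<open>\<eta>\<close> cancel by \<open>L\<^bsub>[Q,X]\<^esub> = [L\<^sub>Q, L\<^sub>X]\<close>, terms with
  \<open>\<xi>\<close> because \<open>L\<^sub>Q\<close> commutes with \<open>d\<close> and because of the rule for \<open>[L\<^sub>Q, i\<^sub>Y]\<close>. The terms with \<open>H\<close> add up
  to \<open>L\<^sub>Q H = - d i\<^sub>Q H\<close>, and those with \<open>\<Theta>\<close> are Cartan's expansion of \<open>d\<Theta>\<close>.
\<close>

lemma twisted_lie_dorfman:
  assumes H: "H \<in> forms A 3 (- l)" and dH: "ext_d A (- l) H = (\<lambda>Vs. 0)"
    and \<psi>: "(X, \<xi>) \<in> sections A l j" and \<psi>': "(Y, \<eta>) \<in> sections A l k"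
  defines "\<delta> \<equiv> sadd (dorfman A l H (twisted_lie A l Q \<Theta> (X, \<xi>)) (Y, \<eta>))
      (sscale (sg (j + l)) (dorfman A l H (X, \<xi>) (twisted_lie A l Q \<Theta> (Y, \<eta>))))"
  shows "fst (twisted_lie A l Q \<Theta> (dorfman A l H (X, \<xi>) (Y, \<eta>))) = fst \<delta>" (is ?fst)
    and "snd (twisted_lie A l Q \<Theta> (dorfman A l H (X, \<xi>) (Y, \<eta>))) Vs =
      snd \<delta> Vs + ext_d A (1 - l) (\<lambda>Vs. \<Theta> Vs - iprod (- l) Q H Vs) (X # Y # Vs)" (is ?snd)
proof -
  have X: "X \<in> vfields A" and j: "j + l = fst X" and \<xi>: "\<xi> \<in> forms A 1 (fst X - l)"
    and Y: "Y \<in> vfields A" and \<eta>: "\<eta> \<in> forms A 1 (fst Y - l)"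
    using \<psi> \<psi>' by (auto simp: sections_def)
  show ?fst
    unfolding \<delta>_def twisted_lie_def dorfman_def sadd_def sscale_def prod.case fst_conv
    using vbracket_jacobi[OF Q X Y] by (simp add: j Q1)
  define a b where "a = fst X" and "b = fst Y"
  note \<xi> = \<xi>[folded a_def] and \<eta> = \<eta>[folded b_def]
  have H': "H \<in> forms A (Suc (Suc 1)) (- l)" using H by (simp add: eval_nat_numeral)
  have HX: "(\<lambda>Vs. H (X # Vs)) \<in> forms A (Suc 1) (a - l)"
    using contract_in[OF H' X] by (simp add: a_def)
  have HXY: "(\<lambda>Vs. H (X # Y # Vs)) \<in> forms A 1 (a + b - l)"
    using contract_in[OF HX Y] by (simp add: algebra_simps b_def)
  have d\<xi>: "ext_d A (a - l) \<xi> \<in> forms A (Suc 1) (a - l)"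
    using ext_d_in[OF \<xi>] by simp
  have d\<xi>Y: "(\<lambda>Vs. ext_d A (a - l) \<xi> (Y # Vs)) \<in> forms A 1 (a + b - l)"
    using contract_in[OF d\<xi> Y] by (simp add: algebra_simps b_def)
  have L\<eta>: "nat_lie A (b - l) X \<eta> \<in> forms A 1 (a + b - l)"
    using nat_lie_in[OF X \<eta>] by (simp add: algebra_simps a_def)
  have L\<xi>: "nat_lie A (a - l) Q \<xi> \<in> forms A 1 (a + 1 - l)"
    and \<alpha>X: "(\<lambda>Vs. \<Theta> (X # Vs)) \<in> forms A 1 (a + 1 - l)"
    using nat_lie_1form_in[OF X \<xi>[unfolded a_def]] Theta_contract_in[OF X] by (simp_all add: a_def)
  have LQ\<eta>: "nat_lie A (b - l) Q \<eta> \<in> forms A 1 (b + 1 - l)"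
    and \<alpha>Y: "(\<lambda>Vs. \<Theta> (Y # Vs)) \<in> forms A 1 (b + 1 - l)"
    using nat_lie_1form_in[OF Y \<eta>[unfolded b_def]] Theta_contract_in[OF Y] by (simp_all add: b_def)
  \<comment> \<open>The left-hand side contains \<open>L\<^sub>Q\<close> of each term of the bracket; each is commuted past the
    operation in that term, to match a term on the right.\<close>
  have LL\<eta>: "nat_lie A (a + b - l) Q (nat_lie A (b - l) X \<eta>) Vs =
      nat_lie A (b - l) (vbracket Q X) \<eta> Vs + sg a *\<^sub>R nat_lie A (b + 1 - l) X (nat_lie A (b - l) Q \<eta>) Vs"
    using nat_lie_nat_lie[OF Q X \<eta>, of Vs] by (simp add: Q1 a_def algebra_simps)
  have Ld\<xi>: "nat_lie A (a + b - l) Q (\<lambda>Vs. ext_d A (a - l) \<xi> (Y # Vs)) Vs =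
      - ext_d A (a + 1 - l) (nat_lie A (a - l) Q \<xi>) (Y # Vs)
      + sg (a - l) *\<^sub>R ext_d A (a - l) \<xi> (vbracket Q Y # Vs)"
    using nat_lie_contract[OF d\<xi> Q Y, of Vs] nat_lie_ext_d[OF Q \<xi>, of "Y # Vs"]
    by (simp add: Q1 b_def algebra_simps sg_def)
  have LHX: "nat_lie A (a + b - l) Q (\<lambda>Vs. H (X # Y # Vs)) Vs =
      nat_lie A (- l) Q H (X # Y # Vs) + sg l *\<^sub>R H (vbracket Q X # Y # Vs)
      + sg (a - l) *\<^sub>R H (X # vbracket Q Y # Vs)"
    using nat_lie_contract[OF HX Q Y, of Vs] nat_lie_contract[OF H' Q X, of "Y # Vs"]
    by (simp add: Q1 a_def b_def algebra_simps sg_def)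
  have Ld: "nat_lie A (a + b - l) Q (\<lambda>Vs. c1 *\<^sub>R nat_lie A (b - l) X \<eta> Vs
        - c2 *\<^sub>R (c3 *\<^sub>R ext_d A (a - l) \<xi> (Y # Vs)) + c4 *\<^sub>R H (X # Y # Vs)) Vs =
      c1 *\<^sub>R nat_lie A (a + b - l) Q (nat_lie A (b - l) X \<eta>) Vs
      - c2 *\<^sub>R (c3 *\<^sub>R nat_lie A (a + b - l) Q (\<lambda>Vs. ext_d A (a - l) \<xi> (Y # Vs)) Vs)
      + c4 *\<^sub>R nat_lie A (a + b - l) Q (\<lambda>Vs. H (X # Y # Vs)) Vs" for c1 c2 c3 c4
    by (simp only: nat_lie_add[OF form_diff_in[OF form_scale_in[OF L\<eta>]
          form_scale_in[OF form_scale_in[OF d\<xi>Y]]] form_scale_in[OF HXY]]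
        nat_lie_diff[OF form_scale_in[OF L\<eta>] form_scale_in[OF form_scale_in[OF d\<xi>Y]]]
        nat_lie_scale[OF L\<eta>] nat_lie_scale[OF d\<xi>Y]
        nat_lie_scale[OF form_scale_in[OF d\<xi>Y]] nat_lie_scale[OF HXY])
  have dH': "nat_lie A (- l) Q H Ws = - ext_d A (1 - l) (iprod (- l) Q H) Ws" for Ws
    using fun_cong[OF iprod_ext_d[of "- l" Q A H], of Ws] by (simp add: dH Q1 sg_def eq_neg_iff_add_eq_0)
  have iH: "iprod (- l) Q H \<in> forms A 2 (1 - l)"
    using iprod_in[OF H' Q] by (simp add: Q1 numeral_2_eq_2)
  \<comment> \<open>All terms are now written in the same atoms, and only the comparison of signs is left.\<close>
  have lhs: "snd (twisted_lie A l Q \<Theta> (dorfman A l H (X, \<xi>) (Y, \<eta>))) Vs = sg l *\<^sub>R (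
      sg (a * l) *\<^sub>R (nat_lie A (b - l) (vbracket Q X) \<eta> Vs + sg a *\<^sub>R nat_lie A (b + 1 - l) X (nat_lie A (b - l) Q \<eta>) Vs)
      - sg (b * (a + l)) *\<^sub>R (sg ((a - l) * (b - 1)) *\<^sub>R (- ext_d A (a + 1 - l) (nat_lie A (a - l) Q \<xi>) (Y # Vs)
      + sg (a - l) *\<^sub>R ext_d A (a - l) \<xi> (vbracket Q Y # Vs)))
      + sg l *\<^sub>R (nat_lie A (- l) Q H (X # Y # Vs) + sg l *\<^sub>R H (vbracket Q X # Y # Vs)
      + sg (a - l) *\<^sub>R H (X # vbracket Q Y # Vs))
      + \<Theta> (vbracket X Y # Vs))"
    unfolding twisted_lie_def dorfman_def prod.case snd_conv fst_vops a_def[symmetric] b_def[symmetric]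
      lie_eq_nat_lie iprod_def[of "a - l"] Ld LL\<eta> Ld\<xi> LHX ..
  have rhs: "snd \<delta> Vs =
      sg ((a + 1) * l) *\<^sub>R nat_lie A (b - l) (vbracket Q X) \<eta> Vs
      - sg (b * (a + 1 + l)) *\<^sub>R (sg ((a + 1 - l) * (b - 1)) *\<^sub>R (sg l *\<^sub>R (ext_d A (a + 1 - l) (nat_lie A (a - l) Q \<xi>) (Y # Vs)
        + ext_d A (a + 1 - l) (\<lambda>Vs. \<Theta> (X # Vs)) (Y # Vs))))
      + sg l *\<^sub>R H (vbracket Q X # Y # Vs)
      + sg a *\<^sub>R (sg (a * l) *\<^sub>R (sg l *\<^sub>R (nat_lie A (b + 1 - l) X (nat_lie A (b - l) Q \<eta>) Vs +
          nat_lie A (b + 1 - l) X (\<lambda>Vs. \<Theta> (Y # Vs)) Vs))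
        - sg ((b + 1) * (a + l)) *\<^sub>R (sg ((a - l) * b) *\<^sub>R ext_d A (a - l) \<xi> (vbracket Q Y # Vs))
        + sg l *\<^sub>R H (X # vbracket Q Y # Vs))"
    unfolding \<delta>_def twisted_lie_def dorfman_def sadd_def sscale_def prod.case snd_conv fst_vops Q1
      a_def[symmetric] b_def[symmetric] lie_eq_nat_lie iprod_def
      add.commute[of 1 a] add.commute[of 1 b] j[folded a_def] add_diff_cancel_right'
      nat_lie_scale[OF form_add_in[OF LQ\<eta> \<alpha>Y]] nat_lie_add[OF LQ\<eta> \<alpha>Y]
      ext_d_scale[OF form_add_in[OF L\<xi> \<alpha>X]] ext_d_add[OF L\<xi> \<alpha>X] ..
  have e: "1 - l + b = b + 1 - l" "1 - l + a = a + 1 - l" by simp_all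
  show ?snd
    unfolding lhs rhs ext_d_diff[OF \<Theta> iH] dH' ext_d_2form[OF \<Theta> X Y] a_def[symmetric] b_def[symmetric] e
    by (cases "even l"; cases "even a"; cases "even b"; simp add: sg_def algebra_simps)
qed

end

end

context graded_comm_algebra
begin

lemma smult_in:
  assumes f: "f \<in> A i" and \<psi>: "\<psi> \<in> sections A l j"
  shows "smult l i f \<psi> \<in> sections A l (i + j)"
proof -
  obtain X \<xi> where eq: "\<psi> = (X, \<xi>)" and X: "X \<in> vfields A" and j: "fst X = j + l" and \<xi>: "\<xi> \<in> forms A 1 j"
    using \<psi> by (auto simp: sections_def)
  show ?thesis
    using form_fmult_in[OF f \<xi>] by (simp add: eq sections_def smult_def vscale_in vmult_in X f j)
qed

lemma dorfman_in:
  assumes H: "H \<in> forms A 3 (- l)" and \<psi>: "\<psi> \<in> sections A l j" and \<psi>': "\<psi>' \<in> sections A l k"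
  shows "dorfman A l H \<psi> \<psi>' \<in> sections A l (j + k + l)"
proof -
  obtain X \<xi> Y \<eta> where eq: "\<psi> = (X, \<xi>)" "\<psi>' = (Y, \<eta>)"
    and X: "X \<in> vfields A" and j: "fst X = j + l" and \<xi>: "\<xi> \<in> forms A 1 j"
    and Y: "Y \<in> vfields A" and k: "fst Y = k + l" and \<eta>: "\<eta> \<in> forms A 1 k"
    using \<psi> \<psi>' by (auto simp: sections_def)
  have H': "H \<in> forms A (Suc (Suc 1)) (- l)" using H by (simp add: eval_nat_numeral)
  have "lie A k X \<eta> \<in> forms A 1 (j + k + l)"
    using nat_lie_in[OF X \<eta>] by (simp add: lie_eq_nat_lie j algebra_simps)
  moreover have "iprod j Y (ext_d A j \<xi>) \<in> forms A 1 (j + k + l)"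
    using iprod_in[OF ext_d_in[OF \<xi>] Y] by (simp add: k algebra_simps)
  moreover have "(\<lambda>Vs. H (X # Y # Vs)) \<in> forms A 1 (j + k + l)"
    using contract_in[OF contract_in[OF H' X] Y] by (simp add: j k algebra_simps)
  ultimately show ?thesis
    using vbracket_in[OF X Y]
    by (simp add: eq dorfman_def sections_def j k form_add_in form_diff_in form_scale_in)
qed

section \<open>Characterisation of differentials\<close>

text \<open>
  The form \<open>\<Theta>\<close> is read off from the operator on sections \<open>(X, 0)\<close>. Pairing with \<open>(Y, 0)\<close> in condition
  (iii) yields both its skew symmetry and, together with that, the second component on all of
  \<open>(X, \<xi>)\<close>.
\<close>

lemma ex_twisted_lie:
  assumes Q: "Q \<in> vfields A" and Q1: "fst Q = 1"
    and cd: "courant_differential A l H \<Delta> (vscale (sg l) Q)"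
  obtains \<Theta> where "\<Theta> \<in> forms A 2 (1 - l)"
    and "\<And>j \<psi>. \<psi> \<in> sections A l j \<Longrightarrow> \<Delta> \<psi> = twisted_lie A l Q \<Theta> \<psi>"
proof -
  define \<beta> where "\<beta> X = snd (\<Delta> (X, \<lambda>Vs. 0))" for X
  define \<Theta> where "\<Theta> Vs = (case Vs of [] \<Rightarrow> 0 |
    X # Ws \<Rightarrow> if X \<in> vfields A then sg l *\<^sub>R \<beta> X Ws else 0)" for Vs
  have lin: "linear_degree_1 A l \<Delta>"
    using cd by (simp add: courant_differential_def)
  then have deg: "\<Delta> \<psi> \<in> sections A l (j + 1)" if "\<psi> \<in> sections A l j" for \<psi> j
    using that by (simp add: linear_degree_1_def)
  have anchor: "fst (\<Delta> (X, \<xi>)) = vbracket Q X" if "(X, \<xi>) \<in> sections A l j" for X \<xi> j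
  proof -
    have X: "X \<in> vfields A" using that by (simp add: sections_def)
    have "anchor (\<Delta> (X, \<xi>)) = vscale (sg l) (vbracket (vscale (sg l) Q) (anchor (X, \<xi>)))"
      using cd that unfolding courant_differential_def by blast
    moreover have "vscale (sg l) (vscale (sg l) V) = V" for V :: "'f hvf"
      by (rule prod_eqI) (simp_all add: snd_vops)
    ultimately show ?thesis
      by (simp add: anchor_def vbracket_vscale(2)[OF X Q] case_prod_beta)
  qed
  have \<Delta>0: "\<Delta> (X, \<lambda>Vs. 0) = (vbracket Q X, \<beta> X)" if "X \<in> vfields A" for X
    using anchor[OF sections_0_in[OF that]] by (simp add: \<beta>_def prod_eq_iff)
  have \<beta>: "\<beta> X \<in> forms A 1 (fst X + 1 - l)" if X: "X \<in> vfields A" for X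
    using deg[OF sections_0_in[OF X, of l]] by (simp add: \<Delta>0[OF X] sections_def algebra_simps)
  have pair: "sg l *\<^sub>R snd Q (\<xi> [Y]) = snd (\<Delta> (X, \<xi>)) [Y] + sg (fst X) *\<^sub>R
      (\<xi> [vbracket Q Y] + sg (fst X * (fst Y + 1)) *\<^sub>R \<beta> Y [X])"
    if \<psi>: "(X, \<xi>) \<in> sections A l j" and Y: "Y \<in> vfields A" for X \<xi> j Y
  proof -
    have "snd (vscale (sg l) Q) (pairing (X, \<xi>) (Y, \<lambda>Vs. 0)) =
        pairing (\<Delta> (X, \<xi>)) (Y, \<lambda>Vs. 0) + sg (j + l) *\<^sub>R pairing (X, \<xi>) (\<Delta> (Y, \<lambda>Vs. 0))"
      using cd \<psi> sections_0_in[OF Y, of l] unfolding courant_differential_def by blast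
    moreover have "j + l = fst X" using \<psi> by (simp add: sections_def)
    ultimately show ?thesis
      by (simp add: pairing_def \<Delta>0[OF Y] snd_vops Q1 case_prod_beta add.commute)
  qed
  have skew: "\<beta> X [Y] = - (sg (fst X * fst Y) *\<^sub>R \<beta> Y [X])" if X: "X \<in> vfields A" and Y: "Y \<in> vfields A" for X Y
    using pair[OF sections_0_in[OF X] Y] Q
    by (cases "even (fst X)"; cases "even (fst Y)";
        simp add: \<Delta>0[OF X] sg_def eq_neg_iff_add_eq_0)
  have iprod: "iprod (1 - l) X \<Theta> = (\<lambda>Vs. (sg ((1 - l) * (fst X - 1)) * sg l) *\<^sub>R \<beta> X Vs)"
    if "X \<in> vfields A" for X
    using that by (simp add: iprod_def \<Theta>_def)
  have \<Theta>: "\<Theta> \<in> forms A (Suc 1) (1 - l)"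
  proof (rule form_SucI)
    show "iprod (1 - l) V \<Theta> \<in> forms A 1 (1 - l + fst V)" if V: "V \<in> vfields A" for V
      using form_scale_in[OF \<beta>[OF V]] by (simp add: iprod[OF V] algebra_simps)
    show "iprod (1 - l) (vadd V W) \<Theta> Vs = iprod (1 - l) V \<Theta> Vs + iprod (1 - l) W \<Theta> Vs"
      if V: "V \<in> vfields A" and W: "W \<in> vfields A" and eq: "fst V = fst W" for V W Vs
    proof -
      have "\<Delta> (sadd (V, \<lambda>Vs. 0) (W, \<lambda>Vs. 0)) = sadd (\<Delta> (V, \<lambda>Vs. 0)) (\<Delta> (W, \<lambda>Vs. 0))"
        using lin sections_0_in[OF V, of l] sections_0_in[OF W, of l] eq
        unfolding linear_degree_1_def by metis
      then have "\<beta> (vadd V W) Vs = \<beta> V Vs + \<beta> W Vs"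
        by (simp add: sadd_def \<Delta>0 V W vadd_in[OF V W eq])
      then show ?thesis
        by (simp add: iprod V W vadd_in[OF V W eq] eq scaleR_right_distrib)
    qed
    have scale: "\<beta> (vscale c V) Vs = c *\<^sub>R \<beta> V Vs" if V: "V \<in> vfields A" for V c Vs
    proof -
      have "\<Delta> (sscale c (V, \<lambda>Vs. 0)) = sscale c (\<Delta> (V, \<lambda>Vs. 0))"
        using lin sections_0_in[OF V, of l] unfolding linear_degree_1_def by metis
      then show ?thesis
        by (simp add: sscale_def \<Delta>0 V vscale_in[OF V])
    qed
    show "iprod (1 - l) (vscale c V) \<Theta> Vs = c *\<^sub>R iprod (1 - l) V \<Theta> Vs" if V: "V \<in> vfields A" for V c Vs
      by (simp add: iprod V vscale_in[OF V] scale[OF V])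
    show "iprod (1 - l) (vmult i f V) \<Theta> Vs = f * iprod (1 - l) V \<Theta> Vs"
      if V: "V \<in> vfields A" and f: "f \<in> A i" for V f i Vs
    proof -
      note fV = vmult_in[OF V f]
      have "\<Delta> (smult l i f (V, \<lambda>Vs. 0)) = sadd (sscale (sg i) (smult l i f (\<Delta> (V, \<lambda>Vs. 0))))
          (smult l (i + 1) (snd (vscale (sg l) Q) f) (V, \<lambda>Vs. 0))"
        using cd sections_0_in[OF V, of l] f unfolding courant_differential_def by blast
      then have "sg (i * l) *\<^sub>R \<beta> (vmult i f V) Vs = sg i *\<^sub>R (f * \<beta> V Vs)"
        by (simp add: smult_def sadd_def sscale_def \<Delta>0 V vscale_in[OF fV] flip: scale[OF fV])
      then show ?thesis
        by (cases "even i"; cases "even l"; cases "even (fst V)"; simp add: iprod V fV sg_def)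
    qed
    show "iprod (1 - l + fst V) U (iprod (1 - l) V \<Theta>) Vs =
        sg ((fst U - 1) * (fst V - 1)) *\<^sub>R iprod (1 - l + fst U) V (iprod (1 - l) U \<Theta>) Vs"
      if U: "U \<in> vfields A" and V: "V \<in> vfields A" for U V Vs
    proof (cases Vs)
      case Nil
      then show ?thesis
        using skew[OF U V] unfolding iprod[OF U] iprod[OF V]
        by (cases "even l"; cases "even (fst U)"; cases "even (fst V)"; simp add: iprod_def sg_def)
    next
      case Cons
      then show ?thesis
        unfolding iprod[OF U] iprod[OF V]
        using formD(2)[OF \<beta>[OF U], of "V # Vs"] formD(2)[OF \<beta>[OF V], of "U # Vs"]
        by (simp add: iprod_def)
    qed
  qed (simp_all add: \<Theta>_def)
  then have \<Theta>2: "\<Theta> \<in> forms A 2 (1 - l)" by (simp add: numeral_2_eq_2)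
  moreover have "\<Delta> \<psi> = twisted_lie A l Q \<Theta> \<psi>" if \<psi>: "\<psi> \<in> sections A l j" for j \<psi>
  proof -
    obtain X \<xi> where eq: "\<psi> = (X, \<xi>)" and X: "X \<in> vfields A" and j: "fst X = j + l"
      and \<xi>: "\<xi> \<in> forms A 1 j"
      using \<psi> by (auto simp: sections_def)
    have "snd (\<Delta> \<psi>) = snd (twisted_lie A l Q \<Theta> \<psi>)"
    proof (rule form_1_eqI)
      show "snd (\<Delta> \<psi>) \<in> forms A 1 (j + 1)"
        using deg[OF \<psi>] by (auto simp: sections_def)
      show "snd (twisted_lie A l Q \<Theta> \<psi>) \<in> forms A 1 (j + 1)"
        using twisted_lie_in[OF Q Q1 \<Theta>2 \<psi>] by (auto simp: sections_def)
      fix Y assume Y: "Y \<in> vfields A"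
      have "snd (\<Delta> (X, \<xi>)) [Y] = sg l *\<^sub>R snd Q (\<xi> [Y]) - sg (fst X) *\<^sub>R \<xi> [vbracket Q Y]
          - sg (fst X * fst Y) *\<^sub>R \<beta> Y [X]"
        unfolding pair[OF \<psi>[unfolded eq] Y]
        by (cases "even (fst X)"; cases "even (fst Y)"; simp add: sg_def)
      then show "snd (\<Delta> \<psi>) [Y] = snd (twisted_lie A l Q \<Theta> \<psi>) [Y]"
        using skew[OF X Y]
        by (simp add: eq twisted_lie_def nat_lie_1form[OF Q Y] Q1 \<Theta>_def X,
          cases "even (fst X)"; cases "even l"; simp add: sg_def)
    qed
    then show ?thesis
      using anchor[OF \<psi>[unfolded eq]] by (simp add: prod_eq_iff eq twisted_lie_def)
  qed
  ultimately show thesis by (rule that)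
qed

text \<open>
  For \<open>\<theta> = \<Theta> - i\<^sub>Q H\<close>, testing the bracket on sections \<open>(X, 0)\<close> and \<open>(Y, 0)\<close> already detects all values of
  \<open>d\<theta>\<close>.
\<close>

lemma courant_differential_iff:
  assumes H: "H \<in> forms A 3 (- l)" and dH: "ext_d A (- l) H = (\<lambda>Vs. 0)"
    and Q: "Q \<in> vfields A" and Q1: "fst Q = 1" and \<Theta>: "\<Theta> \<in> forms A 2 (1 - l)"
    and lin: "linear_degree_1 A l \<Delta>"
    and \<Delta>: "\<And>j \<psi>. \<psi> \<in> sections A l j \<Longrightarrow> \<Delta> \<psi> = twisted_lie A l Q \<Theta> \<psi>"
  shows "courant_differential A l H \<Delta> (vscale (sg l) Q) \<longleftrightarrow>
    vbracket Q Q = (2, \<lambda>f. 0) \<and> nat_lie A (1 - l) Q \<Theta> = (\<lambda>Vs. 0) \<and>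
    ext_d A (1 - l) (\<lambda>Vs. \<Theta> Vs - iprod (- l) Q H Vs) = (\<lambda>Vs. 0)"
    (is "_ \<longleftrightarrow> ?sq1 \<and> ?sq2 \<and> ?closed")
proof -
  let ?D = "vscale (sg l) Q" and ?\<theta> = "\<lambda>Vs. \<Theta> Vs - iprod (- l) Q H Vs"
  have deg: "\<Delta> \<psi> \<in> sections A l (j + 1)" if "\<psi> \<in> sections A l j" for \<psi> j
    using lin that by (auto simp: linear_degree_1_def)
  have square: "(\<forall>j. \<forall>\<psi> \<in> sections A l j. \<Delta> (\<Delta> \<psi>) = ((j + 2 + l, \<lambda>f. 0), \<lambda>Vs. 0)) \<longleftrightarrow> ?sq1 \<and> ?sq2"
    unfolding twisted_lie_square_0_iff[OF Q Q1 \<Theta>, symmetric]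
    by (intro all_cong1 ball_cong refl) (metis \<Delta> deg)
  have smult: "\<Delta> (smult l i f \<psi>) =
        sadd (sscale (sg i) (smult l i f (\<Delta> \<psi>))) (smult l (i + 1) (snd ?D f) \<psi>)"
    if "f \<in> A i" "\<psi> \<in> sections A l j" for i j f \<psi>
    using twisted_lie_smult[OF Q Q1 \<Theta>, of "fst \<psi>" "snd \<psi>" j f i] that
    by (simp add: \<Delta>[OF smult_in[OF that]] \<Delta>[OF that(2)])
  have pair: "snd ?D (pairing \<psi> \<psi>') = pairing (\<Delta> \<psi>) \<psi>' + sg (j + l) *\<^sub>R pairing \<psi> (\<Delta> \<psi>')"
    if "\<psi> \<in> sections A l j" "\<psi>' \<in> sections A l k" for j k \<psi> \<psi>'
    using twisted_lie_pairing[OF Q Q1 \<Theta>, of "fst \<psi>" "snd \<psi>" j "fst \<psi>'" "snd \<psi>'" k] that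
    by (simp add: \<Delta>[OF that(1)] \<Delta>[OF that(2)])
  have anchor: "anchor (\<Delta> \<psi>) = vscale (sg l) (vbracket ?D (anchor \<psi>))" if "\<psi> \<in> sections A l j" for j \<psi>
    using that twisted_lie_anchor[OF Q Q1 \<Theta>, where X = "fst \<psi>" and \<xi> = "snd \<psi>"]
    by (simp add: \<Delta>[OF that] sections_def anchor_def case_prod_beta)
  have closed_iff: "?closed \<longleftrightarrow> (\<forall>X \<in> vfields A. \<forall>Y \<in> vfields A. \<forall>Vs. ext_d A (1 - l) ?\<theta> (X # Y # Vs) = 0)"
    (is "_ \<longleftrightarrow> ?closed'")
  proof
    assume 0: ?closed'
    have "iprod (- l) Q H \<in> forms A (3 - 1) (- l + fst Q)"
      by (rule iprod_in'[OF H Q])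
    then have "?\<theta> \<in> forms A 2 (1 - l)"
      by (intro form_diff_in \<Theta>) (simp add: Q1)
    then have d: "ext_d A (1 - l) ?\<theta> \<in> forms A 3 (1 - l)"
      using ext_d_in[of ?\<theta> 2] by simp
    have "ext_d A (1 - l) ?\<theta> Vs = 0" for Vs
    proof (cases "length Vs = 3 \<and> set Vs \<subseteq> vfields A")
      case True
      then show ?thesis using 0 by (auto simp: eval_nat_numeral length_Suc_conv)
    next
      case False
      then show ?thesis using formD(2)[OF d] by blast
    qed
    then show ?closed by (rule ext)
  qed simp
  have br: "\<Delta> (dorfman A l H (X, \<xi>) (Y, \<eta>)) =
        sadd (dorfman A l H (\<Delta> (X, \<xi>)) (Y, \<eta>)) (sscale (sg (j + l)) (dorfman A l H (X, \<xi>) (\<Delta> (Y, \<eta>))))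
      \<longleftrightarrow> (\<forall>Vs. ext_d A (1 - l) ?\<theta> (X # Y # Vs) = 0)"
    if \<psi>: "(X, \<xi>) \<in> sections A l j" and \<psi>': "(Y, \<eta>) \<in> sections A l k" for X \<xi> j Y \<eta> k
    unfolding \<Delta>[OF dorfman_in[OF H \<psi> \<psi>']] \<Delta>[OF \<psi>] \<Delta>[OF \<psi>']
      prod_eq_iff[of "twisted_lie A l Q \<Theta> (dorfman A l H (X, \<xi>) (Y, \<eta>))"] fun_eq_iff
      twisted_lie_dorfman[OF Q Q1 \<Theta> H dH \<psi> \<psi>'] by simp
  have bracket: "(\<forall>j k. \<forall>\<psi> \<in> sections A l j. \<forall>\<psi>' \<in> sections A l k. \<Delta> (dorfman A l H \<psi> \<psi>') =
      sadd (dorfman A l H (\<Delta> \<psi>) \<psi>') (sscale (sg (j + l)) (dorfman A l H \<psi> (\<Delta> \<psi>')))) \<longleftrightarrow> ?closed"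
    (is "?B \<longleftrightarrow> _")
  proof
    assume B: ?B
    show ?closed
      unfolding closed_iff
    proof (intro ballI)
      fix X Y assume X: "X \<in> vfields A" and Y: "Y \<in> vfields A"
      note 0 = sections_0_in[OF X, of l] sections_0_in[OF Y, of l]
      show "\<forall>Vs. ext_d A (1 - l) ?\<theta> (X # Y # Vs) = 0"
        using B 0 unfolding br[OF 0, symmetric] by blast
    qed
  next
    assume C: ?closed
    show ?B
    proof (intro allI ballI)
      fix j k \<psi> \<psi>' assume "\<psi> \<in> sections A l j" "\<psi>' \<in> sections A l k"
      then show "\<Delta> (dorfman A l H \<psi> \<psi>') =
          sadd (dorfman A l H (\<Delta> \<psi>) \<psi>') (sscale (sg (j + l)) (dorfman A l H \<psi> (\<Delta> \<psi>')))"
        using br[of "fst \<psi>" "snd \<psi>" j "fst \<psi>'" "snd \<psi>'" k] C by simp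
    qed
  qed
  show ?thesis
    unfolding courant_differential_def square bracket
    using lin vscale_in[OF Q] Q1 smult pair anchor by auto
qed

text \<open>
  In the bracket of \<open>(Q, \<tau>)\<close> with \<open>(X, \<xi>)\<close>, the sign \<open>- (-1)\<^bsup>|X|(1 + l)\<^esup>\<close> before \<open>i\<^sub>X d\<tau>\<close> and the sign
  in \<open>i\<^sub>X\<close> multiply to \<open>(-1)\<^sup>l\<close>, the sign before \<open>\<Theta>(X, \<cdot>)\<close>.
\<close>

lemma twisted_lie_exact:
  assumes \<tau>: "\<tau> \<in> forms A 1 (1 - l)" and Q1: "fst Q = 1" and \<psi>: "(X, \<xi>) \<in> sections A l j"
  shows "twisted_lie A l Q (\<lambda>Vs. ext_d A (1 - l) \<tau> Vs + iprod (- l) Q H Vs) (X, \<xi>) =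
    dorfman A l H (Q, \<tau>) (X, \<xi>)"
  unfolding twisted_lie_def dorfman_def lie_eq_nat_lie prod.case Q1 iprod_def
  by (cases "even l"; cases "even (fst X)"; simp add: sg_def algebra_simps)

end

theorem mainTheorem5:
  fixes M :: "('p, 'f::real_algebra) graded_ringed_space"
    and n :: nat and ds :: "int list" and l :: int
    and H :: "'f form" and \<Delta> :: "'f esection \<Rightarrow> 'f esection" and D Q :: "'f hvf"
    and A :: "int \<Rightarrow> 'f set" and R :: "'f form \<Rightarrow> bool"
  defines "A \<equiv> global_functions M"
    and "Q \<equiv> vscale (sg l) D"
    and "R \<equiv> \<lambda>\<theta>.
      (\<forall>j. \<forall>(X, \<xi>) \<in> sections A l j.
        \<Delta> (X, \<xi>) = (vbracket Q X,
          \<lambda>Vs. sg l *\<^sub>R (lie A j Q \<xi> Vs + \<theta> (X # Vs) + H (Q # X # Vs)))) \<and>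
      ext_d A (1 - l) \<theta> = (\<lambda>Vs. 0) \<and>
      vbracket Q Q = (2, \<lambda>f. 0) \<and>
      lie A (1 - l) Q (\<lambda>Vs. \<theta> Vs + iprod (- l) Q H Vs) = (\<lambda>Vs. 0)"
  assumes "graded_manifold M n ds"
    and "H \<in> forms A 3 (- l)" and "ext_d A (- l) H = (\<lambda>Vs. 0)"
    and "linear_degree_1 A l \<Delta>"
    and "D \<in> vfields A" and "fst D = 1"
  shows "(courant_differential A l H \<Delta> D \<longleftrightarrow> (\<exists>\<theta> \<in> forms A 2 (1 - l). R \<theta>)) \<and>
    (l \<noteq> 1 \<and> courant_differential A l H \<Delta> D \<longrightarrow>
      (\<forall>\<theta> \<in> forms A 2 (1 - l). R \<theta> \<longrightarrow>
        (\<exists>\<tau> \<in> forms A 1 (1 - l). \<theta> = ext_d A (1 - l) \<tau> \<and>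
          (\<forall>j. \<forall>(X, \<xi>) \<in> sections A l j. \<Delta> (X, \<xi>) = dorfman A l H (Q, \<tau>) (X, \<xi>)))))"
proof -
  interpret graded_manifold M n ds by fact
  interpret alg: graded_comm_algebra A "unit M (topspace (base M))"
    using algebra[OF openin_topspace] by (simp add: A_def global_functions_def)
  have H: "H \<in> forms A 3 (- l)" and dH: "ext_d A (- l) H = (\<lambda>Vs. 0)" and lin: "linear_degree_1 A l \<Delta>"
    and D: "D \<in> vfields A" and D1: "fst D = 1"
    by fact+
  have Q: "Q \<in> vfields A" and Q1: "fst Q = 1" and D_eq: "D = vscale (sg l) Q"
    using alg.vscale_in[OF D] D1 by (simp_all add: Q_def prod_eq_iff snd_vops)
  define tw where "tw \<theta> = (\<lambda>Vs. \<theta> Vs + iprod (- l) Q H Vs)" for \<theta> :: "'f form"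
  have iH: "iprod (- l) Q H \<in> forms A 2 (1 - l)"
    using alg.iprod_in'[OF H Q] by (simp add: Q1)
  have tw_in: "tw \<theta> \<in> forms A 2 (1 - l)" if "\<theta> \<in> forms A 2 (1 - l)" for \<theta>
    unfolding tw_def by (rule alg.form_add_in[OF that iH])
  have formula: "(case \<psi> of (X, \<xi>) \<Rightarrow> \<Delta> (X, \<xi>) = (vbracket Q X,
      \<lambda>Vs. sg l *\<^sub>R (lie A j Q \<xi> Vs + \<theta> (X # Vs) + H (Q # X # Vs)))) \<longleftrightarrow>
      \<Delta> \<psi> = twisted_lie A l Q (tw \<theta>) \<psi>"
    if "\<psi> \<in> sections A l j" for j \<psi> \<theta>
    using that by (auto simp: twisted_lie_def tw_def sections_def alg.lie_eq_nat_lie iprod_def Q1 add.assoc)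
  have R_iff: "R \<theta> \<longleftrightarrow> (\<forall>j. \<forall>\<psi> \<in> sections A l j. \<Delta> \<psi> = twisted_lie A l Q (tw \<theta>) \<psi>) \<and>
      ext_d A (1 - l) \<theta> = (\<lambda>Vs. 0) \<and> vbracket Q Q = (2, \<lambda>f. 0) \<and> nat_lie A (1 - l) Q (tw \<theta>) = (\<lambda>Vs. 0)" for \<theta>
    unfolding R_def alg.lie_eq_nat_lie[of "1 - l"] tw_def[symmetric]
    by (intro arg_cong2[where f = "(\<and>)"] all_cong1 ball_cong refl formula)
  have iff: "courant_differential A l H \<Delta> D \<longleftrightarrow> R \<theta>"
    if \<theta>: "\<theta> \<in> forms A 2 (1 - l)" and \<Delta>: "\<And>j \<psi>. \<psi> \<in> sections A l j \<Longrightarrow> \<Delta> \<psi> = twisted_lie A l Q (tw \<theta>) \<psi>" for \<theta>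
  proof -
    have "(\<lambda>Vs. tw \<theta> Vs - iprod (- l) Q H Vs) = \<theta>" by (simp add: tw_def)
    with alg.courant_differential_iff[OF H dH Q Q1 tw_in[OF \<theta>] lin \<Delta>] \<Delta> show ?thesis
      unfolding R_iff D_eq by auto
  qed
  show ?thesis
  proof (intro conjI iffI impI ballI)
    assume cd: "courant_differential A l H \<Delta> D"
    obtain \<Theta> where \<Theta>: "\<Theta> \<in> forms A 2 (1 - l)"
      and \<Delta>: "\<And>j \<psi>. \<psi> \<in> sections A l j \<Longrightarrow> \<Delta> \<psi> = twisted_lie A l Q \<Theta> \<psi>"
      using alg.ex_twisted_lie[OF Q Q1 cd[unfolded D_eq]] by blast
    define \<theta> where "\<theta> = (\<lambda>Vs. \<Theta> Vs - iprod (- l) Q H Vs)"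
    have "\<theta> \<in> forms A 2 (1 - l)" "tw \<theta> = \<Theta>"
      unfolding \<theta>_def by (rule alg.form_diff_in[OF \<Theta> iH]) (simp add: tw_def)
    with iff[of \<theta>] \<Delta> cd show "\<exists>\<theta> \<in> forms A 2 (1 - l). R \<theta>" by blast
  next
    assume "\<exists>\<theta> \<in> forms A 2 (1 - l). R \<theta>"
    then show "courant_differential A l H \<Delta> D"
      using iff R_iff by blast
  next
    fix \<theta> assume l: "l \<noteq> 1 \<and> courant_differential A l H \<Delta> D" and \<theta>: "\<theta> \<in> forms A 2 (1 - l)" and R: "R \<theta>"
    have "\<theta> \<in> forms A (Suc 1) (1 - l)" using \<theta> by (simp add: numeral_2_eq_2)
    then obtain \<tau> where \<tau>: "\<tau> \<in> forms A 1 (1 - l)" and eq: "\<theta> = ext_d A (1 - l) \<tau>"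
      using alg.closed_form_exact[of \<theta> 1 "1 - l"] R l by (auto simp: R_iff)
    have "\<Delta> (X, \<xi>) = dorfman A l H (Q, \<tau>) (X, \<xi>)" if \<psi>: "(X, \<xi>) \<in> sections A l j" for j X \<xi>
      using R \<psi> alg.twisted_lie_exact[OF \<tau> Q1 \<psi>] by (auto simp: R_iff tw_def eq)
    with \<tau> eq show "\<exists>\<tau> \<in> forms A 1 (1 - l). \<theta> = ext_d A (1 - l) \<tau> \<and>
        (\<forall>j. \<forall>(X, \<xi>) \<in> sections A l j. \<Delta> (X, \<xi>) = dorfman A l H (Q, \<tau>) (X, \<xi>))"
      by blast
  qed
qed

end
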